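(* Let $n\ge1$ and let $m>m_1>\dots>m_n>0$ be integers with $\gcd(m,m_1,\dots,m_n)=1$. With the notation $Y$, $y^{(k)}_j$, $\chi_c$ defined in the context: (1) The space $Y$ coincides with the space of algebraic solutions, around the origin, to the Mellin system associated with $(m;m_1,\dots,m_n)$. Its dimension is $\dim Y = m^n-m^{n-1}+1$ if $m_1=m-1$, and $\dim Y = m^n-m^{n-1}$ otherwise. (2) The space of relations $$R=\Big\{c\in\mathbb{C}^{m^{n-1}} : \sum_{k=1}^{m^{n-1}} c^{(k)}\big(y^{(k)}_1+\dots+y^{(k)}_m\big)=0\Big\}$$ has dimension $\dim R=m^{n-1}-1$ if $m_1=m-1$, and $\dim R=m^{n-1}$ otherwise. (3) For any nonzero $c\in R$, the function $\chi_c$ is a non-algebraic solution to the Mellin system; the space $S=\{\chi_c : c\in R\}$ has dimension $\dim S=\dim R$; and the sum $S\oplus Y$ is direct and equals the full solution space of the Mellin system (around the origin).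
   Context: Put $m_j' = m-m_j$, $\theta_j = x_j\,\partial/\partial x_j$, $\varepsilon=e^{2\pi i/m}$. The Mellin system associated with $(m;m_1,\dots,m_n)$ is the following system of $n$ linear partial differential equations for $y(x)=y(x_1,\dots,x_n)$: $$\prod_{k=0}^{m_j-1}(m_1\theta_1+\dots+m_n\theta_n+mk+1)\prod_{k=0}^{m_j'-1}(m_1'\theta_1+\dots+m_n'\theta_n+mk-1)\,y(x) = (-1)^{m_j}m^m\frac{\partial^m y(x)}{\partial x_j^m},\quad j=1,\dots,n.$$ Solutions are considered as analytic functions near the origin of $\mathbb{C}^n$. Let $B=\{(i_1,\dots,i_n)\in\mathbb{Z}^n : 0\le i_j\le m-1\}$. For $I=(i_1,\dots,i_n)\in B$ let $(I)$ denote the algebraic equation $$y^m+\varepsilon^{i_1}x_1y^{m_1}+\dots+\varepsilon^{i_n}x_ny^{m_n}-1=0.$$ Each equation $(I)$ has $m$ analytic roots near the origin. $Y$ denotes the $\mathbb{C}$-vector space generated by all the roots of all the equations $(I)$, $I\in B$. The equations $(I)$, $I\in B$, are partitioned into $m^{n-1}$ subsets $G^{(1)},\dots,G^{(m^{n-1})}$ of $m$ equations each, such that for equations $(I),(J)$ in the same subset the corresponding roots differ only by multiplicative constants; explicitly, $(I)$ and $(J)$ are in the same subset iff $I-J\equiv (jm_1,\dots,jm_n) \pmod m$ for some integer $j$. For each $k=1,\dots,m^{n-1}$ choose one index $I^{(k)}\in B$ with $(I^{(k)})\in G^{(k)}$, and let $y^{(k)}_1,\dots,y^{(k)}_m$ be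 the analytic roots of the equation $(I^{(k)})$ in a small neighbourhood of the origin. For $c=(c^{(1)},\dots,c^{(m^{n-1})})\in\mathbb{C}^{m^{n-1}}$ define $$\chi_c=\sum_{k=1}^{m^{n-1}}c^{(k)}\big(y^{(k)}_1\log(y^{(k)}_1)+\dots+y^{(k)}_m\log(y^{(k)}_m)\big),$$ where $\log$ denotes a holomorphic branch of the logarithm defined on the union of the images of the roots (on a sufficiently small neighbourhood of the origin). *)

theory Defs
  imports "HOL-Analysis.Analysis" "HOL-Number_Theory.Cong"
begin

text \<open>
  A space of functions ``near the origin'' is a complex vector space only after functions that
  agree on a neighbourhood of the origin have been identified.
\<close>

definition germ_eq :: "(complex^'n \<Rightarrow> complex) \<Rightarrow> (complex^'n \<Rightarrow> complex) \<Rightarrow> bool" where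
  "germ_eq f g \<longleftrightarrow> (\<forall>\<^sub>F x in nhds 0. f x = g x)"

lemma equivp_germ_eq: "equivp germ_eq"
proof (rule equivpI)
  show "reflp germ_eq"
    by (auto simp: reflp_def germ_eq_def)
  show "symp germ_eq"
    by (auto simp: symp_def germ_eq_def elim: eventually_mono)
  show "transp germ_eq"
    unfolding transp_def germ_eq_def
    by (blast intro: eventually_elim2 trans)
qed

quotient_type 'n germ = "complex^('n::finite) \<Rightarrow> complex" / germ_eq
  morphisms rep_germ germ
  by (rule equivp_germ_eq)

instantiation germ :: (finite) ab_group_add
begin

lift_definition zero_germ :: "'a germ" is "\<lambda>x. 0" .

lift_definition plus_germ :: "'a germ \<Rightarrow> 'a germ \<Rightarrow> 'a germ" is "\<lambda>f g x. f x + g x"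
  unfolding germ_eq_def by (erule (1) eventually_elim2) simp

lift_definition minus_germ :: "'a germ \<Rightarrow> 'a germ \<Rightarrow> 'a germ" is "\<lambda>f g x. f x - g x"
  unfolding germ_eq_def by (erule (1) eventually_elim2) simp

lift_definition uminus_germ :: "'a germ \<Rightarrow> 'a germ" is "\<lambda>f x. - f x"
  unfolding germ_eq_def by (elim eventually_mono) simp

instance
  by standard (transfer; simp add: germ_eq_def algebra_simps)+

end

lift_definition scale_germ :: "complex \<Rightarrow> 'n::finite germ \<Rightarrow> 'n germ" is "\<lambda>c f x. c * f x"
  unfolding germ_eq_def by (elim eventually_mono) simp

global_interpretation germ: vector_space "scale_germ :: complex \<Rightarrow> 'n::finite germ \<Rightarrow> 'n germ"
  by standard (transfer; simp add: germ_eq_def algebra_simps)+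

text \<open>
  The multivariate analogue of \<open>f analytic_on {0}\<close>: complex linearity of the Frechet derivative on a
  neighbourhood encodes holomorphy, which by Cauchy's formula is equivalent to power series expansion.
\<close>

definition analytic_near_0 :: "(complex^'n \<Rightarrow> complex) \<Rightarrow> bool" where
  "analytic_near_0 f \<longleftrightarrow>
     (\<exists>U. open U \<and> 0 \<in> U \<and>
       (\<forall>x\<in>U. \<exists>D. (f has_derivative D) (at x) \<and> (\<forall>c v. D (c *s v) = c * D v)))"

text \<open>
  A function is algebraic if it is a root of a nonzero polynomial over the polynomial ring in the
  coordinates; the value \<open>p a k\<close> is the coefficient of the monomial
  \<open>x\<^sub>1 ^ a\<^sub>1 * \<dots> * x\<^sub>n ^ a\<^sub>n * y ^ k\<close>.
\<close>

definition algebraic_near_0 :: "(complex^'n \<Rightarrow> complex) \<Rightarrow> bool" where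
  "algebraic_near_0 f \<longleftrightarrow>
     (\<exists>p :: ('n \<Rightarrow> nat) \<Rightarrow> nat \<Rightarrow> complex.
        finite {(a, k). p a k \<noteq> 0} \<and> {(a, k). p a k \<noteq> 0} \<noteq> {} \<and>
        (\<forall>\<^sub>F x in nhds 0.
           (\<Sum>(a, k)\<in>{(a, k). p a k \<noteq> 0}. p a k * (\<Prod>i\<in>UNIV. (x $ i) ^ a i) * f x ^ k) = 0))"

definition algebraic_germs :: "'n::finite germ set" where
  "algebraic_germs = {germ f | f. algebraic_near_0 f}"

definition partial_deriv :: "'n \<Rightarrow> (complex^'n \<Rightarrow> complex) \<Rightarrow> complex^'n \<Rightarrow> complex" where
  "partial_deriv j f x = deriv (\<lambda>z. f (\<chi> i. if i = j then z else x $ i)) (x $ j)"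

definition theta :: "'n \<Rightarrow> (complex^'n \<Rightarrow> complex) \<Rightarrow> complex^'n \<Rightarrow> complex" where
  "theta j f x = x $ j * partial_deriv j f x"

definition theta_factor ::
  "('n \<Rightarrow> nat) \<Rightarrow> complex \<Rightarrow> (complex^'n \<Rightarrow> complex) \<Rightarrow> complex^'n \<Rightarrow> complex" where
  "theta_factor a b f x = (\<Sum>i\<in>UNIV. of_nat (a i) * theta i f x) + b * f x"

definition op_prod :: "('a \<Rightarrow> 'a) list \<Rightarrow> 'a \<Rightarrow> 'a" where
  "op_prod Ps = foldr (\<circ>) Ps id"

definition mellin_lhs ::
  "nat \<Rightarrow> ('n \<Rightarrow> nat) \<Rightarrow> 'n \<Rightarrow> (complex^'n \<Rightarrow> complex) \<Rightarrow> complex^'n \<Rightarrow> complex" where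
  "mellin_lhs m M j =
     op_prod (map (\<lambda>k. theta_factor M (of_nat m * of_nat k + 1)) [0..<M j]) \<circ>
     op_prod (map (\<lambda>k. theta_factor (\<lambda>i. m - M i) (of_nat m * of_nat k - 1)) [0..<m - M j])"

definition mellin_system :: "nat \<Rightarrow> ('n \<Rightarrow> nat) \<Rightarrow> (complex^'n \<Rightarrow> complex) \<Rightarrow> bool" where
  "mellin_system m M f \<longleftrightarrow>
     (\<forall>j. \<forall>\<^sub>F x in nhds 0.
        mellin_lhs m M j f x = (-1) ^ M j * of_nat m ^ m * (partial_deriv j ^^ m) f x)"

definition mellin_solutions :: "nat \<Rightarrow> ('n::finite \<Rightarrow> nat) \<Rightarrow> 'n germ set" where
  "mellin_solutions m M = {germ f | f. analytic_near_0 f \<and> mellin_system m M f}"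

definition index_box :: "nat \<Rightarrow> (int^'n) set" where
  "index_box m = {I. \<forall>j. 0 \<le> I $ j \<and> I $ j \<le> int m - 1}"

definition unity_root :: "nat \<Rightarrow> complex" where
  "unity_root m = exp (2 * of_real pi * \<i> / of_nat m)"

definition root_germs :: "nat \<Rightarrow> ('n::finite \<Rightarrow> nat) \<Rightarrow> int^'n \<Rightarrow> 'n germ set" where
  "root_germs m M I =
     {germ f | f. analytic_near_0 f \<and>
        (\<forall>\<^sub>F x in nhds 0.
           f x ^ m + (\<Sum>j\<in>UNIV. unity_root m powi (I $ j) * x $ j * f x ^ M j) - 1 = 0)}"

definition root_space :: "nat \<Rightarrow> ('n::finite \<Rightarrow> nat) \<Rightarrow> 'n germ set" where
  "root_space m M = germ.span (\<Union>I\<in>index_box m. root_germs m M I)"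

definition same_class :: "nat \<Rightarrow> ('n::finite \<Rightarrow> nat) \<Rightarrow> ((int^'n) \<times> (int^'n)) set" where
  "same_class m M =
     {(I, J). I \<in> index_box m \<and> J \<in> index_box m \<and>
        (\<exists>t::int. \<forall>i. [I $ i - J $ i = t * int (M i)] (mod int m))}"

text \<open>
  The type \<open>'k\<close> indexes the classes of \<open>same_class m M\<close>, so that \<open>complex^'k\<close> is the coefficient
  space; \<open>y k j\<close>, for \<open>j\<close> from 1 to \<open>m\<close>, are the roots of the equation selected for the class \<open>k\<close>.
\<close>

definition root_relations ::
  "nat \<Rightarrow> ('k \<Rightarrow> nat \<Rightarrow> complex^'n \<Rightarrow> complex) \<Rightarrow> (complex^'k) set" where
  "root_relations m y = {c. \<forall>\<^sub>F x in nhds 0. (\<Sum>k\<in>UNIV. c $ k * (\<Sum>j=1..m. y k j x)) = 0}"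

definition chi_germ ::
  "nat \<Rightarrow> ('k::finite \<Rightarrow> nat \<Rightarrow> complex^('n::finite) \<Rightarrow> complex) \<Rightarrow> (complex \<Rightarrow> complex) \<Rightarrow>
     complex^'k \<Rightarrow> 'n germ" where
  "chi_germ m y L c = germ (\<lambda>x. \<Sum>k\<in>UNIV. c $ k * (\<Sum>j=1..m. y k j x * L (y k j x)))"

definition log_branch_on :: "complex set \<Rightarrow> (complex \<Rightarrow> complex) \<Rightarrow> bool" where
  "log_branch_on V L \<longleftrightarrow> open V \<and> L holomorphic_on V \<and> (\<forall>z\<in>V. exp (L z) = z)"

end

(*
  A germ is determined by its Taylor coefficients, and on these the Mellin system becomes a recursion that couples only
  multi-indices congruent modulo m. A solution is therefore determined by its coefficients in the box B = {0..m-1}^n, and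
  the solution space has dimension at most m^n. Implicit differentiation yields the coefficients of the root \<phi> of
  y^m + x_1 y^{m_1} + ... + x_n y^{m_n} = 1 with \<phi>(0) = 1, and those of \<psi> = \<phi> log \<phi>. All roots are, up to constants, the
  germs \<phi>(\<epsilon>^{J_1} x_1, ..., \<epsilon>^{J_n} x_n), so by Fourier inversion on (Z/m)^n they span the space of the components of \<phi> in
  the residue classes modulo m. The component of \<beta> in B vanishes precisely if m divides 1 + m_1 \<beta>_1 + ... + m_n \<beta>_n, with
  the single exception of \<beta> = e_1 if m_1 = m - 1. On the m^{n-1} (respectively m^{n-1} - 1) classes where it vanishes, the
  component of \<psi> solves the recursion, and the functions \<chi>_c are combinations of these modulo the span of the roots.
  An algebraic solution has no part in these classes: its projection to one of them would be algebraic with the rational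
  coefficients \<plusminus>(N - 1)! (N' - 1)! / (\<alpha>_1! ... \<alpha>_n!), N + N' = \<alpha>_1 + ... + \<alpha>_n, up to a constant, and
  restricting to a curve x_i = t^{w_i} contradicts Eisenstein's theorem on the denominators of algebraic power series.
*)

theory Submission
  imports Defs "HOL-Complex_Analysis.Complex_Analysis"
begin

text \<open>For \<alpha> \<noteq> 0 the coefficient of \<phi> at \<alpha> is, up to a nonzero
  constant, the falling factorial (a - 1) ... (a - d + 1) with a = (1 + m_1 \<alpha>_1 + ... + m_n
  \<alpha>_n) / m and d = \<alpha>_1 + ... + \<alpha>_n. The recursion multiplies by linear factors
  in a; where the product has a simple zero, its derivative in a takes over, as in the method of
  Frobenius. Multiplication by log \<phi> is differentiation with respect to the exponent of \<phi>,
  hence up to 1/m with respect to a, and this is where \<psi> comes from. At the exception e_1 one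
  has a = d, just beyond the last zero. In the arithmetic part a relation over the complex numbers
  is made rational by a linear functional over the rationals. One coordinate \<alpha>_j is raised
  just beyond a large prime q: then q divides \<alpha>_j!, while N and N' are about (m_j / m) q and
  (1 - m_j / m) q, so q divides neither numerator factorial. The weights are w_j = 1 and distinct
  powers of a large base; they keep the relation nontrivial and all competing indices of the same
  weighted degree harmless.\<close>

no_notation fps_nth (infixl "$" 75)

section \<open>Holomorphic functions of several variables\<close>

lemma sum_indicator_mult: "(\<Sum>i\<in>UNIV. (if i = j then 1 else 0) * f i) = (f (j::'n::finite) :: complex)"
proof -
  have "(\<Sum>i\<in>UNIV. (if i = j then 1 else 0) * f i) = (\<Sum>i\<in>UNIV. if i = j then f i else 0)"
    by (rule sum.cong) auto
  then show ?thesis by simp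
qed

text \<open>The condition in \<open>analytic_near_0\<close> with the open set made explicit, so that
  several functions can share one domain.\<close>

definition mholo_on :: "(complex^'n \<Rightarrow> complex) \<Rightarrow> (complex^'n) set \<Rightarrow> bool" where
  "mholo_on f U \<longleftrightarrow> open U \<and>
     (\<forall>x\<in>U. \<exists>D. (f has_derivative D) (at x) \<and> (\<forall>c v. D (c *s v) = c * D v))"

lemma analytic_near_0_iff: "analytic_near_0 f \<longleftrightarrow> (\<exists>U. 0 \<in> U \<and> mholo_on f U)"
  unfolding analytic_near_0_def mholo_on_def by blast

lemma mholo_on_subset: "mholo_on f U \<Longrightarrow> V \<subseteq> U \<Longrightarrow> open V \<Longrightarrow> mholo_on f V"
  unfolding mholo_on_def by blast

lemma bounded_linear_smult_left: "bounded_linear (\<lambda>h::complex. h *s (v::complex^'n))"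
  by (subst linear_conv_bounded_linear[symmetric])
     (auto intro!: linearI simp: vec_eq_iff algebra_simps)

lemma vec_eq_sum_axis: "(v::complex^'n) = (\<Sum>i\<in>UNIV. v $ i *s axis i 1)"
  by (metis basis_expansion)

lemma clinear_expand:
  fixes D :: "complex^'n \<Rightarrow> complex"
  assumes "linear D" "\<And>c v. D (c *s v) = c * D v"
  shows "D v = (\<Sum>i\<in>UNIV. v $ i * D (axis i 1))"
proof -
  have "D v = D (\<Sum>i\<in>UNIV. v $ i *s axis i 1)"
    using vec_eq_sum_axis[of v] by simp
  also have "\<dots> = (\<Sum>i\<in>UNIV. v $ i * D (axis i 1))"
    using assms by (simp add: linear_sum)
  finally show ?thesis .
qed

lemma has_derivative_curve:
  fixes \<gamma> :: "complex \<Rightarrow> complex^'n"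
  assumes "\<And>i. ((\<lambda>t. \<gamma> t $ i) has_field_derivative d i) (at t)"
  shows "(\<gamma> has_derivative (\<lambda>h. \<Sum>i\<in>UNIV. (d i * h) *s axis i 1)) (at t)"
proof -
  have "((\<lambda>t. \<Sum>i\<in>UNIV. \<gamma> t $ i *s axis i 1) has_derivative
         (\<lambda>h. \<Sum>i\<in>UNIV. (d i * h) *s axis i 1)) (at t)"
    using assms
    by (intro has_derivative_sum bounded_linear.has_derivative[OF bounded_linear_smult_left])
       (simp add: has_field_derivative_def)
  moreover have "(\<lambda>t. \<Sum>i\<in>UNIV. \<gamma> t $ i *s axis i 1) = \<gamma>"
    by (rule ext) (rule vec_eq_sum_axis[symmetric])
  ultimately show ?thesis by simp
qed

text \<open>The derivative \<open>D\<close> is a priori only real linear; complex linearity lets the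
  scalar \<open>h\<close> be pulled out, so that the composite has a complex derivative. Coordinate
  slices, lines and monomial curves are all instances.\<close>

lemma chain_curve:
  fixes \<gamma> :: "complex \<Rightarrow> complex^'n"
  assumes D: "(f has_derivative D) (at (\<gamma> t))" "\<And>c v. D (c *s v) = c * D v"
    and \<gamma>: "\<And>i. ((\<lambda>t. \<gamma> t $ i) has_field_derivative d i) (at t)"
  shows "((\<lambda>t. f (\<gamma> t)) has_field_derivative (\<Sum>i\<in>UNIV. d i * D (axis i 1))) (at t)"
proof -
  have lin: "linear D" using D(1) has_derivative_linear by blast
  have "((\<lambda>t. f (\<gamma> t)) has_derivative (\<lambda>h. D (\<Sum>i\<in>UNIV. (d i * h) *s axis i 1))) (at t)"
    using diff_chain_at[OF has_derivative_curve[of \<gamma> d t, OF \<gamma>] D(1)] by (simp add: o_def)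
  then show ?thesis
    unfolding has_field_derivative_def
  proof (rule has_derivative_eq_rhs)
    show "(\<lambda>h. D (\<Sum>i\<in>UNIV. (d i * h) *s axis i 1)) = (*) (\<Sum>i\<in>UNIV. d i * D (axis i 1))"
      by (rule ext) (simp add: linear_sum[OF lin] D(2) sum_distrib_right sum_distrib_left mult_ac)
  qed
qed

lemma slice_has_field_derivative:
  fixes x :: "complex^'n"
  shows "((\<lambda>z. (\<chi> i. if i = j then z else x $ i) $ i) has_field_derivative (if i = j then 1 else 0)) (at z)"
  by auto

lemma partial_deriv_eq:
  assumes "(f has_derivative D) (at x)" "\<And>c v. D (c *s v) = c * D v"
  shows "partial_deriv j f x = D (axis j 1)"
proof -
  have [simp]: "(\<chi> i. if i = j then x $ j else x $ i) = x" by (simp add: vec_eq_iff)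
  have "((\<lambda>z. f (\<chi> i. if i = j then z else x $ i)) has_field_derivative
        (\<Sum>i\<in>UNIV. (if i = j then 1 else 0) * D (axis i 1))) (at (x $ j))"
    using slice_has_field_derivative
    by (intro chain_curve[where \<gamma> = "\<lambda>z. \<chi> i. if i = j then z else x $ i"]) (simp_all add: assms)
  then show ?thesis
    unfolding partial_deriv_def sum_indicator_mult[of j "\<lambda>i. D (axis i 1)"] by (rule DERIV_imp_deriv)
qed

text \<open>Complex linearity determines \<open>D\<close> by its values on the axes, and these are
  the derivatives of the coordinate slices.\<close>

lemma mholo_on_has_derivative:
  assumes "mholo_on f U" "x \<in> U"
  shows "(f has_derivative (\<lambda>v. \<Sum>i\<in>UNIV. v $ i * partial_deriv i f x)) (at x)"
proof -
  have "\<exists>D. (f has_derivative D) (at x) \<and> (\<forall>c v. D (c *s v) = c * D v)"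
    using assms by (simp add: mholo_on_def)
  then obtain D where "(f has_derivative D) (at x)" "\<forall>c v. D (c *s v) = c * D v"
    by (elim exE conjE)
  then have D: "(f has_derivative D) (at x)" "\<And>c v. D (c *s v) = c * D v"
    by simp_all
  have "D = (\<lambda>v. \<Sum>i\<in>UNIV. v $ i * partial_deriv i f x)"
    by (rule ext) (simp only: partial_deriv_eq[OF D], rule clinear_expand[OF has_derivative_linear[OF D(1)] D(2)])
  with D show ?thesis by simp
qed

lemma mholo_onI:
  assumes "open U" "\<And>x. x \<in> U \<Longrightarrow> (f has_derivative (\<lambda>v. \<Sum>i\<in>UNIV. v $ i * d x i)) (at x)"
  shows "mholo_on f U"
  unfolding mholo_on_def
  using assms by (auto intro!: exI[of _ "\<lambda>v. \<Sum>i\<in>UNIV. v $ i * d _ i"] simp: sum_distrib_left mult.assoc)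

lemma partial_deriv_eqI:
  assumes "(f has_derivative (\<lambda>v. \<Sum>i\<in>UNIV. v $ i * d i)) (at x)"
  shows "partial_deriv j f x = d j"
  using partial_deriv_eq[OF assms, of j]
  by (simp add: sum_distrib_left mult.assoc axis_def sum_indicator_mult)

lemma mholo_on_continuous: "mholo_on f U \<Longrightarrow> continuous_on U f"
  by (meson mholo_on_has_derivative continuous_at_imp_continuous_on has_derivative_continuous)

lemma mholo_on_curve:
  fixes \<gamma> :: "complex \<Rightarrow> complex^'n"
  assumes "mholo_on f U" "\<gamma> t \<in> U" "\<And>i. ((\<lambda>t. \<gamma> t $ i) has_field_derivative d i) (at t)"
  shows "((\<lambda>t. f (\<gamma> t)) has_field_derivative (\<Sum>i\<in>UNIV. d i * partial_deriv i f (\<gamma> t))) (at t)"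
proof -
  have "((\<lambda>t. f (\<gamma> t)) has_field_derivative
        (\<Sum>i\<in>UNIV. d i * (\<Sum>k\<in>UNIV. axis i 1 $ k * partial_deriv k f (\<gamma> t)))) (at t)"
    by (rule chain_curve[OF mholo_on_has_derivative[OF assms(1,2)] _ assms(3)])
       (auto simp: sum_distrib_left mult.assoc)
  then show ?thesis
    by (simp add: axis_def sum_indicator_mult)
qed

lemma partial_deriv_cong:
  assumes "\<forall>\<^sub>F x in nhds x. f x = g x"
  shows "partial_deriv j f x = partial_deriv j g x"
proof -
  have [simp]: "(\<chi> i. if i = j then x $ j else x $ i) = x" by (simp add: vec_eq_iff)
  have "((\<lambda>z. \<chi> i. if i = j then z else x $ i) \<longlongrightarrow> (\<chi> i. if i = j then x $ j else x $ i)) (nhds (x $ j))"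
    by (rule tendsto_vec_lambda) (auto simp: tendsto_const filterlim_ident)
  then have "\<forall>\<^sub>F z in nhds (x $ j). f (\<chi> i. if i = j then z else x $ i) = g (\<chi> i. if i = j then z else x $ i)"
    using eventually_compose_filterlim[OF assms] by simp
  then show ?thesis unfolding partial_deriv_def by (rule deriv_cong_ev) simp
qed

section \<open>Cauchy's formula for partial derivatives and its consequences\<close>

lemma line_has_field_derivative:
  fixes x :: "complex^'n"
  shows "((\<lambda>z. (x + z *s axis j 1) $ i) has_field_derivative (if i = j then 1 else 0)) (at z)"
  by (cases "i = j") (auto simp: axis_def intro!: derivative_eq_intros)

lemma mholo_on_line:
  assumes "mholo_on f U" "x + z *s axis j 1 \<in> U"
  shows "((\<lambda>z. f (x + z *s axis j 1)) has_field_derivative partial_deriv j f (x + z *s axis j 1)) (at z)"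
  using mholo_on_curve[where \<gamma> = "\<lambda>z. x + z *s axis j 1", OF assms line_has_field_derivative]
  by (simp only: sum_indicator_mult)

text \<open>Cauchy's derivative formula for the slice in direction \<open>j\<close>; the derivative
  of the circle path cancels 2 \<pi> i and one power of the denominator. The integrand depends on
  \<open>x\<close> only through \<open>f\<close>, so continuity and differentiability of
  \<open>f\<close> pass to the partial derivative.\<close>

lemma partial_deriv_Cauchy:
  assumes f: "mholo_on f U" and \<rho>: "\<rho> > 0" and U: "\<And>z. norm z \<le> \<rho> \<Longrightarrow> x + z *s axis j 1 \<in> U"
  shows "partial_deriv j f x =
    integral (cbox 0 1) (\<lambda>t::real. f (x + (of_real \<rho> * exp (2 * of_real pi * \<i> * of_real t)) *s axis j 1) /
       (of_real \<rho> * exp (2 * of_real pi * \<i> * of_real t)))"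
proof -
  let ?g = "\<lambda>z. f (x + z *s axis j 1)"
  have g: "(?g has_field_derivative partial_deriv j f (x + z *s axis j 1)) (at z)" if "norm z \<le> \<rho>" for z
    using mholo_on_line[OF f U[OF that]] .
  have "?g holomorphic_on ball 0 \<rho>"
  proof (rule holomorphic_onI)
    fix z :: complex assume "z \<in> ball 0 \<rho>"
    then have "norm z \<le> \<rho>" by simp
    from has_field_derivative_at_within[OF g[OF this]] show "?g field_differentiable at z within ball 0 \<rho>"
      unfolding field_differentiable_def by (rule exI)
  qed
  moreover have "continuous_on (cball 0 \<rho>) ?g"
    using DERIV_isCont[OF g] by (intro continuous_at_imp_continuous_on ballI) simp
  ultimately have "(?g has_field_derivative (1 / (2 * of_real pi * \<i>) *
       contour_integral (circlepath 0 \<rho>) (\<lambda>u. ?g u / (u - 0)^2))) (at 0)"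
    using \<rho> by (intro Cauchy_derivative_integral_circlepath) auto
  then have "partial_deriv j f x = 1 / (2 * of_real pi * \<i>) * contour_integral (circlepath 0 \<rho>) (\<lambda>u. ?g u / (u - 0)^2)"
    using DERIV_unique[OF g[of 0]] \<rho> by simp
  also have "contour_integral (circlepath 0 \<rho>) (\<lambda>u. ?g u / (u - 0)^2) =
     integral (cbox 0 1) (\<lambda>t. 2 * of_real pi * \<i> * (?g (of_real \<rho> * exp (2 * of_real pi * \<i> * of_real t)) /
       (of_real \<rho> * exp (2 * of_real pi * \<i> * of_real t))))"
    unfolding contour_integral_integral cbox_interval
    using \<rho> by (intro integral_cong) (simp only: vector_derivative_circlepath, simp add: circlepath power2_eq_square field_simps)
  finally show ?thesis by (simp only: integral_mult_right) simp
qed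


lemma norm_smult_axis:
  fixes z :: complex
  shows "norm (z *s axis j (1::complex) :: complex^'n) = norm z"
proof -
  have "(z *s axis j 1 :: complex^'n) = axis j z" by (simp add: vec_eq_iff axis_def)
  moreover have "(\<Sum>i\<in>UNIV. (norm (if i = j then z else 0))\<^sup>2) = (\<Sum>i\<in>UNIV. if i = j then (norm z)\<^sup>2 else 0)"
    by (rule sum.cong) auto
  ultimately show ?thesis by (simp add: norm_vec_def L2_set_def axis_def)
qed

text \<open>The same \<open>\<delta>\<close> bounds the range of \<open>x\<close> and the radius of
  the circle, so one circle serves in Cauchy's formula for all \<open>x\<close> near
  \<open>x0\<close>.\<close>

lemma polydisc_nbhd:
  fixes x0 :: "complex^'n"
  assumes "open U" "x0 \<in> U"
  obtains \<delta> where "\<delta> > 0" "ball x0 \<delta> \<subseteq> U" "\<And>x z. x \<in> ball x0 \<delta> \<Longrightarrow> norm z \<le> \<delta> \<Longrightarrow> x + z *s axis j 1 \<in> U"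
proof -
  obtain r where r: "r > 0" "ball x0 r \<subseteq> U" using assms open_contains_ball by blast
  show ?thesis
  proof (rule that[of "r / 2"])
    show "r / 2 > 0" "ball x0 (r / 2) \<subseteq> U" using r by auto
    fix x :: "complex^'n" and z :: complex assume "x \<in> ball x0 (r / 2)" "norm z \<le> r / 2"
    then have "dist x0 x < r / 2" "dist x (x + z *s axis j 1) \<le> r / 2" by (simp_all add: dist_norm norm_smult_axis)
    then have "dist x0 (x + z *s axis j 1) < r" using dist_triangle[of x0 "x + z *s axis j 1" x] by linarith
    then show "x + z *s axis j 1 \<in> U" using r by auto
  qed
qed

lemma continuous_on_Cauchy_kernel:
  fixes x0 :: "complex^'n"
  assumes f: "continuous_on U f" and \<delta>: "\<delta> > 0"
    and U: "\<And>x z. x \<in> B \<Longrightarrow> norm z \<le> \<delta> \<Longrightarrow> x + z *s axis j (1::complex) \<in> U"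
  shows "continuous_on (B \<times> cbox 0 1) (\<lambda>(x, t::real). f (x + (of_real \<delta> * exp (2 * of_real pi * \<i> * of_real t)) *s axis j 1) /
       (of_real \<delta> * exp (2 * of_real pi * \<i> * of_real t)) :: complex)"
  unfolding split_beta
  using \<delta>
  by (intro continuous_on_divide continuous_on_compose2[OF f] continuous_intros
       bounded_linear.continuous_on[OF bounded_linear_smult_left])
     (auto intro!: U simp: norm_mult)

text \<open>Continuity comes before differentiability: Leibniz' rule asks for a continuous
  derivative of the integrand.\<close>

lemma continuous_on_partial_deriv:
  assumes f: "mholo_on f U"
  shows "continuous_on U (partial_deriv j f)"
proof (rule continuous_at_imp_continuous_on, rule ballI)
  fix x0 assume x0: "x0 \<in> U"
  have "open U" using f by (simp add: mholo_on_def)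
  from polydisc_nbhd[OF this x0, of j] obtain \<delta> where \<delta>: "\<delta> > 0" "ball x0 \<delta> \<subseteq> U"
    "\<And>x z. x \<in> ball x0 \<delta> \<Longrightarrow> norm z \<le> \<delta> \<Longrightarrow> x + z *s axis j 1 \<in> U" by metis
  have "continuous_on (ball x0 \<delta>) (\<lambda>x. integral (cbox 0 1) (\<lambda>t::real. f (x + (of_real \<delta> * exp (2 * of_real pi * \<i> * of_real t)) *s axis j 1) /
       (of_real \<delta> * exp (2 * of_real pi * \<i> * of_real t))))"
    by (intro integral_continuous_on_param continuous_on_Cauchy_kernel[OF mholo_on_continuous[OF f]] \<delta>(1,3))
  then have "continuous_on (ball x0 \<delta>) (partial_deriv j f)"
    by (rule continuous_on_eq) (rule partial_deriv_Cauchy[OF f \<delta>(1,3), symmetric])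
  then show "isCont (partial_deriv j f) x0"
    using \<delta>(1) by (simp add: continuous_on_eq_continuous_at)
qed

lift_definition blinfun_coordinate :: "'n \<Rightarrow> (complex^'n) \<Rightarrow>\<^sub>L complex" is "\<lambda>i v. v $ i"
  by (rule bounded_linear_vec_nth)

text \<open>Leibniz' rule applied to Cauchy's formula. The coefficients of the derivative are kept
  as Cauchy integrals over the same circle, because in this form the mixed derivatives can be
  compared.\<close>

lemma partial_deriv_has_derivative:
  fixes f :: "complex^'n \<Rightarrow> complex"
  assumes f: "mholo_on f U" and x0: "x0 \<in> U"
  obtains \<delta> where "\<delta> > 0" "\<And>x z. x \<in> ball x0 \<delta> \<Longrightarrow> norm z \<le> \<delta> \<Longrightarrow> x + z *s axis j 1 \<in> U"
    "(partial_deriv j f has_derivative (\<lambda>v. \<Sum>i\<in>UNIV. v $ i * integral (cbox 0 1)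
      (\<lambda>t::real. partial_deriv i f (x0 + (of_real \<delta> * exp (2 * of_real pi * \<i> * of_real t)) *s axis j 1) /
       (of_real \<delta> * exp (2 * of_real pi * \<i> * of_real t))))) (at x0)"
proof -
  have "open U" using f by (simp add: mholo_on_def)
  from polydisc_nbhd[OF this x0, of j] obtain \<delta> where \<delta>: "\<delta> > 0" "ball x0 \<delta> \<subseteq> U"
    "\<And>x z. x \<in> ball x0 \<delta> \<Longrightarrow> norm z \<le> \<delta> \<Longrightarrow> x + z *s axis j 1 \<in> U" by metis
  define K where "K = (\<lambda>t::real. of_real \<delta> * exp (2 * of_real pi * \<i> * of_real t) :: complex)"
  have K0: "K t \<noteq> 0" for t using \<delta> by (simp add: K_def)
  have KU: "x + K t *s axis j 1 \<in> U" if "x \<in> ball x0 \<delta>" for x t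
    using \<delta>(3)[OF that, of "K t"] \<delta>(1) by (simp add: K_def norm_mult)
  let ?k = "\<lambda>i x t. partial_deriv i f (x + K t *s axis j 1) / K t"
  \<comment> \<open>The derivative in \<open>x\<close> of the Cauchy integrand at parameter
    \<open>t\<close>, packed as a bounded linear map as Leibniz' rule demands.\<close>
  define fx where "fx = (\<lambda>x t. \<Sum>i\<in>UNIV. blinfun_mult_right (?k i x t) o\<^sub>L blinfun_coordinate i)"
  have fx_app: "blinfun_apply (fx x t) v = (\<Sum>i\<in>UNIV. v $ i * ?k i x t)" for x t v
    by (simp add: fx_def blinfun.sum_left blinfun_coordinate.rep_eq mult.commute)
  have ck: "continuous_on (ball x0 \<delta> \<times> cbox 0 1) (\<lambda>(x, t). ?k i x t)" for i
    unfolding K_def by (rule continuous_on_Cauchy_kernel[OF continuous_on_partial_deriv[OF f] \<delta>(1,3)])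
  have cf: "continuous_on (ball x0 \<delta> \<times> cbox 0 1) (\<lambda>(x, t). f (x + K t *s axis j 1) / K t)"
    unfolding K_def by (rule continuous_on_Cauchy_kernel[OF mholo_on_continuous[OF f] \<delta>(1,3)])
  have "((\<lambda>x. integral (cbox 0 1) (\<lambda>t. f (x + K t *s axis j 1) / K t)) has_derivative
         integral (cbox 0 1) (fx x0)) (at x0 within ball x0 \<delta>)"
  proof (rule leibniz_rule)
    fix x and t :: real assume x: "x \<in> ball x0 \<delta>"
    have s: "((\<lambda>x. x + K t *s axis j 1) has_derivative (\<lambda>v. v)) (at x within ball x0 \<delta>)"
      by (auto intro!: derivative_eq_intros)
    have "((\<lambda>x. f (x + K t *s axis j 1)) has_derivative
      (\<lambda>v. \<Sum>i\<in>UNIV. v $ i * partial_deriv i f (x + K t *s axis j 1))) (at x within ball x0 \<delta>)"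
      by (rule has_derivative_compose[OF s mholo_on_has_derivative[OF f KU[OF x]]])
    from bounded_linear.has_derivative[OF bounded_linear_mult_left[of "inverse (K t)"] this]
    show "((\<lambda>x. f (x + K t *s axis j 1) / K t) has_derivative blinfun_apply (fx x t)) (at x within ball x0 \<delta>)"
      unfolding fx_app[abs_def] by (simp add: divide_inverse sum_distrib_right mult.assoc)
  next
    fix x assume x: "x \<in> ball x0 \<delta>"
    have "continuous_on (cbox 0 1) (\<lambda>t. (\<lambda>(x, t). f (x + K t *s axis j 1) / K t) (x, t))"
      by (rule continuous_on_compose2[OF cf]) (use x in \<open>auto intro!: continuous_intros\<close>)
    then show "(\<lambda>t. f (x + K t *s axis j 1) / K t) integrable_on cbox 0 1"
      by (intro integrable_continuous) simp
  next
    show "continuous_on (ball x0 \<delta> \<times> cbox 0 1) (\<lambda>(x, t). fx x t)"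
      unfolding fx_def split_beta
      using ck by (intro continuous_on_sum bounded_bilinear.continuous_on[OF bounded_bilinear_blinfun_compose]
        bounded_linear.continuous_on[OF bounded_linear_blinfun_mult_right] continuous_on_const)
         (simp add: split_beta)
  qed (use \<delta> in auto)
  moreover have "at x0 within ball x0 \<delta> = at x0" using \<delta>(1) by (intro at_within_open) auto
  moreover have cfx: "continuous_on (cbox 0 1) (fx x0)"
  proof -
    have "continuous_on (cbox 0 1) (\<lambda>t. (\<lambda>(x, t). ?k i x t) (x0, t))" for i
      by (rule continuous_on_compose2[OF ck]) (use \<delta>(1) in \<open>auto intro!: continuous_intros\<close>)
    then show ?thesis unfolding fx_def
      by (intro continuous_on_sum bounded_bilinear.continuous_on[OF bounded_bilinear_blinfun_compose]
        bounded_linear.continuous_on[OF bounded_linear_blinfun_mult_right] continuous_on_const) simp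
  qed
  moreover have "blinfun_apply (integral (cbox 0 1) (fx x0)) =
      (\<lambda>v. \<Sum>i\<in>UNIV. v $ i * integral (cbox 0 1) (?k i x0))"
  proof
    fix v
    have int: "?k i x0 integrable_on cbox 0 1" for i
    proof -
      have "continuous_on (cbox 0 1) (\<lambda>t. (\<lambda>(x, t). ?k i x t) (x0, t))"
        by (rule continuous_on_compose2[OF ck]) (use \<delta>(1) in \<open>auto intro!: continuous_intros\<close>)
      then show ?thesis by (intro integrable_continuous) simp
    qed
    have "blinfun_apply (integral (cbox 0 1) (fx x0)) v = integral (cbox 0 1) (\<lambda>t. blinfun_apply (fx x0 t) v)"
      by (rule blinfun_apply_integral) (rule integrable_continuous[OF cfx])
    also have "\<dots> = (\<Sum>i\<in>UNIV. v $ i * integral (cbox 0 1) (?k i x0))"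
      unfolding fx_app using int
      by (subst integral_sum) (auto intro!: integrable_on_mult_right simp del: times_divide_eq_right)
    finally show "blinfun_apply (integral (cbox 0 1) (fx x0)) v = (\<Sum>i\<in>UNIV. v $ i * integral (cbox 0 1) (?k i x0))" .
  qed
  ultimately have D: "((\<lambda>x. integral (cbox 0 1) (\<lambda>t. f (x + K t *s axis j 1) / K t)) has_derivative
         (\<lambda>v. \<Sum>i\<in>UNIV. v $ i * integral (cbox 0 1) (?k i x0))) (at x0)" by simp
  have "(partial_deriv j f has_derivative (\<lambda>v. \<Sum>i\<in>UNIV. v $ i * integral (cbox 0 1) (?k i x0))) (at x0)"
    by (rule has_derivative_transform_within_open[OF D, of "ball x0 \<delta>"])
       (use \<delta>(1) partial_deriv_Cauchy[OF f \<delta>(1,3)] in \<open>auto simp: K_def\<close>)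
  note D' = this[unfolded K_def]
  show ?thesis
    by (rule that[OF \<delta>(1)], erule (1) \<delta>(3), rule D')
qed

lemma mholo_on_partial_deriv:
  assumes "mholo_on f U"
  shows "mholo_on (partial_deriv j f) U"
proof -
  have "\<exists>d. (partial_deriv j f has_derivative (\<lambda>v. \<Sum>i\<in>UNIV. v $ i * d i)) (at x)" if "x \<in> U" for x
    by (rule partial_deriv_has_derivative[OF assms that, of j]) (rule exI)
  then obtain d where "\<And>x. x \<in> U \<Longrightarrow> (partial_deriv j f has_derivative (\<lambda>v. \<Sum>i\<in>UNIV. v $ i * d x i)) (at x)"
    by metis
  then show ?thesis using assms by (intro mholo_onI) (auto simp: mholo_on_def)
qed

text \<open>Differentiating Cauchy's formula for \<open>\<partial>\<^sub>j f\<close> under the integral sign yields Cauchy's formula for \<open>\<partial>\<^sub>j (\<partial>\<^sub>i f)\<close>.\<close>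

lemma partial_deriv_commute:
  assumes f: "mholo_on f U" and x: "x \<in> U"
  shows "partial_deriv i (partial_deriv j f) x = partial_deriv j (partial_deriv i f) x"
  using partial_deriv_has_derivative[OF f x, of j]
proof cases
  case (1 \<delta>)
  then have "x + z *s axis j 1 \<in> U" if "norm z \<le> \<delta>" for z
    using that by simp
  from partial_deriv_Cauchy[OF mholo_on_partial_deriv[OF f] 1(1) this, of i]
  show ?thesis using partial_deriv_eqI[OF 1(3), of i] by simp
qed

section \<open>The ring of germs\<close>

text \<open>Each closure property below obtains holomorphy and the values of the partial derivatives
  from a single \<open>has_derivative\<close> fact, hence the conjunction.\<close>

lemma mholo_onI2:
  assumes "open U" "\<And>x. x \<in> U \<Longrightarrow> (f has_derivative D x) (at x)" "\<And>x v. x \<in> U \<Longrightarrow> D x v = (\<Sum>i\<in>UNIV. v $ i * d x i)"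
  shows "mholo_on f U \<and> (\<forall>x\<in>U. \<forall>j. partial_deriv j f x = d x j)"
proof -
  have "D x = (\<lambda>v. \<Sum>i\<in>UNIV. v $ i * d x i)" if "x \<in> U" for x using assms(3)[OF that] by (rule ext)
  then have 1: "(f has_derivative (\<lambda>v. \<Sum>i\<in>UNIV. v $ i * d x i)) (at x)" if "x \<in> U" for x using assms(2)[OF that] that by simp
  show ?thesis using mholo_onI[OF assms(1) 1] partial_deriv_eqI[OF 1] by simp
qed

lemma mholo_const: "open U \<Longrightarrow> mholo_on (\<lambda>x. c) U \<and> (\<forall>x\<in>U. \<forall>j. partial_deriv j (\<lambda>x. c) x = 0)"
  by (rule mholo_onI2[where D = "\<lambda>x v. 0"]) auto

lemma mholo_coord: "open U \<Longrightarrow> mholo_on (\<lambda>x. x $ k) U \<and> (\<forall>x\<in>U. \<forall>j. partial_deriv j (\<lambda>x. x $ k) x = (if j = k then 1 else 0))"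
proof (rule mholo_onI2[where D = "\<lambda>x v. v $ k"])
  fix v :: "complex^'a"
  show "v $ k = (\<Sum>i\<in>UNIV. v $ i * (if i = k then 1 else 0))"
    using sum_indicator_mult[of k "\<lambda>i. v $ i"] by (simp only: mult.commute)
qed (auto intro: bounded_linear_imp_has_derivative)

lemma mholo_add:
  assumes "mholo_on f U" "mholo_on g U"
  shows "mholo_on (\<lambda>x. f x + g x) U \<and> (\<forall>x\<in>U. \<forall>j. partial_deriv j (\<lambda>x. f x + g x) x = partial_deriv j f x + partial_deriv j g x)"
  by (rule mholo_onI2, use assms in \<open>simp add: mholo_on_def\<close>,
      rule has_derivative_add[OF mholo_on_has_derivative[OF assms(1)] mholo_on_has_derivative[OF assms(2)]])
     (simp_all add: sum.distrib algebra_simps)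

lemma mholo_mult:
  assumes "mholo_on f U" "mholo_on g U"
  shows "mholo_on (\<lambda>x. f x * g x) U \<and> (\<forall>x\<in>U. \<forall>j. partial_deriv j (\<lambda>x. f x * g x) x = f x * partial_deriv j g x + partial_deriv j f x * g x)"
  by (rule mholo_onI2, use assms in \<open>simp add: mholo_on_def\<close>,
      rule has_derivative_mult[OF mholo_on_has_derivative[OF assms(1)] mholo_on_has_derivative[OF assms(2)]])
     (simp_all add: sum.distrib sum_distrib_left sum_distrib_right algebra_simps)

lemma mholo_compose:
  assumes "mholo_on f U" "\<And>x. x \<in> U \<Longrightarrow> (h has_field_derivative h' (f x)) (at (f x))"
  shows "mholo_on (\<lambda>x. h (f x)) U \<and> (\<forall>x\<in>U. \<forall>j. partial_deriv j (\<lambda>x. h (f x)) x = h' (f x) * partial_deriv j f x)"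
  by (rule mholo_onI2, use assms in \<open>simp add: mholo_on_def\<close>,
      rule has_derivative_compose[OF mholo_on_has_derivative[OF assms(1)] assms(2)[unfolded has_field_derivative_def]])
     (simp_all add: sum_distrib_left algebra_simps)

section \<open>Dilations of the coordinates\<close>

lemma bounded_linear_dilation: "bounded_linear (\<lambda>x::complex^'n. \<chi> i. u i * x $ i)"
  by (subst linear_conv_bounded_linear[symmetric])
     (auto intro!: linearI simp: vec_eq_iff algebra_simps)

lemma tendsto_dilation: "filterlim (\<lambda>x::complex^'n. \<chi> i. u i * x $ i) (nhds 0) (nhds 0)"
proof -
  have "((\<lambda>x::complex^'n. \<chi> i. u i * x $ i) \<longlongrightarrow> (\<chi> i. u i * 0 $ i)) (nhds 0)"
    by (intro tendsto_vec_lambda tendsto_mult tendsto_const tendsto_vec_nth filterlim_ident)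
  then show ?thesis by (simp add: zero_vec_def)
qed

lemma open_dilation_vimage: "open U \<Longrightarrow> open ((\<lambda>x::complex^'n. \<chi> i. u i * x $ i) -` U)"
  using linear_continuous_on[OF bounded_linear_dilation] by (intro open_vimage) auto

lemma mholo_dilation:
  assumes "mholo_on f U"
  shows "mholo_on (\<lambda>x. f (\<chi> i. u i * x $ i)) ((\<lambda>x. \<chi> i. u i * x $ i) -` U) \<and>
    (\<forall>x\<in>(\<lambda>x. \<chi> i. u i * x $ i) -` U. \<forall>j. partial_deriv j (\<lambda>x. f (\<chi> i. u i * x $ i)) x = u j * partial_deriv j f (\<chi> i. u i * x $ i))"
proof (rule mholo_onI2)
  show "open ((\<lambda>x. \<chi> i. u i * x $ i) -` U)" using assms by (auto simp: mholo_on_def intro: open_dilation_vimage)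
  fix x assume "x \<in> (\<lambda>x. \<chi> i. u i * x $ i) -` U"
  then have x: "(\<chi> i. u i * x $ i) \<in> U" by simp
  show "((\<lambda>x. f (\<chi> i. u i * x $ i)) has_derivative (\<lambda>v. \<Sum>i\<in>UNIV. (\<chi> i. u i * v $ i) $ i * partial_deriv i f (\<chi> i. u i * x $ i))) (at x)"
    by (rule has_derivative_compose[OF bounded_linear_imp_has_derivative[OF bounded_linear_dilation] mholo_on_has_derivative[OF assms x]])
qed (simp add: mult_ac)

lemma analytic_near_0_common:
  assumes "analytic_near_0 f" "analytic_near_0 g"
  obtains U where "open U" "0 \<in> U" "mholo_on f U" "mholo_on g U"
proof -
  obtain A B where A: "0 \<in> A" "mholo_on f A" and B: "0 \<in> B" "mholo_on g B"
    using assms by (auto simp: analytic_near_0_iff)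
  then have o: "open (A \<inter> B)" by (simp add: mholo_on_def open_Int)
  show ?thesis
    by (rule that[of "A \<inter> B"]) (use A B o in \<open>auto intro: mholo_on_subset\<close>)
qed

lemma analytic_near_0_open:
  assumes "analytic_near_0 f"
  obtains U where "open U" "0 \<in> U" "mholo_on f U"
  using analytic_near_0_common[OF assms assms] by metis

lemma germ_eqI: "open U \<Longrightarrow> 0 \<in> U \<Longrightarrow> (\<And>x. x \<in> U \<Longrightarrow> f x = g x) \<Longrightarrow> germ_eq f g"
  unfolding germ_eq_def eventually_nhds by blast

section \<open>Multiplication, differentiation and dilation of germs\<close>

instantiation germ :: (finite) comm_ring_1
begin

lift_definition one_germ :: "'a germ" is "\<lambda>x. 1" .

lift_definition times_germ :: "'a germ \<Rightarrow> 'a germ \<Rightarrow> 'a germ" is "\<lambda>f g x. f x * g x"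
  unfolding germ_eq_def by (erule (1) eventually_elim2) simp

instance
proof
  show "(0::'a germ) \<noteq> 1"
    by transfer (auto simp: germ_eq_def dest: eventually_nhds_x_imp_x)
qed (transfer; simp add: germ_eq_def algebra_simps)+

end

lift_definition ganalytic :: "'n::finite germ \<Rightarrow> bool" is analytic_near_0
proof -
  have "analytic_near_0 g" if fg: "germ_eq f g" and af: "analytic_near_0 f" for f g :: "complex^'n \<Rightarrow> complex"
  proof -
    obtain U where U: "open U" "0 \<in> U" "mholo_on f U" using analytic_near_0_open[OF af] .
    obtain V where V: "open V" "0 \<in> V" "\<And>x. x \<in> V \<Longrightarrow> f x = g x"
      using fg unfolding germ_eq_def eventually_nhds by blast
    have gd: "(g has_derivative (\<lambda>v. \<Sum>i\<in>UNIV. v $ i * partial_deriv i f x)) (at x)" if "x \<in> U \<inter> V" for x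
    proof (rule has_derivative_transform_within_open[of f _ x UNIV "U \<inter> V"])
      show "(f has_derivative (\<lambda>v. \<Sum>i\<in>UNIV. v $ i * partial_deriv i f x)) (at x)"
        using mholo_on_has_derivative[OF U(3)] that by simp
    qed (use U V that in auto)
    then have "mholo_on g (U \<inter> V)" by (intro mholo_onI[OF open_Int[OF U(1) V(1)] gd])
    then show ?thesis unfolding analytic_near_0_iff using U V by blast
  qed
  then show "germ_eq f g \<Longrightarrow> analytic_near_0 f = analytic_near_0 g" for f g :: "complex^'n \<Rightarrow> complex"
    using equivp_germ_eq equivp_symp by metis
qed

lift_definition pd :: "'n::finite \<Rightarrow> 'n germ \<Rightarrow> 'n germ" is partial_deriv
proof -
  fix j and f g :: "complex^'n \<Rightarrow> complex"
  assume "germ_eq f g"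
  then obtain V where V: "open V" "0 \<in> V" "\<And>x. x \<in> V \<Longrightarrow> f x = g x"
    unfolding germ_eq_def eventually_nhds by blast
  show "germ_eq (partial_deriv j f) (partial_deriv j g)"
    by (rule germ_eqI[OF V(1,2)], rule partial_deriv_cong) (use V in \<open>auto simp: eventually_nhds\<close>)
qed

lift_definition ev0 :: "'n::finite germ \<Rightarrow> complex" is "\<lambda>f. f 0"
  unfolding germ_eq_def by (rule eventually_nhds_x_imp_x)

lift_definition dil :: "('n \<Rightarrow> complex) \<Rightarrow> 'n::finite germ \<Rightarrow> 'n germ" is "\<lambda>u f x. f (\<chi> i. u i * x $ i)"
  unfolding germ_eq_def by (rule eventually_compose_filterlim[OF _ tendsto_dilation])

lift_definition gX :: "'n::finite \<Rightarrow> 'n germ" is "\<lambda>j x. x $ j" .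

lemma analytic_near_0I: "0 \<in> U \<Longrightarrow> mholo_on f U \<Longrightarrow> analytic_near_0 f"
  by (auto simp: analytic_near_0_iff)

lemma ganalytic_add: "ganalytic f \<Longrightarrow> ganalytic g \<Longrightarrow> ganalytic (f + g)"
  by transfer (erule (1) analytic_near_0_common, metis analytic_near_0I mholo_add)

lemma pd_add: "ganalytic f \<Longrightarrow> ganalytic g \<Longrightarrow> pd j (f + g) = pd j f + pd j g"
  by transfer (erule (1) analytic_near_0_common, rule germ_eqI, assumption, assumption, simp add: mholo_add)

lemma ganalytic_mult: "ganalytic f \<Longrightarrow> ganalytic g \<Longrightarrow> ganalytic (f * g)"
  by transfer (erule (1) analytic_near_0_common, metis analytic_near_0I mholo_mult)

lemma pd_mult: "ganalytic f \<Longrightarrow> ganalytic g \<Longrightarrow> pd j (f * g) = f * pd j g + pd j f * g"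
  by transfer (erule (1) analytic_near_0_common, rule germ_eqI, assumption, assumption, simp add: mholo_mult)

lemma ganalytic_const: "ganalytic (scale_germ c 1)"
  by transfer (rule analytic_near_0I[of UNIV], simp_all add: mholo_const)

lemma pd_const: "pd j (scale_germ c 1) = 0"
  by transfer (rule germ_eqI[of UNIV], simp_all add: mholo_const[OF open_UNIV, simplified])

lemma ganalytic_X: "ganalytic (gX j)"
  by transfer (rule analytic_near_0I[of UNIV], simp_all add: mholo_coord)

lemma pd_X: "pd i (gX j) = (if i = j then 1 else 0)"
  by (cases "i = j"; simp; transfer; rule germ_eqI[of UNIV]; simp add: mholo_coord[OF open_UNIV, simplified])

lemma ganalytic_pd: "ganalytic f \<Longrightarrow> ganalytic (pd j f)"
  by transfer (erule analytic_near_0_open, metis analytic_near_0I mholo_on_partial_deriv)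

lemma pd_commute: "ganalytic f \<Longrightarrow> pd i (pd j f) = pd j (pd i f)"
  by transfer (erule analytic_near_0_open, rule germ_eqI, assumption, assumption, rule partial_deriv_commute)

lemma ganalytic_dil: "ganalytic f \<Longrightarrow> ganalytic (dil u f)"
proof transfer
  fix f :: "complex^'a \<Rightarrow> complex" and u
  assume "analytic_near_0 f"
  then obtain U where U: "open U" "0 \<in> U" "mholo_on f U" by (rule analytic_near_0_open)
  show "analytic_near_0 (\<lambda>x. f (\<chi> i. u i * x $ i))"
    by (rule analytic_near_0I[of "(\<lambda>x. \<chi> i. u i * x $ i) -` U"])
       (use mholo_dilation[OF U(3)] U(2) in \<open>auto simp: zero_vec_def\<close>)
qed

lemma pd_dil: "ganalytic f \<Longrightarrow> pd j (dil u f) = scale_germ (u j) (dil u (pd j f))"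
proof transfer
  fix f :: "complex^'a \<Rightarrow> complex" and u j
  assume "analytic_near_0 f"
  then obtain U where U: "open U" "0 \<in> U" "mholo_on f U" by (rule analytic_near_0_open)
  show "germ_eq (partial_deriv j (\<lambda>x. f (\<chi> i. u i * x $ i))) (\<lambda>x. u j * partial_deriv j f (\<chi> i. u i * x $ i))"
    by (rule germ_eqI[of "(\<lambda>x. \<chi> i. u i * x $ i) -` U"])
       (use mholo_dilation[OF U(3)] U(2) open_dilation_vimage[OF U(1)] in \<open>auto simp: zero_vec_def\<close>)
qed

lemma scale_germ_eq_mult: "scale_germ c f = scale_germ c 1 * f"
  by transfer (simp add: germ_eq_def)

lemma scale_mult_left: "scale_germ c f * g = scale_germ c (f * g)"
  by transfer (simp add: germ_eq_def mult.assoc)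

lemma scale_mult_right: "f * scale_germ c g = scale_germ c (f * g)"
  by transfer (simp add: germ_eq_def mult_ac)

lemma ganalytic_scale: "ganalytic f \<Longrightarrow> ganalytic (scale_germ c f)"
  by (subst scale_germ_eq_mult) (intro ganalytic_mult ganalytic_const)

lemma pd_scale: "ganalytic f \<Longrightarrow> pd j (scale_germ c f) = scale_germ c (pd j f)"
  by (subst (1 2) scale_germ_eq_mult) (simp add: pd_mult ganalytic_const pd_const)

lemma of_nat_germ: "of_nat n = scale_germ (of_nat n) (1 :: 'n::finite germ)"
  by (induction n) (simp_all add: germ.scale_left_distrib)

lemma ganalytic_1: "ganalytic 1" and ganalytic_0: "ganalytic 0" and ganalytic_of_nat: "ganalytic (of_nat n)"
  using ganalytic_const[of 1] ganalytic_const[of 0] ganalytic_const[of "of_nat n"] by (simp_all add: of_nat_germ)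

lemma pd_0: "pd j 0 = 0" and pd_1: "pd j 1 = 0" and pd_of_nat: "pd j (of_nat n) = 0"
  using pd_const[of j 0] pd_const[of j 1] pd_const[of j "of_nat n"] by (simp_all add: of_nat_germ)

lemma ganalytic_uminus: "ganalytic f \<Longrightarrow> ganalytic (- f)"
  using ganalytic_scale[of f "-1"] by simp

lemma ganalytic_diff: "ganalytic f \<Longrightarrow> ganalytic g \<Longrightarrow> ganalytic (f - g)"
  using ganalytic_add[of f "- g"] ganalytic_uminus[of g] by simp

lemma ganalytic_sum: "(\<And>i. i \<in> A \<Longrightarrow> ganalytic (f i)) \<Longrightarrow> ganalytic (\<Sum>i\<in>A. f i)"
  by (induction A rule: infinite_finite_induct) (auto simp: ganalytic_0 ganalytic_add)

lemma ganalytic_prod: "(\<And>i. i \<in> A \<Longrightarrow> ganalytic (f i)) \<Longrightarrow> ganalytic (\<Prod>i\<in>A. f i)"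
  by (induction A rule: infinite_finite_induct) (auto simp: ganalytic_1 ganalytic_mult)

lemma ganalytic_power: "ganalytic f \<Longrightarrow> ganalytic (f ^ n)"
  by (induction n) (auto simp: ganalytic_1 ganalytic_mult)

lemmas ganalytic_intros = ganalytic_add ganalytic_mult ganalytic_diff ganalytic_uminus ganalytic_sum ganalytic_prod
  ganalytic_power ganalytic_0 ganalytic_1 ganalytic_of_nat ganalytic_X ganalytic_scale ganalytic_pd ganalytic_dil

lemma pd_sum: "(\<And>i. i \<in> A \<Longrightarrow> ganalytic (f i)) \<Longrightarrow> pd j (\<Sum>i\<in>A. f i) = (\<Sum>i\<in>A. pd j (f i))"
  by (induction A rule: infinite_finite_induct) (auto simp: pd_0 pd_add ganalytic_sum)

lemma pd_power: "ganalytic f \<Longrightarrow> pd j (f ^ Suc n) = of_nat (Suc n) * f ^ n * pd j f"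
  by (induction n) (auto simp: pd_mult ganalytic_power algebra_simps ganalytic_mult)

lemma ev0_add: "ev0 (f + g) = ev0 f + ev0 g" and ev0_mult: "ev0 (f * g) = ev0 f * ev0 g"
  and ev0_diff: "ev0 (f - g) = ev0 f - ev0 g" and ev0_uminus: "ev0 (- f) = - ev0 f"
  and ev0_scale: "ev0 (scale_germ c f) = c * ev0 f" and ev0_0: "ev0 0 = 0" and ev0_1: "ev0 1 = 1"
  and ev0_X: "ev0 (gX j) = 0"
  and ev0_dil: "ev0 (dil u f) = ev0 f"
proof -
  have [simp]: "(\<chi> i. 0) = (0 :: complex^'a)" by (simp add: vec_eq_iff)
  show "ev0 (f + g) = ev0 f + ev0 g" "ev0 (f * g) = ev0 f * ev0 g" "ev0 (f - g) = ev0 f - ev0 g" "ev0 (- f) = - ev0 f"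
    "ev0 (scale_germ c f) = c * ev0 f" "ev0 0 = 0" "ev0 1 = 1" "ev0 (gX j) = 0" "ev0 (dil u f) = ev0 f"
    by (transfer; simp)+
qed

lemma ev0_of_nat: "ev0 (of_nat n) = of_nat n"
  by (induction n) (simp_all add: ev0_add ev0_1 ev0_0)

lemma ev0_sum: "ev0 (\<Sum>i\<in>A. f i) = (\<Sum>i\<in>A. ev0 (f i))"
  by (induction A rule: infinite_finite_induct) (auto simp: ev0_add ev0_0)

lemma ev0_power: "ev0 (f ^ n) = ev0 f ^ n"
  by (induction n) (auto simp: ev0_mult ev0_1)

lemmas ev0_simps = ev0_add ev0_mult ev0_diff ev0_uminus ev0_scale ev0_0 ev0_1 ev0_X ev0_of_nat ev0_dil ev0_sum ev0_power

lemma dil_add: "dil u (f + g) = dil u f + dil u g" and dil_mult: "dil u (f * g) = dil u f * dil u g"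
  and dil_scale: "dil u (scale_germ c f) = scale_germ c (dil u f)" and dil_0: "dil u 0 = 0" and dil_1: "dil u 1 = 1"
  and dil_X: "dil u (gX j) = scale_germ (u j) (gX j)"
  by (transfer; simp add: germ_eq_def)+

lemma dil_sum: "dil u (\<Sum>i\<in>A. f i) = (\<Sum>i\<in>A. dil u (f i))"
  by (induction A rule: infinite_finite_induct) (auto simp: dil_add dil_0)

lemma dil_power: "dil u (f ^ n) = dil u f ^ n"
  by (induction n) (auto simp: dil_mult dil_1)

lemma ganalytic_inverse:
  assumes "ganalytic f" "ev0 f \<noteq> 0"
  obtains g where "ganalytic g" "f * g = 1"
proof -
  have "\<exists>g. ganalytic g \<and> f * g = 1"
    using assms
  proof transfer
    fix f :: "complex^'a \<Rightarrow> complex"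
    assume "analytic_near_0 f" and f0: "f 0 \<noteq> 0"
    then obtain U where U: "open U" "0 \<in> U" "mholo_on f U" by (metis analytic_near_0_open)
    define V where "V = U \<inter> f -` (-{0})"
    have V: "open V" "0 \<in> V" unfolding V_def
      using f0 U by (auto intro!: continuous_open_preimage mholo_on_continuous)
    have "mholo_on (\<lambda>x. inverse (f x)) V"
      using V mholo_on_subset[OF U(3), of V]
      by (intro conjunct1[OF mholo_compose[where h = inverse and h' = "\<lambda>z. - (inverse z ^ 2)"]])
         (auto simp: V_def power2_eq_square intro!: derivative_eq_intros)
    moreover have "germ_eq (\<lambda>x. f x * inverse (f x)) (\<lambda>x. 1)"
      by (rule germ_eqI[OF V]) (simp add: V_def)
    ultimately show "\<exists>g. analytic_near_0 g \<and> germ_eq (\<lambda>x. f x * g x) (\<lambda>x. 1)"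
      using V(2) analytic_near_0I by blast
  qed
  then show ?thesis using that by blast
qed

text \<open>Near the origin \<open>f\<close> stays away from the slit of \<open>Ln\<close>, because
  its value there is 1. The last clause fixes the principal branch for every representative; other
  branches of the logarithm are later compared with it.\<close>

lemma ganalytic_log:
  assumes "ganalytic f" "ev0 f = 1"
  obtains g where "ganalytic g" "\<And>j. pd j g * f = pd j f" "ev0 g = 0"
    "\<And>F. f = germ F \<Longrightarrow> g = germ (\<lambda>x. Ln (F x))"
proof -
  obtain F where F: "f = germ F" by (metis Quotient_abs_rep Quotient_germ)
  define g where "g = germ (\<lambda>x. Ln (F x))"
  have "analytic_near_0 F" using assms(1) by (simp add: F ganalytic.abs_eq)
  then obtain U where U: "open U" "0 \<in> U" "mholo_on F U" by (rule analytic_near_0_open)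
  have F0: "F 0 = 1" using assms(2) by (simp add: F ev0.abs_eq)
  define V where "V = U \<inter> F -` (- \<real>\<^sub>\<le>\<^sub>0)"
  have V: "open V" "0 \<in> V" unfolding V_def
    using F0 U by (auto intro!: continuous_open_preimage mholo_on_continuous)
  have VF: "mholo_on F V" using V mholo_on_subset[OF U(3), of V] by (auto simp: V_def)
  have L: "mholo_on (\<lambda>x. Ln (F x)) V \<and> (\<forall>x\<in>V. \<forall>j. partial_deriv j (\<lambda>x. Ln (F x)) x = inverse (F x) * partial_deriv j F x)"
    by (rule mholo_compose[OF VF]) (auto simp: V_def intro!: derivative_eq_intros)
  show ?thesis
  proof (rule that[of g])
    show "ganalytic g" unfolding g_def ganalytic.abs_eq using L V(2) analytic_near_0I by blast
    show "pd j g * f = pd j f" for j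
      unfolding g_def F pd.abs_eq times_germ.abs_eq germ.abs_eq_iff
      by (rule germ_eqI[OF V]) (use L in \<open>auto simp: V_def field_simps\<close>)
    show "ev0 g = 0" by (simp add: g_def ev0.abs_eq F0)
    fix F' assume "f = germ F'"
    then have "germ_eq F F'" using F by (simp add: germ.abs_eq_iff)
    then show "g = germ (\<lambda>x. Ln (F' x))" unfolding g_def germ.abs_eq_iff germ_eq_def by (rule eventually_mono) simp
  qed
qed

section \<open>Taylor coefficients\<close>

lemma multi_index_induct:
  fixes \<alpha> :: "'n::finite \<Rightarrow> nat"
  assumes "P (\<lambda>_. 0)" "\<And>\<alpha> i. P \<alpha> \<Longrightarrow> P (\<alpha>(i := Suc (\<alpha> i)))"
  shows "P \<alpha>"
proof (induction "sum \<alpha> UNIV" arbitrary: \<alpha>)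
  case 0
  then have "\<alpha> = (\<lambda>_. 0)" by auto
  then show ?case using assms(1) by simp
next
  case (Suc k)
  then obtain i where i: "\<alpha> i > 0" by (metis Zero_not_Suc finite less_nat_zero_code neq0_conv sum.neutral)
  let ?\<beta> = "\<alpha>(i := \<alpha> i - 1)"
  have "sum \<alpha> UNIV = Suc (sum ?\<beta> UNIV)"
    using i by (simp add: sum.remove[of UNIV i])
  then have "P ?\<beta>" using Suc by simp
  from assms(2)[OF this, of i] i show ?case by simp
qed

lemma sum_fun_upd: "sum (\<alpha>(i := x)) UNIV + \<alpha> i = sum \<alpha> UNIV + (x :: nat)"
  for \<alpha> :: "'n::finite \<Rightarrow> nat"
  by (simp add: sum.remove[of UNIV i])

lemma sum_fun_upd_Suc: "sum (\<alpha>(i := Suc (\<alpha> i))) UNIV = Suc (sum \<alpha> UNIV)"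
  for \<alpha> :: "'n::finite \<Rightarrow> nat"
  using sum_fun_upd[of \<alpha> i "Suc (\<alpha> i)"] by simp

text \<open>Taylor coefficients by peeling off one derivative at a time, in an arbitrarily chosen
  direction with positive index. Since partial derivatives commute, the choice does not matter for
  analytic germs; \<open>coef_pd\<close> makes this precise.\<close>

primrec coefn :: "nat \<Rightarrow> 'n::finite germ \<Rightarrow> ('n \<Rightarrow> nat) \<Rightarrow> complex" where
  "coefn 0 g \<alpha> = ev0 g"
| "coefn (Suc k) g \<alpha> =
     (let i = (SOME i. \<alpha> i > 0) in coefn k (pd i g) (\<alpha>(i := \<alpha> i - 1)) / of_nat (\<alpha> i))"

definition coef :: "'n::finite germ \<Rightarrow> ('n \<Rightarrow> nat) \<Rightarrow> complex" where
  "coef g \<alpha> = coefn (sum \<alpha> UNIV) g \<alpha>"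

lemma coef_zero: "coef g (\<lambda>_. 0) = ev0 g"
  by (simp add: coef_def)

text \<open>If the chosen direction \<open>i0\<close> is not \<open>i\<close>, the two derivatives
  are exchanged and the induction hypothesis is used twice at the index \<open>\<gamma>\<close>
  obtained by lowering \<open>i0\<close>, once for each direction.\<close>

lemma coef_pd:
  "ganalytic g \<Longrightarrow> coef (pd i g) \<alpha> = of_nat (Suc (\<alpha> i)) * coef g (\<alpha>(i := Suc (\<alpha> i)))"
proof (induction "sum \<alpha> UNIV" arbitrary: g \<alpha> i rule: less_induct)
  case less
  define k where "k = sum \<alpha> UNIV"
  define \<alpha>' where "\<alpha>' = \<alpha>(i := Suc (\<alpha> i))"
  define i0 where "i0 = (SOME i. \<alpha>' i > 0)"
  have "\<alpha>' i > 0" by (simp add: \<alpha>'_def)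
  then have i0: "\<alpha>' i0 > 0" unfolding i0_def by (rule someI)
  have s': "sum \<alpha>' UNIV = Suc k" unfolding \<alpha>'_def k_def by (rule sum_fun_upd_Suc)
  have "sum (\<alpha>'(i0 := \<alpha>' i0 - 1)) UNIV = k"
    using sum_fun_upd[of \<alpha>' i0 "\<alpha>' i0 - 1"] s' i0 by simp
  then have unf: "coef g \<alpha>' = coef (pd i0 g) (\<alpha>'(i0 := \<alpha>' i0 - 1)) / of_nat (\<alpha>' i0)"
    unfolding coef_def s' by (simp add: Let_def i0_def)
  show ?case
  proof (cases "i0 = i")
    case True
    then have "\<alpha>'(i0 := \<alpha>' i0 - 1) = \<alpha>" "\<alpha>' i0 = Suc (\<alpha> i)" by (auto simp: \<alpha>'_def)
    then show ?thesis using unf True by (simp add: \<alpha>'_def[symmetric] del: of_nat_Suc)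
  next
    case False
    define \<gamma> where "\<gamma> = \<alpha>(i0 := \<alpha> i0 - 1)"
    have a0: "\<alpha> i0 > 0" using i0 False by (simp add: \<alpha>'_def)
    then have sg: "sum \<gamma> UNIV < sum \<alpha> UNIV"
      using sum_fun_upd[of \<alpha> i0 "\<alpha> i0 - 1"] by (simp add: \<gamma>_def)
    have e1: "\<alpha>'(i0 := \<alpha>' i0 - 1) = \<gamma>(i := Suc (\<gamma> i))" "\<gamma> i = \<alpha> i" "\<alpha>' i0 = \<alpha> i0"
      using False by (auto simp: \<alpha>'_def \<gamma>_def)
    have e2: "\<gamma>(i0 := Suc (\<gamma> i0)) = \<alpha>" "Suc (\<gamma> i0) = \<alpha> i0" using a0 by (auto simp: \<gamma>_def)
    have 1: "coef (pd i (pd i0 g)) \<gamma> = of_nat (Suc (\<alpha> i)) * coef (pd i0 g) (\<gamma>(i := Suc (\<gamma> i)))"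
      using less.hyps[OF sg, of "pd i0 g" i] less.prems by (simp add: ganalytic_pd e1(2) del: of_nat_Suc)
    have 2: "coef (pd i0 (pd i g)) \<gamma> = of_nat (\<alpha> i0) * coef (pd i g) \<alpha>"
      using less.hyps[OF sg, of "pd i g" i0] less.prems unfolding e2(1) unfolding e2(2) by (simp add: ganalytic_pd)
    have "of_nat (\<alpha> i0) * coef (pd i g) \<alpha> = of_nat (\<alpha> i0) * (of_nat (Suc (\<alpha> i)) * coef g \<alpha>')"
      unfolding unf[unfolded e1(1), unfolded e1(3)] 2[symmetric] pd_commute[OF less.prems, of i0 i] 1 using a0 by simp
    then show ?thesis using a0 unfolding \<alpha>'_def by (simp del: of_nat_Suc)
  qed
qed

lemma coef_Suc: "ganalytic g \<Longrightarrow> coef g (\<alpha>(i := Suc (\<alpha> i))) = coef (pd i g) \<alpha> / of_nat (Suc (\<alpha> i))"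
  by (simp add: coef_pd del: of_nat_Suc)

lemma coef_add: "ganalytic f \<Longrightarrow> ganalytic g \<Longrightarrow> coef (f + g) \<alpha> = coef f \<alpha> + coef g \<alpha>"
  by (induction \<alpha> arbitrary: f g rule: multi_index_induct)
     (simp_all add: coef_zero ev0_simps coef_Suc pd_add ganalytic_intros add_divide_distrib del: of_nat_Suc)

lemma coef_scale: "ganalytic f \<Longrightarrow> coef (scale_germ c f) \<alpha> = c * coef f \<alpha>"
  by (induction \<alpha> arbitrary: f rule: multi_index_induct)
     (simp_all add: coef_zero ev0_simps coef_Suc pd_scale ganalytic_intros del: of_nat_Suc)

lemma coef_0: "coef 0 \<alpha> = 0"
  using coef_scale[OF ganalytic_0, of 0] by simp

lemma coef_uminus: "ganalytic f \<Longrightarrow> coef (- f) \<alpha> = - coef f \<alpha>"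
  using coef_scale[of f "-1"] by simp

lemma coef_diff: "ganalytic f \<Longrightarrow> ganalytic g \<Longrightarrow> coef (f - g) \<alpha> = coef f \<alpha> - coef g \<alpha>"
  using coef_add[of f "- g"] by (simp add: coef_uminus ganalytic_uminus)

lemma coef_sum: "(\<And>i. i \<in> A \<Longrightarrow> ganalytic (f i)) \<Longrightarrow> coef (\<Sum>i\<in>A. f i) \<alpha> = (\<Sum>i\<in>A. coef (f i) \<alpha>)"
  by (induction A rule: infinite_finite_induct) (auto simp: coef_0 coef_add ganalytic_sum)

lemma coef_X_mult:
  "ganalytic g \<Longrightarrow> coef (gX j * g) \<alpha> = (if \<alpha> j = 0 then 0 else coef g (\<alpha>(j := \<alpha> j - 1)))"
proof (induction \<alpha> arbitrary: g rule: multi_index_induct)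
  case 1
  then show ?case by (simp add: coef_zero ev0_simps)
next
  case (2 \<alpha> i)
  show ?case
  proof (cases "i = j")
    case False
    then have "(\<alpha>(i := Suc (\<alpha> i), j := \<alpha> j - 1)) = (\<alpha>(j := \<alpha> j - 1))(i := Suc ((\<alpha>(j := \<alpha> j - 1)) i))"
      by auto
    then have "coef g (\<alpha>(i := Suc (\<alpha> i), j := \<alpha> j - 1)) = coef (pd i g) (\<alpha>(j := \<alpha> j - 1)) / of_nat (Suc (\<alpha> i))"
      using coef_Suc[OF 2(2), of "\<alpha>(j := \<alpha> j - 1)" i] False by (simp del: of_nat_Suc)
    then show ?thesis
      unfolding coef_Suc[OF ganalytic_mult[OF ganalytic_X 2(2)]]
      using 2 False by (simp add: pd_mult pd_X ganalytic_intros fun_upd_def del: of_nat_Suc)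
  next
    case True
    have "\<alpha> j * coef g \<alpha> = coef (pd j g) (\<alpha>(j := \<alpha> j - 1))" if "\<alpha> j \<noteq> 0"
      using that by (simp add: coef_pd[OF 2(2)] del: of_nat_Suc)
    then have c: "coef (gX j * pd j g) \<alpha> = of_nat (\<alpha> j) * coef g \<alpha>"
      using 2(1)[OF ganalytic_pd[OF 2(2), of j]] by (auto simp: fun_upd_def)
    have "coef (pd j (gX j * g)) \<alpha> = of_nat (Suc (\<alpha> j)) * coef g \<alpha>"
      using 2(2) by (simp add: pd_mult pd_X coef_add ganalytic_mult ganalytic_X ganalytic_pd c algebra_simps)
    then show ?thesis
      unfolding True coef_Suc[OF ganalytic_mult[OF ganalytic_X 2(2)]] by (simp del: of_nat_Suc)
  qed
qed

text \<open>Euler operators are diagonal on monomials, so the left side of the Mellin system only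
  rescales each coefficient.\<close>

lemma coef_theta: "ganalytic g \<Longrightarrow> coef (gX j * pd j g) \<alpha> = of_nat (\<alpha> j) * coef g \<alpha>"
  by (auto simp: coef_X_mult ganalytic_intros coef_pd simp del: of_nat_Suc)

lemma coef_dil: "ganalytic g \<Longrightarrow> coef (dil u g) \<alpha> = (\<Prod>i\<in>UNIV. u i ^ \<alpha> i) * coef g \<alpha>"
proof (induction \<alpha> arbitrary: g rule: multi_index_induct)
  case 1
  then show ?case by (simp add: coef_zero ev0_simps)
next
  case (2 \<alpha> j)
  have "(\<Prod>i\<in>UNIV. u i ^ (\<alpha>(j := Suc (\<alpha> j))) i) = u j * (\<Prod>i\<in>UNIV. u i ^ \<alpha> i)"
    by (simp add: prod.remove[of UNIV j])
  then show ?case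
    unfolding coef_Suc[OF 2(2)] coef_Suc[OF ganalytic_dil[OF 2(2)]]
    using 2 by (simp add: pd_dil ganalytic_intros coef_scale del: of_nat_Suc fun_upd_apply)
qed

definition gmon :: "('n::finite \<Rightarrow> nat) \<Rightarrow> 'n germ" where
  "gmon a = (\<Prod>i\<in>UNIV. gX i ^ a i)"

lemma gmon_Suc: "gmon (a(i := Suc (a i))) = gX i * gmon a"
  by (simp add: gmon_def prod.remove[of UNIV i])

lemma gmon_0: "gmon (\<lambda>_. 0) = 1"
  by (simp add: gmon_def)

lemma gmon_add: "gmon (\<lambda>i. a i + b i) = gmon a * gmon b"
  by (simp add: gmon_def power_add prod.distrib)

lemma ganalytic_gmon: "ganalytic (gmon a)"
  unfolding gmon_def by (intro ganalytic_intros)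

lemma coef_1: "coef 1 \<alpha> = (if \<alpha> = (\<lambda>_. 0) then 1 else 0)"
proof (induction \<alpha> rule: multi_index_induct)
  case (2 \<alpha> i)
  have "\<alpha>(i := Suc (\<alpha> i)) \<noteq> (\<lambda>_. 0)" by (metis fun_upd_same nat.simps(3))
  then show ?case unfolding coef_Suc[OF ganalytic_1] by (simp add: pd_1 coef_0 del: fun_upd_apply)
qed (simp add: coef_zero ev0_simps)

lemma coef_gmon: "coef (gmon a) \<alpha> = (if \<alpha> = a then 1 else 0)"
proof (induction a arbitrary: \<alpha> rule: multi_index_induct)
  case 1
  then show ?case by (simp add: gmon_0 coef_1)
next
  case (2 a i)
  have "\<alpha> i \<noteq> 0 \<and> \<alpha>(i := \<alpha> i - 1) = a \<longleftrightarrow> \<alpha> = a(i := Suc (a i))"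
    by (auto simp: fun_eq_iff)
  then show ?case unfolding gmon_Suc coef_X_mult[OF ganalytic_gmon] 2 by auto
qed

text \<open>The power series in t of f at the point (t^w_1, ..., t^w_n). If some weight is 0, the
  curve does not start at the origin and the series would not depend on the germ alone; the value is
  then set to 0.\<close>

lift_definition cfps :: "('n \<Rightarrow> nat) \<Rightarrow> 'n::finite germ \<Rightarrow> complex fps" is
  "\<lambda>w f. if \<forall>i. w i > 0 then fps_expansion (\<lambda>t. f (\<chi> i. t ^ w i)) 0 else 0"
proof -
  fix w and f g :: "complex^'n \<Rightarrow> complex"
  assume *: "germ_eq f g"
  show "(if \<forall>i. w i > 0 then fps_expansion (\<lambda>t. f (\<chi> i. t ^ w i)) 0 else 0) =
        (if \<forall>i. w i > 0 then fps_expansion (\<lambda>t. g (\<chi> i. t ^ w i)) 0 else 0)"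
  proof (cases "\<forall>i. w i > 0")
    case True
    have "((\<lambda>t::complex. \<chi> i. t ^ w i) \<longlongrightarrow> (\<chi> i. 0 ^ w i)) (nhds 0)"
      by (intro tendsto_vec_lambda tendsto_power filterlim_ident)
    also have "(\<chi> i. 0 ^ w i) = (0 :: complex^'n)" using True by (simp add: vec_eq_iff)
    finally have "\<forall>\<^sub>F t in nhds 0. f (\<chi> i. t ^ w i) = g (\<chi> i. t ^ w i)"
      using * unfolding germ_eq_def by (rule eventually_compose_filterlim[rotated])
    then have "(deriv ^^ n) (\<lambda>t. f (\<chi> i. t ^ w i)) 0 = (deriv ^^ n) (\<lambda>t. g (\<chi> i. t ^ w i)) 0" for n
      by (rule higher_deriv_cong_ev) simp
    then have "fps_expansion (\<lambda>t. f (\<chi> i. t ^ w i)) 0 = fps_expansion (\<lambda>t. g (\<chi> i. t ^ w i)) 0"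
      by (simp add: fps_expansion_def)
    then show ?thesis unfolding if_P[OF True] .
  next
    case False
    then show ?thesis by (simp only: if_False)
  qed
qed

lemma curve_holo:
  fixes w :: "'n::finite \<Rightarrow> nat"
  assumes "mholo_on f U" "0 \<in> U" and w: "\<And>i. w i > 0"
  shows "(\<lambda>t. f (\<chi> i. t ^ w i)) has_fps_expansion cfps w (germ f)"
    and "\<forall>\<^sub>F t in nhds 0. deriv (\<lambda>t. f (\<chi> i. t ^ w i)) t =
           (\<Sum>i\<in>UNIV. of_nat (w i) * t ^ (w i - 1) * partial_deriv i f (\<chi> i. t ^ w i))"
proof -
  define T where "T = (\<lambda>t::complex. (\<chi> i. t ^ w i) :: complex^'n) -` U"
  have "open U" using assms by (simp add: mholo_on_def)
  then have T: "open T" unfolding T_def by (rule open_vimage) (intro continuous_intros)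
  have "(\<chi> i. 0 ^ w i) = (0 :: complex^'n)" using w by (simp add: vec_eq_iff)
  then have T0: "0 \<in> T" using assms by (simp add: T_def)
  have D: "((\<lambda>t. f (\<chi> i. t ^ w i)) has_field_derivative
     (\<Sum>i\<in>UNIV. of_nat (w i) * t ^ (w i - 1) * partial_deriv i f (\<chi> i. t ^ w i))) (at t)" if "t \<in> T" for t
  proof (rule mholo_on_curve[OF assms(1), where \<gamma> = "\<lambda>t. \<chi> i. t ^ w i"])
    show "((\<lambda>t. (\<chi> i. t ^ w i) $ i) has_field_derivative of_nat (w i) * t ^ (w i - 1)) (at t)" for i
      by (auto intro!: derivative_eq_intros)
  qed (use that in \<open>simp add: T_def\<close>)
  have "(\<lambda>t. f (\<chi> i. t ^ w i)) analytic_on {0}"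
    using D T T0 analytic_at holomorphic_on_open by blast
  then have "(\<lambda>t. f (\<chi> i. t ^ w i)) has_fps_expansion fps_expansion (\<lambda>t. f (\<chi> i. t ^ w i)) 0"
    by (rule analytic_at_imp_has_fps_expansion_0)
  then show "(\<lambda>t. f (\<chi> i. t ^ w i)) has_fps_expansion cfps w (germ f)"
    using w by (simp add: cfps.abs_eq)
  show "\<forall>\<^sub>F t in nhds 0. deriv (\<lambda>t. f (\<chi> i. t ^ w i)) t =
           (\<Sum>i\<in>UNIV. of_nat (w i) * t ^ (w i - 1) * partial_deriv i f (\<chi> i. t ^ w i))"
    unfolding eventually_nhds using T T0 DERIV_imp_deriv[OF D] by blast
qed

lemma germ_cases: obtains F where "f = germ F"
  by (metis Quotient_abs_rep Quotient_germ)

lemma ganalytic_cases: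
  assumes "ganalytic f"
  obtains F U where "f = germ F" "open U" "0 \<in> U" "mholo_on F U"
proof -
  obtain F where F: "f = germ F" by (rule germ_cases)
  then have "analytic_near_0 F" using assms by (simp add: ganalytic.abs_eq)
  then show ?thesis using that F analytic_near_0_open by metis
qed

context
  fixes w :: "'n::finite \<Rightarrow> nat"
  assumes w: "\<And>i. w i > 0"
begin

lemma cfps_add:
  assumes "ganalytic f" "ganalytic g"
  shows "cfps w (f + g) = cfps w f + cfps w g"
proof -
  obtain F U where F: "f = germ F" "0 \<in> U" "mholo_on F U" using ganalytic_cases[OF assms(1)] .
  obtain G V where G: "g = germ G" "0 \<in> V" "mholo_on G V" using ganalytic_cases[OF assms(2)] .
  have "(\<lambda>t. F (\<chi> i. t ^ w i) + G (\<chi> i. t ^ w i)) has_fps_expansion (cfps w f + cfps w g)"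
    unfolding F G by (intro fps_expansion_intros curve_holo[OF F(3,2) w] curve_holo[OF G(3,2) w])
  moreover obtain W where "0 \<in> W" "mholo_on (\<lambda>x. F x + G x) W"
    using ganalytic_add[OF assms] unfolding F G plus_germ.abs_eq ganalytic.abs_eq analytic_near_0_iff by blast
  note curve_holo(1)[OF this(2,1) w]
  ultimately show ?thesis unfolding F G plus_germ.abs_eq by (rule fps_expansion_unique_complex[rotated])
qed

lemma cfps_mult:
  assumes "ganalytic f" "ganalytic g"
  shows "cfps w (f * g) = cfps w f * cfps w g"
proof -
  obtain F U where F: "f = germ F" "0 \<in> U" "mholo_on F U" using ganalytic_cases[OF assms(1)] .
  obtain G V where G: "g = germ G" "0 \<in> V" "mholo_on G V" using ganalytic_cases[OF assms(2)] .
  have "(\<lambda>t. F (\<chi> i. t ^ w i) * G (\<chi> i. t ^ w i)) has_fps_expansion (cfps w f * cfps w g)"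
    unfolding F G by (intro fps_expansion_intros curve_holo[OF F(3,2) w] curve_holo[OF G(3,2) w])
  moreover obtain W where "0 \<in> W" "mholo_on (\<lambda>x. F x * G x) W"
    using ganalytic_mult[OF assms] unfolding F G times_germ.abs_eq ganalytic.abs_eq analytic_near_0_iff by blast
  note curve_holo(1)[OF this(2,1) w]
  ultimately show ?thesis unfolding F G times_germ.abs_eq by (rule fps_expansion_unique_complex[rotated])
qed

lemma cfps_const: "cfps w (scale_germ c 1) = fps_const c"
proof -
  have "(\<lambda>t. c * 1) has_fps_expansion cfps w (germ (\<lambda>x. c * 1))"
    by (rule curve_holo[of _ UNIV]) (use w mholo_const in auto)
  moreover have "(\<lambda>t::complex. c * 1) has_fps_expansion fps_const c" by simp
  moreover have "scale_germ c (1 :: 'n germ) = germ (\<lambda>x. c * 1)" by (simp add: one_germ_def scale_germ.abs_eq)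
  ultimately show ?thesis using fps_expansion_unique_complex by metis
qed

lemma cfps_X: "cfps w (gX j) = fps_X ^ w j"
proof -
  have "(\<lambda>t. (\<chi> i. t ^ w i) $ j) has_fps_expansion cfps w (germ (\<lambda>x. x $ j))"
    by (rule curve_holo[of _ UNIV]) (use w mholo_coord in auto)
  then have 1: "(\<lambda>t. t ^ w j) has_fps_expansion cfps w (gX j)" by (simp add: gX.abs_eq)
  have 2: "(\<lambda>t::complex. t ^ w j) has_fps_expansion fps_X ^ w j" by (intro fps_expansion_intros)
  show ?thesis by (rule fps_expansion_unique_complex[OF 1 2])
qed

lemma cfps_pd:
  assumes "ganalytic f"
  shows "fps_deriv (cfps w f) = (\<Sum>i\<in>UNIV. fps_const (of_nat (w i)) * fps_X ^ (w i - 1) * cfps w (pd i f))"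
proof -
  obtain F U where F: "f = germ F" "0 \<in> U" "mholo_on F U" using ganalytic_cases[OF assms(1)] .
  have 1: "deriv (\<lambda>t. F (\<chi> i. t ^ w i)) has_fps_expansion fps_deriv (cfps w f)"
    unfolding F by (intro fps_expansion_intros curve_holo[OF F(3,2) w])
  have 2: "(\<lambda>t. \<Sum>i\<in>UNIV. of_nat (w i) * t ^ (w i - 1) * partial_deriv i F (\<chi> i. t ^ w i)) has_fps_expansion
     (\<Sum>i\<in>UNIV. fps_const (of_nat (w i)) * fps_X ^ (w i - 1) * cfps w (pd i f))"
    unfolding F pd.abs_eq
    by (intro fps_expansion_intros curve_holo[OF mholo_on_partial_deriv[OF F(3)] F(2) w])
  show ?thesis
    by (rule fps_expansion_unique_complex[OF iffD1[OF has_fps_expansion_cong[OF curve_holo(2)[OF F(3,2) w] refl] 1] 2])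
qed

lemma cfps_nth_0: "ganalytic f \<Longrightarrow> fps_nth (cfps w f) 0 = ev0 f"
proof -
  assume "ganalytic f"
  then obtain F U where F: "f = germ F" "0 \<in> U" "mholo_on F U" using ganalytic_cases by metis
  have "(\<chi> i. 0 ^ w i) = (0 :: complex^'n)" using w by (simp add: vec_eq_iff)
  then show ?thesis unfolding F fps_nth_fps_expansion[OF curve_holo(1)[OF F(3,2) w]] by (simp add: ev0.abs_eq)
qed

lemma finite_weighted: "finite {\<alpha> :: 'n \<Rightarrow> nat. (\<Sum>i\<in>UNIV. w i * \<alpha> i) = k}"
proof (rule finite_subset)
  show "{\<alpha> :: 'n \<Rightarrow> nat. (\<Sum>i\<in>UNIV. w i * \<alpha> i) = k} \<subseteq> PiE UNIV (\<lambda>_. {..k})"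
  proof
    fix \<alpha> :: "'n \<Rightarrow> nat" assume "\<alpha> \<in> {\<alpha>. (\<Sum>i\<in>UNIV. w i * \<alpha> i) = k}"
    then have s: "(\<Sum>i\<in>UNIV. w i * \<alpha> i) = k" by simp
    have "\<alpha> i \<le> k" for i
    proof -
      have "\<alpha> i \<le> w i * \<alpha> i" using w[of i] by simp
      also have "\<dots> \<le> k" unfolding s[symmetric] by (rule member_le_sum) auto
      finally show ?thesis .
    qed
    then show "\<alpha> \<in> PiE UNIV (\<lambda>_. {..k})" by (simp add: PiE_UNIV_domain)
  qed
  show "finite (PiE (UNIV :: 'n set) (\<lambda>_. {..k}))" by (rule finite_PiE) auto
qed

text \<open>Follows by comparing coefficients in \<open>F'(t) = \<Sum>\<^sub>i w\<^sub>i t\<^bsup>w\<^sub>i - 1\<^esup> (\<partial>\<^sub>i f)(t\<^sup>w)\<close>, where \<open>F(t) = f(t\<^sup>w)\<close>.\<close>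

lemma cfps_nth:
  "ganalytic f \<Longrightarrow> fps_nth (cfps w f) k = (\<Sum>\<alpha> | (\<Sum>i\<in>UNIV. w i * \<alpha> i) = k. coef f \<alpha>)"
proof (induction k arbitrary: f rule: less_induct)
  case (less k)
  show ?case
  proof (cases k)
    case 0
    have "{\<alpha>. (\<Sum>i\<in>UNIV. w i * \<alpha> i) = 0} = {\<lambda>_. 0}"
      using w by (auto simp: fun_eq_iff) (metis less_irrefl)
    then show ?thesis using 0 less.prems by (simp add: cfps_nth_0 coef_zero)
  next
    case (Suc k')
    let ?S = "\<lambda>k. {\<alpha>. (\<Sum>i\<in>UNIV. w i * \<alpha> i) = k}"
    have part: "fps_nth (fps_const (of_nat (w i)) * fps_X ^ (w i - 1) * cfps w (pd i f)) k' =
        (\<Sum>\<alpha>\<in>?S k. of_nat (w i * \<alpha> i) * coef f \<alpha>)" for i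
    proof -
      have "(\<Sum>\<alpha>\<in>?S k. of_nat (w i * \<alpha> i) * coef f \<alpha>) = (\<Sum>\<alpha>\<in>{\<alpha>\<in>?S k. \<alpha> i > 0}. of_nat (w i * \<alpha> i) * coef f \<alpha>)"
        by (rule sum.mono_neutral_right) (auto simp: finite_weighted)
      also have "\<dots> = (if k < w i then 0 else \<Sum>\<gamma>\<in>?S (k - w i). of_nat (w i) * coef (pd i f) \<gamma>)"
      proof (cases "k < w i")
        case True
        have "{\<alpha>\<in>?S k. \<alpha> i > 0} = {}"
        proof -
          have le: "w i \<le> (\<Sum>i\<in>UNIV. w i * \<alpha> i)" if "\<alpha> i > 0" for \<alpha>
          proof -
            have "w i \<le> w i * \<alpha> i" using that by simp
            also have "\<dots> \<le> (\<Sum>i\<in>UNIV. w i * \<alpha> i)" by (rule member_le_sum) auto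
            finally show ?thesis .
          qed
          show ?thesis
          proof (rule equals0I)
            fix \<alpha> assume "\<alpha> \<in> {\<alpha>\<in>?S k. \<alpha> i > 0}"
            then show False using le[of \<alpha>] True by simp
          qed
        qed
        then show ?thesis using True by (simp only:) simp
      next
        case False
        have wsum: "(\<Sum>l\<in>UNIV. w l * (\<alpha>(i := x)) l) + w i * \<alpha> i = (\<Sum>l\<in>UNIV. w l * \<alpha> l) + w i * x" for \<alpha> x
          by (simp add: sum.remove[of UNIV i])
        have "(\<Sum>\<gamma>\<in>?S (k - w i). of_nat (w i) * coef (pd i f) \<gamma>) =
              (\<Sum>\<alpha>\<in>{\<alpha>\<in>?S k. \<alpha> i > 0}. of_nat (w i * \<alpha> i) * coef f \<alpha>)"
        proof (rule sum.reindex_bij_witness[of _ "\<lambda>\<alpha>. \<alpha>(i := \<alpha> i - 1)" "\<lambda>\<gamma>. \<gamma>(i := Suc (\<gamma> i))"])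
          fix \<gamma> assume g: "\<gamma> \<in> ?S (k - w i)"
          show "(\<gamma>(i := Suc (\<gamma> i)))(i := (\<gamma>(i := Suc (\<gamma> i))) i - 1) = \<gamma>" by simp
          show "\<gamma>(i := Suc (\<gamma> i)) \<in> {\<alpha>\<in>?S k. \<alpha> i > 0}"
            using wsum[of \<gamma> "Suc (\<gamma> i)"] g False by simp
          show "of_nat (w i * (\<gamma>(i := Suc (\<gamma> i))) i) * coef f (\<gamma>(i := Suc (\<gamma> i))) = of_nat (w i) * coef (pd i f) \<gamma>"
            by (simp add: coef_pd[OF less.prems] algebra_simps)
        next
          fix \<alpha> assume a: "\<alpha> \<in> {\<alpha>\<in>?S k. \<alpha> i > 0}"
          then show "(\<alpha>(i := \<alpha> i - 1))(i := Suc ((\<alpha>(i := \<alpha> i - 1)) i)) = \<alpha>" by simp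
          have "w i * \<alpha> i = w i * (\<alpha> i - 1) + w i" using a by (cases "\<alpha> i") auto
          then show "\<alpha>(i := \<alpha> i - 1) \<in> ?S (k - w i)"
            using wsum[of \<alpha> "\<alpha> i - 1"] a by simp
        qed
        then show ?thesis using False by simp
      qed
      also have "\<dots> = fps_nth (fps_const (of_nat (w i)) * fps_X ^ (w i - 1) * cfps w (pd i f)) k'"
      proof -
        have "k' < w i - 1 \<longleftrightarrow> k < w i" using Suc w[of i] by auto
        moreover have "k' - (w i - 1) = k - w i" using Suc w[of i] by auto
        moreover have "k - w i < k" using Suc w[of i] by simp
        ultimately show ?thesis
          using less.IH[of "k - w i" "pd i f"] ganalytic_pd[OF less.prems, of i]
          by (simp add: mult.assoc fps_X_power_mult_nth sum_distrib_left)
      qed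
      finally show ?thesis ..
    qed
    have "of_nat k * fps_nth (cfps w f) k = fps_nth (fps_deriv (cfps w f)) k'" using Suc by simp
    also have "\<dots> = (\<Sum>i\<in>UNIV. \<Sum>\<alpha>\<in>?S k. of_nat (w i * \<alpha> i) * coef f \<alpha>)"
      unfolding cfps_pd[OF less.prems] fps_sum_nth part ..
    also have "\<dots> = (\<Sum>\<alpha>\<in>?S k. of_nat (\<Sum>i\<in>UNIV. w i * \<alpha> i) * coef f \<alpha>)"
      unfolding of_nat_sum sum_distrib_right by (rule sum.swap)
    also have "\<dots> = of_nat k * (\<Sum>\<alpha>\<in>?S k. coef f \<alpha>)"
      unfolding sum_distrib_left by (rule sum.cong) auto
    finally show ?thesis using Suc by (simp del: of_nat_Suc)
  qed
qed

end

text \<open>The parameters t with x + t v in the convex set form a convex, hence connected, set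
  containing 0 and 1, so the identity theorem in one variable carries the vanishing from t = 0 to t
  = 1.\<close>

lemma mholo_on_line_zero:
  fixes v x :: "complex^'n"
  assumes F: "mholo_on F C" and C: "convex C" "x \<in> C" "x + v \<in> C"
    and z: "\<forall>\<^sub>F t in nhds 0. F (x + t *s v) = 0"
  shows "F (x + v) = 0"
proof -
  define T where "T = (\<lambda>t. x + t *s v) -` C"
  have bl: "bounded_linear (\<lambda>t. t *s v)" by (rule bounded_linear_smult_left)
  have "T = (\<lambda>t. t *s v) -` ((+) (-x) ` C)"
    by (auto simp: T_def image_iff algebra_simps intro!: bexI[of _ "x + _"])
  then have "convex T"
    using convex_linear_vimage[OF bounded_linear.linear[OF bl], of "(+) (-x) ` C"] C(1) by (simp add: convex_translation)
  have "open C" using F by (simp add: mholo_on_def)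
  then have "open T" unfolding T_def
    by (rule open_vimage) (intro continuous_intros bounded_linear.continuous_on[OF bl])
  have "((\<lambda>t. F (x + t *s v)) has_field_derivative (\<Sum>i\<in>UNIV. v $ i * partial_deriv i F (x + t *s v))) (at t)"
    if "t \<in> T" for t
    by (rule mholo_on_curve[OF F, where \<gamma> = "\<lambda>t. x + t *s v"])
       (use that in \<open>auto simp: T_def intro!: derivative_eq_intros\<close>)
  then have hol: "(\<lambda>t. F (x + t *s v)) holomorphic_on T"
    using \<open>open T\<close> holomorphic_on_open by blast
  have "(\<lambda>t. F (x + t *s v)) has_fps_expansion 0"
    using has_fps_expansion_cong[OF z refl, of 0] by simp
  then have "F (x + 1 *s v) = 0"
    by (rule has_fps_expansion_0_analytic_continuation[OF _ hol \<open>open T\<close> convex_connected[OF \<open>convex T\<close>]])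
       (use C in \<open>auto simp: T_def\<close>)
  then show ?thesis by simp
qed

lemma ganalytic_ball:
  assumes "ganalytic f"
  obtains F r where "f = germ F" "r > 0" "mholo_on F (ball 0 r)"
proof -
  obtain F U where F: "f = germ F" "open U" "0 \<in> U" "mholo_on F U" by (rule ganalytic_cases[OF assms])
  obtain r where "r > 0" "ball 0 r \<subseteq> U" using F(2,3) open_contains_ball by blast
  then show ?thesis using that F mholo_on_subset by blast
qed

lemma germ_eq_0I: "r > 0 \<Longrightarrow> (\<And>x. x \<in> ball 0 r \<Longrightarrow> F x = 0) \<Longrightarrow> germ F = 0"
  unfolding zero_germ_def germ.abs_eq_iff by (rule germ_eqI[of "ball 0 r"]) auto

text \<open>Reduction to one variable: dilating by the coordinates of x and restricting to the
  diagonal gives the function t -> f(t x), whose power series coefficients are sums of Taylor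
  coefficients of the dilate.\<close>

lemma coef_eq_0_imp_eq_0:
  assumes "ganalytic f" "\<And>\<alpha>. coef f \<alpha> = 0"
  shows "f = 0"
proof -
  obtain F r where F: "f = germ F" "r > 0" "mholo_on F (ball 0 r)" by (rule ganalytic_ball[OF assms(1)])
  have "F x = 0" if x: "x \<in> ball 0 r" for x
  proof -
    have "F (0 + x) = 0"
    proof (rule mholo_on_line_zero[OF F(3)])
      have "fps_nth (cfps (\<lambda>_. 1) (dil (vec_nth x) f)) k = 0" for k
        by (subst cfps_nth) (auto intro: ganalytic_dil[OF assms(1)] simp: coef_dil[OF assms(1)] assms(2))
      then have z: "cfps (\<lambda>_. 1) (dil (vec_nth x) f) = 0" by (simp add: fps_eq_iff)
      obtain W where "0 \<in> W" "mholo_on (\<lambda>y. F (\<chi> i. x $ i * y $ i)) W"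
        using ganalytic_dil[OF assms(1), of "vec_nth x"] unfolding F dil.abs_eq ganalytic.abs_eq analytic_near_0_iff by blast
      from curve_holo(1)[OF this(2,1), of "\<lambda>_. 1"] z
      have "(\<lambda>t. F (\<chi> i. x $ i * (\<chi> i. t ^ 1) $ i)) has_fps_expansion 0"
        by (simp add: F dil.abs_eq)
      then have "\<forall>\<^sub>F t in nhds 0. F (\<chi> i. x $ i * (\<chi> i. t ^ 1) $ i) = 0"
        by (auto simp: has_fps_expansion_def elim: eventually_mono)
      then show "\<forall>\<^sub>F t in nhds 0. F (0 + t *s x) = 0"
        by (rule eventually_mono) (simp add: vector_scalar_mult_def mult.commute)
    qed (use x F in auto)
    then show ?thesis by simp
  qed
  then show ?thesis unfolding F(1) using germ_eq_0I[OF F(2)] by blast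
qed

lemma coef_eqI:
  assumes "ganalytic f" "ganalytic g" "\<And>\<alpha>. coef f \<alpha> = coef g \<alpha>"
  shows "f = g"
  using coef_eq_0_imp_eq_0[of "f - g"] assms by (simp add: ganalytic_diff coef_diff)

text \<open>Around some point x with G x \<noteq> 0 the factor F vanishes identically, and the
  segments from x to the other points of the ball carry this to the whole ball.\<close>

lemma ganalytic_no_zero_divisors:
  assumes "ganalytic f" "ganalytic g" "f * g = 0"
  shows "f = 0 \<or> g = 0"
proof (rule disjCI)
  assume "g \<noteq> 0"
  obtain F r where F: "f = germ F" "r > 0" "mholo_on F (ball 0 r)" by (rule ganalytic_ball[OF assms(1)])
  obtain G s where G: "g = germ G" "s > 0" "mholo_on G (ball 0 s)" by (rule ganalytic_ball[OF assms(2)])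
  have "germ (\<lambda>x. F x * G x) = germ (\<lambda>x. 0)"
    using assms(3) by (simp add: F G times_germ.abs_eq zero_germ_def)
  then have "\<forall>\<^sub>F x in nhds 0. F x * G x = 0" by (simp add: germ.abs_eq_iff germ_eq_def)
  then obtain e where e: "e > 0" "\<And>x. x \<in> ball 0 e \<Longrightarrow> F x * G x = 0"
    unfolding eventually_nhds_metric by (auto simp: dist_commute)
  define q where "q = min e (min r s)"
  have q: "q > 0" "ball 0 q \<subseteq> ball 0 r" "ball 0 q \<subseteq> ball (0::complex^'a) s" "ball 0 q \<subseteq> ball (0::complex^'a) e"
    using e F G by (auto simp: q_def)
  obtain x where x: "x \<in> ball 0 q" "G x \<noteq> 0" using germ_eq_0I[OF q(1), of G] \<open>g \<noteq> 0\<close> G(1) by blast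
  have "\<forall>\<^sub>F y in nhds x. G y \<noteq> 0 \<and> y \<in> ball 0 q"
  proof -
    have "isCont G x" using mholo_on_continuous[OF G(3)] x q continuous_on_eq_continuous_at[of "ball 0 s" G] by auto
    then have "\<forall>\<^sub>F y in nhds x. G y \<noteq> 0"
      using x(2) by (intro tendsto_imp_eventually_ne) (auto simp: isCont_def tendsto_at_iff_tendsto_nhds)
    moreover have "\<forall>\<^sub>F y in nhds x. y \<in> ball 0 q" using x(1) by (intro eventually_nhds_in_open) auto
    ultimately show ?thesis by (rule eventually_conj)
  qed
  then have Fz: "\<forall>\<^sub>F y in nhds x. F y = 0" by (rule eventually_mono) (use e(2) q(4) in fastforce)
  have "F y = 0" if y: "y \<in> ball 0 q" for y
  proof -
    have "F (x + (y - x)) = 0"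
    proof (rule mholo_on_line_zero[OF F(3)])
      have "((\<lambda>t. x + t *s (y - x)) \<longlongrightarrow> x + 0 *s (y - x)) (nhds 0)"
        by (intro tendsto_add tendsto_const bounded_linear.tendsto[OF bounded_linear_smult_left] filterlim_ident)
      then have "((\<lambda>t. x + t *s (y - x)) \<longlongrightarrow> x) (nhds 0)" by simp
      then show "\<forall>\<^sub>F t in nhds 0. F (x + t *s (y - x)) = 0"
        by (rule eventually_compose_filterlim[OF Fz])
    qed (use subsetD[OF q(2) x(1)] subsetD[OF q(2) y] in auto)
    then show ?thesis by simp
  qed
  then show "f = 0" unfolding F(1) using germ_eq_0I[OF q(1)] by blast
qed

section \<open>The Mellin system as a recursion for Taylor coefficients\<close>

lemma germ_sum: "germ (\<lambda>x. \<Sum>i\<in>A. f i x) = (\<Sum>i\<in>A. germ (f i))"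
  by (induction A rule: infinite_finite_induct)
     (simp_all add: zero_germ_def plus_germ.abs_eq[symmetric])

definition gtheta :: "('n \<Rightarrow> nat) \<Rightarrow> complex \<Rightarrow> 'n::finite germ \<Rightarrow> 'n germ" where
  "gtheta a b g = (\<Sum>i\<in>UNIV. scale_germ (of_nat (a i)) (gX i * pd i g)) + scale_germ b g"

lemma germ_theta_factor: "germ (theta_factor a b F) = gtheta a b (germ F)"
proof -
  have "theta_factor a b F = (\<lambda>x. (\<Sum>i\<in>UNIV. of_nat (a i) * (x $ i * partial_deriv i F x)) + b * F x)"
    by (simp add: fun_eq_iff theta_factor_def theta_def)
  then show ?thesis
    by (simp add: gtheta_def plus_germ.abs_eq[symmetric] germ_sum scale_germ.abs_eq gX.abs_eq pd.abs_eq times_germ.abs_eq)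
qed

lemma germ_op_prod:
  "germ (op_prod (map (\<lambda>k. theta_factor a (b k)) ks) F) = foldr (\<lambda>k. gtheta a (b k)) ks (germ F)"
  by (induction ks) (simp_all add: op_prod_def germ_theta_factor)

lemma germ_funpow_partial_deriv: "germ ((partial_deriv j ^^ k) F) = (pd j ^^ k) (germ F)"
  by (induction k) (simp_all add: pd.abs_eq[symmetric])

lemma ganalytic_gtheta: "ganalytic g \<Longrightarrow> ganalytic (gtheta a b g)"
  unfolding gtheta_def by (intro ganalytic_intros)

lemma ganalytic_foldr_gtheta: "ganalytic g \<Longrightarrow> ganalytic (foldr (\<lambda>k. gtheta a (b k)) ks g)"
  by (induction ks) (simp_all add: ganalytic_gtheta)

lemma ganalytic_funpow_pd: "ganalytic g \<Longrightarrow> ganalytic ((pd j ^^ k) g)"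
  by (induction k) (simp_all add: ganalytic_pd)

lemma coef_gtheta:
  "ganalytic g \<Longrightarrow> coef (gtheta a b g) \<alpha> = (of_nat (\<Sum>i\<in>UNIV. a i * \<alpha> i) + b) * coef g \<alpha>"
  unfolding gtheta_def
  by (simp add: coef_add coef_sum coef_scale coef_theta ganalytic_intros sum_distrib_right distrib_right mult.assoc)

lemma coef_foldr_gtheta:
  "ganalytic g \<Longrightarrow> coef (foldr (\<lambda>k. gtheta a (b k)) [0..<n] g) \<alpha> =
     (\<Prod>k<n. of_nat (\<Sum>i\<in>UNIV. a i * \<alpha> i) + b k) * coef g \<alpha>"
  by (induction n arbitrary: g) (simp_all add: coef_gtheta ganalytic_gtheta mult_ac del: of_nat_sum)

lemma coef_funpow_pd:
  "ganalytic g \<Longrightarrow> coef ((pd j ^^ n) g) \<alpha> = (\<Prod>k<n. of_nat (\<alpha> j + k + 1)) * coef g (\<alpha>(j := \<alpha> j + n))"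
proof (induction n arbitrary: \<alpha>)
  case (Suc n)
  have "coef ((pd j ^^ Suc n) g) \<alpha> = of_nat (Suc (\<alpha> j)) * coef ((pd j ^^ n) g) (\<alpha>(j := Suc (\<alpha> j)))"
    using Suc.prems by (simp add: coef_pd ganalytic_funpow_pd del: of_nat_Suc)
  also have "\<dots> = of_nat (Suc (\<alpha> j)) * ((\<Prod>k<n. of_nat (Suc (\<alpha> j) + k + 1)) * coef g (\<alpha>(j := \<alpha> j + Suc n)))"
  proof -
    have e: "(\<alpha>(j := Suc (\<alpha> j))) j = Suc (\<alpha> j)"
      "(\<alpha>(j := Suc (\<alpha> j)))(j := Suc (\<alpha> j) + n) = \<alpha>(j := \<alpha> j + Suc n)" by simp_all
    show ?thesis by (simp only: Suc.IH[OF Suc.prems] e)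
  qed
  also have "of_nat (Suc (\<alpha> j)) * ((\<Prod>k<n. of_nat (Suc (\<alpha> j) + k + 1)) * coef g (\<alpha>(j := \<alpha> j + Suc n))) =
      (\<Prod>k<Suc n. of_nat (\<alpha> j + k + 1)) * coef g (\<alpha>(j := \<alpha> j + Suc n))"
    unfolding prod.lessThan_Suc_shift by (simp add: mult.assoc)
  finally show ?case .
qed simp

lemma ganalytic_eq_iff_coef:
  "ganalytic f \<Longrightarrow> ganalytic g \<Longrightarrow> f = g \<longleftrightarrow> (\<forall>\<alpha>. coef f \<alpha> = coef g \<alpha>)"
  using coef_eqI by blast

text \<open>The Mellin system at the coefficient of x^\<alpha>: on the left the eigenvalues of the
  theta factors on x^\<alpha>, on the right the factors from m-fold differentiation in x_j.\<close>

definition mellin_rec :: "nat \<Rightarrow> ('n::finite \<Rightarrow> nat) \<Rightarrow> (('n \<Rightarrow> nat) \<Rightarrow> complex) \<Rightarrow> bool" where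
  "mellin_rec m M c \<longleftrightarrow> (\<forall>j \<alpha>.
     (\<Prod>k<M j. of_nat (\<Sum>i\<in>UNIV. M i * \<alpha> i) + (of_nat m * of_nat k + 1)) *
     (\<Prod>k<m - M j. of_nat (\<Sum>i\<in>UNIV. (m - M i) * \<alpha> i) + (of_nat m * of_nat k - 1)) * c \<alpha> =
     (-1) ^ M j * of_nat m ^ m * (\<Prod>k<m. of_nat (\<alpha> j + k + 1)) * c (\<alpha>(j := \<alpha> j + m)))"

lemma mellin_system_iff:
  assumes "analytic_near_0 F"
  shows "mellin_system m M F \<longleftrightarrow> mellin_rec m M (coef (germ F))"
proof -
  let ?g = "germ F"
  have g: "ganalytic ?g" using assms by (simp add: ganalytic.abs_eq)
  let ?L = "\<lambda>j. foldr (\<lambda>k. gtheta M (of_nat m * of_nat k + 1)) [0..<M j]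
     (foldr (\<lambda>k. gtheta (\<lambda>i. m - M i) (of_nat m * of_nat k - 1)) [0..<m - M j] ?g)"
  let ?R = "\<lambda>j. scale_germ ((-1) ^ M j * of_nat m ^ m) ((pd j ^^ m) ?g)"
  have "mellin_system m M F \<longleftrightarrow> (\<forall>j. germ (mellin_lhs m M j F) = germ (\<lambda>x. (-1) ^ M j * of_nat m ^ m * (partial_deriv j ^^ m) F x))"
    unfolding mellin_system_def germ.abs_eq_iff germ_eq_def ..
  also have "\<dots> \<longleftrightarrow> (\<forall>j. ?L j = ?R j)"
    by (simp add: mellin_lhs_def germ_op_prod scale_germ.abs_eq[symmetric] germ_funpow_partial_deriv)
  also have "\<dots> \<longleftrightarrow> (\<forall>j \<alpha>. coef (?L j) \<alpha> = coef (?R j) \<alpha>)"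
    by (simp only: ganalytic_eq_iff_coef ganalytic_foldr_gtheta ganalytic_scale ganalytic_funpow_pd g)
  also have "\<dots> \<longleftrightarrow> mellin_rec m M (coef ?g)"
    unfolding mellin_rec_def
    by (simp add: coef_foldr_gtheta coef_scale coef_funpow_pd ganalytic_foldr_gtheta ganalytic_funpow_pd g mult.assoc del: of_nat_sum)
  finally show ?thesis .
qed

lemma mellin_solutions_eq: "mellin_solutions m M = {g. ganalytic g \<and> mellin_rec m M (coef g)}"
proof (intro set_eqI iffI; clarsimp simp: mellin_solutions_def)
  show "ganalytic (germ F) \<and> mellin_rec m M (coef (germ F))" if "analytic_near_0 F" "mellin_system m M F" for F
    using that by (simp add: ganalytic.abs_eq mellin_system_iff)
  fix g assume g: "ganalytic g" "mellin_rec m M (coef g)"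
  obtain F where "g = germ F" by (rule germ_cases)
  with g show "\<exists>f. g = germ f \<and> analytic_near_0 f \<and> mellin_system m M f"
    by (auto simp: ganalytic.abs_eq mellin_system_iff)
qed

text \<open>Falling factorials \<open>(a - 1) \<dots> (a - N)\<close> and their derivatives with respect to \<open>a\<close>.\<close>

primrec fp :: "nat \<Rightarrow> complex \<Rightarrow> complex" where
  "fp 0 a = 1"
| "fp (Suc N) a = (a - 1) * fp N (a - 1)"

primrec fd :: "nat \<Rightarrow> complex \<Rightarrow> complex" where
  "fd 0 a = 0"
| "fd (Suc N) a = fp N (a - 1) + (a - 1) * fd N (a - 1)"

text \<open>Derivatives are recorded in the logarithmic form \<open>pd i f = f * l\<close>, which
  powers and inverses preserve; all later computations then stay within products of a few fixed
  germs.\<close>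

lemma pd_power_log:
  assumes "ganalytic f" "pd i f = f * l"
  shows "pd i (f ^ n) = of_nat n * f ^ n * l"
proof (cases n)
  case (Suc k)
  then show ?thesis using pd_power[OF assms(1), of i k] assms(2) by (simp add: algebra_simps)
qed (simp add: pd_1)

lemma pd_inverse_log:
  assumes f: "ganalytic f" "pd i f = f * l" and g: "ganalytic g" "f * g = 1"
  shows "pd i g = - (g * l)"
proof -
  have "f * pd i g + f * l * g = 0"
    using pd_mult[OF f(1) g(1), of i] by (simp add: g(2) pd_1 f(2))
  then have "g * (f * pd i g + f * l * g) = 0" by simp
  moreover have "g * (f * pd i g + f * l * g) = (f * g) * pd i g + (f * g) * (g * l)"
    by (simp add: algebra_simps)
  ultimately show ?thesis by (simp add: g(2) eq_neg_iff_add_eq_0)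
qed

lemma coef_of_nat_mult: "ganalytic g \<Longrightarrow> coef (of_nat c * g) \<alpha> = of_nat c * coef g \<alpha>"
  by (simp add: of_nat_germ scale_germ_eq_mult[symmetric] coef_scale)


text \<open>The inverse function theorem for (x, y) -> (x, y^m + x_1 y^m_1 + ... + x_n y^m_n) at (0,
  1), where the derivative in y is m. The root is the second component of the inverse on the slice
  where the second argument is 1.\<close>

lemma root_ex:
  fixes M :: "'n::finite \<Rightarrow> nat"
  assumes m: "m > 0"
  shows "\<exists>f :: 'n germ. ganalytic f \<and> ev0 f = 1 \<and> f ^ m + (\<Sum>j\<in>UNIV. gX j * f ^ M j) = 1"
proof -
  define F :: "(complex^'n) \<times> complex \<Rightarrow> (complex^'n) \<times> complex"
    where "F = (\<lambda>p. (fst p, snd p ^ m + (\<Sum>j\<in>UNIV. fst p $ j * snd p ^ M j)))"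
  define Fy where "Fy = (\<lambda>p::(complex^'n) \<times> complex. of_nat m * snd p ^ (m - 1) + (\<Sum>j\<in>UNIV. fst p $ j * (of_nat (M j) * snd p ^ (M j - 1))))"
  define L where "L = (\<lambda>p q::(complex^'n) \<times> complex. (fst q, (\<Sum>j\<in>UNIV. fst q $ j * snd p ^ M j) + snd q * Fy p))"
  have D: "(F has_derivative L p) (at p)" for p
  proof -
    have c: "((\<lambda>p::(complex^'n) \<times> complex. fst p $ j) has_derivative (\<lambda>q. fst q $ j)) (at p)" for j
      by (intro bounded_linear.has_derivative[OF bounded_linear_vec_nth] has_derivative_fst has_derivative_ident)
    have "((\<lambda>p. snd p ^ m + (\<Sum>j\<in>UNIV. fst p $ j * snd p ^ M j)) has_derivative
       (\<lambda>q. of_nat m * snd q * snd p ^ (m - 1) +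
          (\<Sum>j\<in>UNIV. fst p $ j * (of_nat (M j) * snd q * snd p ^ (M j - 1)) + fst q $ j * snd p ^ M j))) (at p)"
      by (intro has_derivative_add has_derivative_sum has_derivative_mult has_derivative_power c has_derivative_snd has_derivative_ident)
    from has_derivative_Pair[OF has_derivative_fst[OF has_derivative_ident] this]
    have "(F has_derivative (\<lambda>q. (fst q, of_nat m * snd q * snd p ^ (m - 1) +
          (\<Sum>j\<in>UNIV. fst p $ j * (of_nat (M j) * snd q * snd p ^ (M j - 1)) + fst q $ j * snd p ^ M j)))) (at p)"
      unfolding F_def .
    also have "(\<lambda>q. (fst q, of_nat m * snd q * snd p ^ (m - 1) +
          (\<Sum>j\<in>UNIV. fst p $ j * (of_nat (M j) * snd q * snd p ^ (M j - 1)) + fst q $ j * snd p ^ M j))) = L p"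
      by (rule ext) (simp add: L_def Fy_def sum.distrib sum_distrib_left algebra_simps)
    finally show ?thesis .
  qed
  have blL: "bounded_linear (L p)" for p using D has_derivative_bounded_linear by blast
  define F' where "F' = (\<lambda>p. Blinfun (L p))"
  have F': "blinfun_apply (F' p) = L p" for p unfolding F'_def by (rule bounded_linear_Blinfun_apply[OF blL])
  have contF': "continuous_on UNIV F'"
    unfolding Fy_def
    by (rule continuous_on_blinfun_componentwise) (auto simp: F' L_def Fy_def intro!: continuous_intros)
  \<comment> \<open>The inverse of \<open>L (0, 1)\<close>, whose second component at (h, k) is the
    sum of the \<open>h $ j\<close> plus m k.\<close>
  define I where "I = (\<lambda>q::(complex^'n) \<times> complex. (fst q, (snd q - (\<Sum>j\<in>UNIV. fst q $ j)) / of_nat m))"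
  have blI: "bounded_linear I"
    unfolding I_def
    by (intro bounded_linear_Pair bounded_linear_fst bounded_linear_divide[THEN bounded_linear_compose] bounded_linear_sub
        bounded_linear_snd bounded_linear_sum bounded_linear_compose[OF bounded_linear_vec_nth])
  have L1: "L (0, 1) q = (fst q, (\<Sum>j\<in>UNIV. fst q $ j) + snd q * of_nat m)" for q
    by (simp add: L_def Fy_def)
  have inv: "Blinfun I o\<^sub>L F' (0, 1) = id_blinfun"
    using m by (intro blinfun_eqI) (simp only: blinfun_apply_blinfun_compose bounded_linear_Blinfun_apply[OF blI]
      F' L1 blinfun_apply_id_blinfun, simp add: I_def prod_eq_iff)
  obtain U' V g g' where g: "open U'" "U' \<subseteq> UNIV" "(0, 1) \<in> U'" "open V" "F (0, 1) \<in> V" "homeomorphism U' V F g"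
    "\<And>y. y \<in> V \<Longrightarrow> (g has_derivative (g' y)) (at y)"
    "\<And>y. y \<in> V \<Longrightarrow> g' y = Hilbert_Choice.inv (blinfun_apply (F' (g y)))"
    "\<And>y. y \<in> V \<Longrightarrow> bij (blinfun_apply (F' (g y)))"
    using inverse_function_theorem[OF open_UNIV D[folded F'] contF' UNIV_I inv] by metis
  have F01: "F (0, 1) = (0, 1)" by (simp add: F_def)
  have gF: "F (g p) = p" if "p \<in> V" for p using g(6) that by (auto simp: homeomorphism_def)
  define f where "f = (\<lambda>x. snd (g (x, 1)))"
  define W where "W = (\<lambda>x. (x, 1)) -` V"
  have W: "open W" unfolding W_def by (rule open_vimage[OF g(4)]) (intro continuous_intros)
  have W0: "0 \<in> W" using g(5) F01 by (simp add: W_def)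
  have eqn: "f x ^ m + (\<Sum>j\<in>UNIV. x $ j * f x ^ M j) = 1" if "x \<in> W" for x
    using gF[of "(x, 1)"] that by (auto simp: W_def F_def f_def)
  have f0: "f 0 = 1"
    using g(3,6) F01 unfolding homeomorphism_def f_def by (metis snd_conv)
  have "mholo_on f W"
    unfolding mholo_on_def
  proof (intro conjI ballI)
    fix x assume "x \<in> W"
    then have x: "(x, 1) \<in> V" by (simp add: W_def)
    let ?L = "L (g (x, 1))"
    have bijL: "bij ?L" using g(9)[OF x] by (simp add: F')
    have g'L: "g' (x, 1) = Hilbert_Choice.inv ?L" using g(8)[OF x] by (simp add: F')
    \<comment> \<open>The inverse function theorem concerns real derivatives; complex linearity is
      inherited by the inverse of a complex linear bijection.\<close>
    have lin: "g' (x, 1) (c *s h, c * k) = (c *s fst (g' (x, 1) (h, k)), c * snd (g' (x, 1) (h, k)))" for c h k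
    proof -
      have s: "?L (c *s fst q, c * snd q) = (c *s fst (?L q), c * snd (?L q))" for q
        by (simp add: L_def sum_distrib_left algebra_simps)
      have i: "?L (Hilbert_Choice.inv ?L q) = q" for q using bijL by (simp add: bij_is_surj surj_f_inv_f)
      have "?L (c *s fst (g' (x, 1) (h, k)), c * snd (g' (x, 1) (h, k))) = (c *s h, c * k)"
        unfolding s g'L i by simp
      then show ?thesis unfolding g'L using bijL by (metis bij_inv_eq_iff)
    qed
    have "((\<lambda>x. g (x, 1)) has_derivative (\<lambda>h. g' (x, 1) (h, 0))) (at x)"
      by (rule has_derivative_compose[OF has_derivative_Pair[OF has_derivative_ident has_derivative_const] g(7)[OF x]])
    from has_derivative_snd[OF this]
    have "(f has_derivative (\<lambda>h. snd (g' (x, 1) (h, 0)))) (at x)" unfolding f_def .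
    moreover have "\<forall>c v. snd (g' (x, 1) (c *s v, 0)) = c * snd (g' (x, 1) (v, 0))" using lin[of _ _ 0] by simp
    ultimately show "\<exists>D. (f has_derivative D) (at x) \<and> (\<forall>c v. D (c *s v) = c * D v)" by (intro exI conjI)
  qed (rule W)
  then have "ganalytic (germ f)" using W0 analytic_near_0I by (auto simp: ganalytic.abs_eq)
  moreover have "ev0 (germ f) = 1" using f0 by (simp add: ev0.abs_eq)
  moreover have "germ f ^ m + (\<Sum>j\<in>UNIV. gX j * germ f ^ M j) = 1"
  proof -
    have pw: "germ (\<lambda>x. f x ^ k) = germ f ^ k" for k
      by (induction k) (simp_all add: one_germ_def times_germ.abs_eq[symmetric])
    have "germ f ^ m + (\<Sum>j\<in>UNIV. gX j * germ f ^ M j) = germ (\<lambda>x. f x ^ m + (\<Sum>j\<in>UNIV. x $ j * f x ^ M j))"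
      by (simp add: plus_germ.abs_eq[symmetric] germ_sum times_germ.abs_eq[symmetric] pw gX.abs_eq)
    also have "\<dots> = 1"
      unfolding one_germ_def germ.abs_eq_iff by (rule germ_eqI[OF W W0 eqn])
    finally show ?thesis .
  qed
  ultimately show ?thesis by blast
qed

section \<open>Taylor coefficients of the principal root and of its logarithm\<close>

locale mellin_data =
  fixes m :: nat and M :: "'n::finite \<Rightarrow> nat"
  assumes M_range: "\<And>i. 0 < M i \<and> M i < m"
begin

lemma M_pos: "0 < M i" and M_less: "M i < m" and M_le: "M i \<le> m"
  using M_range[of i] by auto

lemma m_pos: "m > 0" and m_ge2: "m \<ge> 2"
  using M_range[of undefined] by auto

definition phi :: "'n germ" where
  "phi = (SOME f. ganalytic f \<and> ev0 f = 1 \<and> f ^ m + (\<Sum>j\<in>UNIV. gX j * f ^ M j) = 1)"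

lemma phi: "ganalytic phi" "ev0 phi = 1" "phi ^ m + (\<Sum>j\<in>UNIV. gX j * phi ^ M j) = 1"
  unfolding phi_def using someI_ex[OF root_ex[OF m_pos, of M]] by auto

definition V :: "'n germ" where "V = (SOME g. ganalytic g \<and> phi * g = 1)"

lemma V: "ganalytic V" "phi * V = 1"
proof -
  have "\<exists>g. ganalytic g \<and> phi * g = 1"
    using ganalytic_inverse[OF phi(1)] phi(2) by (metis zero_neq_one)
  from someI_ex[OF this] show "ganalytic V" "phi * V = 1" by (simp_all add: V_def)
qed

text \<open>\<open>W\<close> is \<open>y \<partial>F/\<partial>y\<close> at \<open>y = \<phi>\<close>, where \<open>F = y\<^sup>m + \<Sum>\<^sub>j x\<^sub>j y\<^bsup>m\<^sub>j\<^esup> - 1\<close>; \<open>W2\<close> is obtained by applying \<open>y \<partial>/\<partial>y\<close> once more.\<close>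

definition W :: "'n germ" where
  "W = of_nat m * phi ^ m + (\<Sum>j\<in>UNIV. of_nat (M j) * gX j * phi ^ M j)"

definition W2 :: "'n germ" where
  "W2 = of_nat m * of_nat m * phi ^ m + (\<Sum>j\<in>UNIV. of_nat (M j) * of_nat (M j) * gX j * phi ^ M j)"

lemma W: "ganalytic W" "ev0 W = of_nat m"
  unfolding W_def by (auto intro!: ganalytic_intros phi simp: ev0_simps phi)

definition U :: "'n germ" where "U = (SOME g. ganalytic g \<and> W * g = 1)"

lemma U: "ganalytic U" "W * U = 1"
proof -
  have "\<exists>g. ganalytic g \<and> W * g = 1"
    using ganalytic_inverse[OF W(1)] W(2) m_pos by (metis of_nat_0_eq_iff less_irrefl)
  from someI_ex[OF this] show "ganalytic U" "W * U = 1" by (simp_all add: U_def)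
qed

lemma ev0_V: "ev0 V = 1" and ev0_U: "ev0 U = 1 / of_nat m"
  using arg_cong[OF V(2), of ev0] arg_cong[OF U(2), of ev0] m_pos
  by (simp_all add: ev0_simps phi W field_simps)

definition Lam :: "'n germ" where
  "Lam = (SOME g. ganalytic g \<and> (\<forall>j. pd j g * phi = pd j phi) \<and> ev0 g = 0 \<and> (\<forall>F. phi = germ F \<longrightarrow> g = germ (\<lambda>x. Ln (F x))))"

lemma Lam: "ganalytic Lam" "pd j Lam * phi = pd j phi" "ev0 Lam = 0" "phi = germ F \<Longrightarrow> Lam = germ (\<lambda>x. Ln (F x))"
proof -
  have "\<exists>g. ganalytic g \<and> (\<forall>j. pd j g * phi = pd j phi) \<and> ev0 g = 0 \<and> (\<forall>F. phi = germ F \<longrightarrow> g = germ (\<lambda>x. Ln (F x)))"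
    by (rule ganalytic_log[OF phi(1,2)]) blast
  from someI_ex[OF this, folded Lam_def]
  show "ganalytic Lam" "pd j Lam * phi = pd j phi" "ev0 Lam = 0" "phi = germ F \<Longrightarrow> Lam = germ (\<lambda>x. Ln (F x))" by auto
qed

text \<open>The logarithmic derivative of the root in direction \<open>i\<close>, as implicit
  differentiation gives it.\<close>

definition ell :: "'n \<Rightarrow> 'n germ" where "ell i = - (phi ^ M i * U)"

lemma pd_phi: "pd i phi = phi * ell i"
proof -
  \<comment> \<open>Multiplication by \<open>phi\<close> turns k \<phi>^(k - 1) into k \<phi>^k,
    which also covers k = 0 and produces the terms of \<open>W\<close>.\<close>
  have pw: "phi * pd i (phi ^ k) = of_nat k * phi ^ k * pd i phi" for k
    using pd_power[OF phi(1), of i "k - 1"] by (cases k) (simp_all add: pd_1 algebra_simps)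
  have "pd i (phi ^ m + (\<Sum>j\<in>UNIV. gX j * phi ^ M j)) = 0" by (simp only: phi(3) pd_1)
  then have "pd i (phi ^ m) + (\<Sum>j\<in>UNIV. gX j * pd i (phi ^ M j)) + phi ^ M i = 0"
    by (simp add: pd_add pd_sum pd_mult ganalytic_intros phi(1) pd_X sum.distrib if_distrib[of "\<lambda>x. x * _"]
        add.assoc cong: if_cong)
  then have "phi * (pd i (phi ^ m) + (\<Sum>j\<in>UNIV. gX j * pd i (phi ^ M j)) + phi ^ M i) = 0" by simp
  moreover have "phi * (pd i (phi ^ m) + (\<Sum>j\<in>UNIV. gX j * pd i (phi ^ M j)) + phi ^ M i) =
      W * pd i phi + phi ^ M i * phi"
  proof -
    have "phi * (\<Sum>j\<in>UNIV. gX j * pd i (phi ^ M j)) = (\<Sum>j\<in>UNIV. gX j * (phi * pd i (phi ^ M j)))"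
      by (simp add: sum_distrib_left mult.left_commute)
    also have "\<dots> = (\<Sum>j\<in>UNIV. of_nat (M j) * gX j * phi ^ M j) * pd i phi"
      unfolding sum_distrib_right by (rule sum.cong) (simp_all add: pw mult_ac)
    finally show ?thesis by (simp add: W_def distrib_left distrib_right pw mult_ac)
  qed
  ultimately have "W * pd i phi = - (phi ^ M i * phi)" by (simp add: eq_neg_iff_add_eq_0)
  then have "U * (W * pd i phi) = U * (- (phi ^ M i * phi))" by simp
  then have "(W * U) * pd i phi = phi * ell i" by (simp add: ell_def mult_ac)
  then show ?thesis by (simp add: U)
qed

lemma pd_V: "pd i V = - (V * ell i)"
  by (rule pd_inverse_log[OF phi(1) pd_phi V])

lemma pd_Lam: "pd i Lam = ell i"
proof -
  have "(pd i Lam * phi) * V = (phi * ell i) * V" by (simp add: Lam pd_phi)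
  then have "pd i Lam * (phi * V) = ell i * (phi * V)" by (simp add: mult_ac)
  then show ?thesis by (simp add: V)
qed

lemma pd_W: "pd i W = of_nat (M i) * phi ^ M i + W2 * ell i"
proof -
  have pw: "pd i (phi ^ k) = of_nat k * phi ^ k * ell i" for k
    by (rule pd_power_log[OF phi(1) pd_phi])
  have "pd i W = of_nat m * (of_nat m * phi ^ m * ell i) +
    (\<Sum>j\<in>UNIV. of_nat (M j) * gX j * (of_nat (M j) * phi ^ M j * ell i) + of_nat (M j) * (if i = j then 1 else 0) * phi ^ M j)"
    unfolding W_def
    by (simp add: pd_add pd_sum pd_mult pd_of_nat ganalytic_intros phi(1) pd_X pw)
  also have "(\<Sum>j\<in>UNIV. of_nat (M j) * gX j * (of_nat (M j) * phi ^ M j * ell i) + of_nat (M j) * (if i = j then 1 else 0) * phi ^ M j)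
    = (\<Sum>j\<in>UNIV. of_nat (M j) * of_nat (M j) * gX j * phi ^ M j) * ell i +
      (\<Sum>j\<in>UNIV. if i = j then of_nat (M j) * phi ^ M j else 0)"
    unfolding sum_distrib_right sum.distrib[symmetric] by (rule sum.cong) (auto simp: mult_ac)
  finally show ?thesis by (simp add: W2_def algebra_simps)
qed

lemma pd_U: "pd i U = (of_nat (M i) - U * W2) * (U * ell i)"
proof -
  have "pd i W = W * (U * pd i W)" using U by (simp add: mult.assoc[symmetric])
  then have "pd i U = - (U * (U * pd i W))"
    by (rule pd_inverse_log[OF W(1) _ U])
  also have "\<dots> = (of_nat (M i) - U * W2) * (U * ell i)"
    by (simp add: pd_W ell_def algebra_simps)
  finally show ?thesis .
qed

text \<open>This is \<phi>^(n - k) / W. Integer exponents are needed, and the pairs n, k with the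
  cancellation \<open>T_add\<close> encode them. The derivatives of \<open>phi\<close> belong to the
  family up to sign.\<close>

definition T :: "nat \<Rightarrow> nat \<Rightarrow> 'n germ" where
  "T n k = phi ^ n * V ^ k * U"

lemma ganalytic_T: "ganalytic (T n k)"
  unfolding T_def by (intro ganalytic_intros phi V U)

lemma T_add: "T (n + a) (k + a) = T n k"
proof -
  have "T (n + a) (k + a) = T n k * (phi * V) ^ a" by (simp add: T_def power_add power_mult_distrib mult_ac)
  then show ?thesis by (simp add: V)
qed

lemma ev0_T: "ev0 (T n k) = 1 / of_nat m"
  by (simp add: T_def ev0_simps phi ev0_V ev0_U)

lemma pd_T: "pd i (T n k) = (of_nat n - of_nat k + of_nat (M i) - U * W2) * ell i * T n k"
proof -
  have 1: "pd i (phi ^ n) = of_nat n * phi ^ n * ell i" by (rule pd_power_log[OF phi(1) pd_phi])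
  have 2: "pd i (V ^ k) = of_nat k * V ^ k * (- ell i)" by (rule pd_power_log[OF V(1)]) (simp add: pd_V)
  show ?thesis
    unfolding T_def
    by (simp add: pd_mult ganalytic_intros phi(1) V(1) U(1) 1 2 pd_U) (simp add: algebra_simps)
qed

text \<open>Differentiation in direction \<open>i\<close> supplies the term m \<phi>^m of
  \<open>W\<close>, the Euler operators supply the terms m_j x_j \<phi>^m_j; together they form
  \<open>W\<close>, which cancels against \<open>U\<close>. What remains is
  \<open>s + U * W2\<close>, that is, n - k.\<close>

lemma T_PDE:
  "of_nat m * pd i (T (n + (m - M i)) k) + (\<Sum>j\<in>UNIV. of_nat (M j) * (gX j * pd j (T n k))) =
    - ((of_nat n - of_nat k) * T n k)"
proof -
  define s :: "'n germ" where "s = of_nat n - of_nat k - U * W2"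
  have "pd i (T (n + (m - M i)) k) = (s + of_nat m) * ell i * T (n + (m - M i)) k"
    using M_le[of i] by (simp add: pd_T s_def of_nat_diff algebra_simps)
  also have "\<dots> = - (U * T n k * ((s + of_nat m) * phi ^ m))"
  proof -
    have "phi ^ m = phi ^ M i * phi ^ (m - M i)" using M_le[of i] by (simp add: power_add[symmetric])
    then show ?thesis by (simp add: T_def ell_def power_add mult_ac)
  qed
  finally have 1: "of_nat m * pd i (T (n + (m - M i)) k) = - (U * T n k * ((s + of_nat m) * (of_nat m * phi ^ m)))"
    by (simp add: mult_ac)
  have "(\<Sum>j\<in>UNIV. of_nat (M j) * (gX j * pd j (T n k))) =
    (\<Sum>j\<in>UNIV. - (U * T n k * (s * (of_nat (M j) * gX j * phi ^ M j) + of_nat (M j) * of_nat (M j) * gX j * phi ^ M j)))"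
    by (rule sum.cong) (simp_all add: pd_T s_def ell_def algebra_simps)
  also have "\<dots> = - (U * T n k * (s * (\<Sum>j\<in>UNIV. of_nat (M j) * gX j * phi ^ M j) +
     (\<Sum>j\<in>UNIV. of_nat (M j) * of_nat (M j) * gX j * phi ^ M j)))"
    by (simp add: sum_negf sum_subtractf sum_distrib_left sum.distrib distrib_left)
  finally have 2: "(\<Sum>j\<in>UNIV. of_nat (M j) * (gX j * pd j (T n k))) = - (U * T n k * (s * (W - of_nat m * phi ^ m) + (W2 - of_nat m * of_nat m * phi ^ m)))"
    by (simp add: W_def W2_def)
  have "of_nat m * pd i (T (n + (m - M i)) k) + (\<Sum>j\<in>UNIV. of_nat (M j) * (gX j * pd j (T n k))) = - (T n k * (s * (W * U) + U * W2))"
    unfolding 1 2 by (simp add: algebra_simps)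
  also have "s * (W * U) + U * W2 = of_nat n - of_nat k" by (simp add: U s_def)
  finally show ?thesis by (simp only: mult.commute)
qed

text \<open>The product rule adds the derivatives of \<open>Lam\<close>; by the same completion to
  \<open>W\<close> they contribute exactly \<open>- T n k\<close>. This inhomogeneous term makes the
  coefficients follow the derivative of those of \<open>T\<close>.\<close>

lemma Lam_T_PDE:
  "of_nat m * pd i (Lam * T (n + (m - M i)) k) + (\<Sum>j\<in>UNIV. of_nat (M j) * (gX j * pd j (Lam * T n k))) =
    - ((of_nat n - of_nat k) * (Lam * T n k)) - T n k"
proof -
  have tm: "phi ^ m = phi ^ M i * phi ^ (m - M i)" using M_le[of i] by (simp add: power_add[symmetric])
  have "of_nat m * (ell i * T (n + (m - M i)) k) = - (U * T n k * (of_nat m * phi ^ m))"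
    by (simp add: tm T_def ell_def power_add mult_ac)
  moreover have "(\<Sum>j\<in>UNIV. of_nat (M j) * (gX j * (ell j * T n k))) = - (U * T n k * (\<Sum>j\<in>UNIV. of_nat (M j) * gX j * phi ^ M j))"
    unfolding sum_distrib_left sum_negf[symmetric] by (rule sum.cong) (simp_all add: ell_def mult_ac)
  ultimately have e: "of_nat m * (ell i * T (n + (m - M i)) k) + (\<Sum>j\<in>UNIV. of_nat (M j) * (gX j * (ell j * T n k))) = - (W * U * T n k)"
    by (simp add: W_def algebra_simps)
  have "of_nat m * pd i (Lam * T (n + (m - M i)) k) + (\<Sum>j\<in>UNIV. of_nat (M j) * (gX j * pd j (Lam * T n k))) =
    Lam * (of_nat m * pd i (T (n + (m - M i)) k) + (\<Sum>j\<in>UNIV. of_nat (M j) * (gX j * pd j (T n k)))) +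
    (of_nat m * (ell i * T (n + (m - M i)) k) + (\<Sum>j\<in>UNIV. of_nat (M j) * (gX j * (ell j * T n k))))"
    by (simp add: pd_mult Lam(1) ganalytic_T pd_Lam distrib_left sum.distrib sum_distrib_left mult_ac add_ac)
  also have "\<dots> = Lam * - ((of_nat n - of_nat k) * T n k) + - (1 * T n k)"
    unfolding T_PDE e U(2) ..
  finally show ?thesis by (simp add: mult.left_commute)
qed

definition dotM :: "('n \<Rightarrow> nat) \<Rightarrow> nat" where "dotM \<alpha> = (\<Sum>i\<in>UNIV. M i * \<alpha> i)"

lemma dotM_upd: "dotM (\<alpha>(i := x)) + M i * \<alpha> i = dotM \<alpha> + M i * x"
  by (simp add: dotM_def sum.remove[of UNIV i])

lemma dotM_Suc: "dotM (\<alpha>(i := Suc (\<alpha> i))) = dotM \<alpha> + M i"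
  using dotM_upd[of \<alpha> i "Suc (\<alpha> i)"] by simp

lemma PDE_coef:
  assumes g: "ganalytic g" "ganalytic h" "ganalytic r"
    and eq: "of_nat m * pd i h + (\<Sum>j\<in>UNIV. of_nat (M j) * (gX j * pd j g)) = - ((of_nat n - of_nat k) * g) - r"
  shows "of_nat m * of_nat (Suc (\<alpha> i)) * coef h (\<alpha>(i := Suc (\<alpha> i))) =
    - ((of_nat n - of_nat k + of_nat (dotM \<alpha>)) * coef g \<alpha>) - coef r \<alpha>"
proof -
  have "coef (of_nat m * pd i h + (\<Sum>j\<in>UNIV. of_nat (M j) * (gX j * pd j g))) \<alpha> =
    of_nat m * (of_nat (Suc (\<alpha> i)) * coef h (\<alpha>(i := Suc (\<alpha> i)))) + (\<Sum>j\<in>UNIV. of_nat (M j) * (of_nat (\<alpha> j) * coef g \<alpha>))"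
    using g by (simp add: coef_add coef_sum ganalytic_intros coef_of_nat_mult coef_theta coef_pd del: of_nat_Suc)
  also have "(\<Sum>j\<in>UNIV. of_nat (M j) * (of_nat (\<alpha> j) * coef g \<alpha>)) = of_nat (dotM \<alpha>) * coef g \<alpha>"
    by (simp add: dotM_def sum_distrib_right mult.assoc)
  finally have 1: "coef (of_nat m * pd i h + (\<Sum>j\<in>UNIV. of_nat (M j) * (gX j * pd j g))) \<alpha> =
    of_nat m * (of_nat (Suc (\<alpha> i)) * coef h (\<alpha>(i := Suc (\<alpha> i)))) + of_nat (dotM \<alpha>) * coef g \<alpha>" .
  have "coef (- ((of_nat n - of_nat k) * g) - r) \<alpha> = - ((of_nat n - of_nat k) * coef g \<alpha>) - coef r \<alpha>"
    using g by (simp add: left_diff_distrib coef_diff coef_uminus ganalytic_intros coef_of_nat_mult)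
  with 1 show ?thesis unfolding eq by (simp add: algebra_simps)
qed

definition afact :: "('n \<Rightarrow> nat) \<Rightarrow> complex" where "afact \<alpha> = (\<Prod>i\<in>UNIV. fact (\<alpha> i))"

lemma afact_Suc: "afact (\<alpha>(i := Suc (\<alpha> i))) = of_nat (Suc (\<alpha> i)) * afact \<alpha>"
  by (simp add: afact_def prod.remove[of UNIV i] del: of_nat_Suc)

lemma afact_nonzero: "afact \<alpha> \<noteq> 0"
  by (simp add: afact_def)

lemma afact_0: "afact (\<lambda>_. 0) = 1"
  by (simp add: afact_def)

text \<open>The relation expresses the coefficients for n + (m - m_i) through those for n. Raising k
  by m - m_i as well and cancelling makes it a formula for given n and k in terms of a smaller
  \<alpha>. The general \<open>b\<close> and \<open>r\<close> cover \<open>T\<close> and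
  \<open>Lam * T\<close> alike.\<close>

lemma coef_T_aux:
  fixes b r :: "nat \<Rightarrow> nat \<Rightarrow> ('n \<Rightarrow> nat) \<Rightarrow> complex"
  assumes "\<And>n k i \<alpha>. of_nat m * of_nat (Suc (\<alpha> i)) * b (n + (m - M i)) k (\<alpha>(i := Suc (\<alpha> i))) =
     - ((of_nat n - of_nat k + of_nat (dotM \<alpha>)) * b n k \<alpha>) - r n k \<alpha>"
    and "\<And>n k a. b (n + a) (k + a) = b n k"
  shows "of_nat m * of_nat (Suc (\<alpha> i)) * b n k (\<alpha>(i := Suc (\<alpha> i))) =
     - ((of_nat n - of_nat k - of_nat m + of_nat (dotM (\<alpha>(i := Suc (\<alpha> i))))) * b n (k + (m - M i)) \<alpha>) - r n (k + (m - M i)) \<alpha>"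
proof -
  have k: "(of_nat (k + (m - M i)) :: complex) = of_nat k + of_nat m - of_nat (M i)"
    using M_le[of i] by (simp add: of_nat_diff)
  have e: "of_nat n - of_nat (k + (m - M i)) + of_nat (dotM \<alpha>) =
      (of_nat n - of_nat k - of_nat m + of_nat (dotM (\<alpha>(i := Suc (\<alpha> i)))) :: complex)"
    unfolding k dotM_Suc by simp
  show ?thesis
    using assms(1)[of \<alpha> i n "k + (m - M i)"] unfolding assms(2) e .
qed

text \<open>Put a = (n - k + dotM \<alpha>) / m. Lowering \<alpha>_i by one while raising k by m -
  m_i lowers a by exactly 1 and brings out the factor -(a - 1), so the recursion builds a falling
  factorial.\<close>

lemma coef_T:
  "coef (T n k) \<alpha> = (-1) ^ sum \<alpha> UNIV * fp (sum \<alpha> UNIV) ((of_nat n - of_nat k + of_nat (dotM \<alpha>)) / of_nat m) / (of_nat m * afact \<alpha>)"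
proof (induction \<alpha> arbitrary: n k rule: multi_index_induct)
  case 1
  then show ?case by (simp add: coef_zero ev0_T afact_0)
next
  case (2 \<alpha> i)
  let ?a = "(of_nat n - of_nat k + of_nat (dotM (\<alpha>(i := Suc (\<alpha> i))))) / of_nat m :: complex"
  have a: "(of_nat n - of_nat (k + (m - M i)) + of_nat (dotM \<alpha>)) / of_nat m = ?a - 1"
    using M_le[of i] m_pos by (simp add: dotM_Suc of_nat_diff field_simps)
  have "of_nat m * of_nat (Suc (\<alpha> i)) * coef (T n k) (\<alpha>(i := Suc (\<alpha> i))) =
     - ((of_nat n - of_nat k - of_nat m + of_nat (dotM (\<alpha>(i := Suc (\<alpha> i))))) * coef (T n (k + (m - M i))) \<alpha>) - 0"
  proof (rule coef_T_aux[where b = "\<lambda>n k. coef (T n k)" and r = "\<lambda>n k \<alpha>. 0"])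
    fix n k i \<alpha>
    have "of_nat m * pd i (T (n + (m - M i)) k) + (\<Sum>j\<in>UNIV. of_nat (M j) * (gX j * pd j (T n k))) =
      - ((of_nat n - of_nat k) * T n k) - 0" by (simp add: T_PDE)
    from PDE_coef[OF ganalytic_T ganalytic_T ganalytic_0 this, of \<alpha>]
    show "of_nat m * of_nat (Suc (\<alpha> i)) * coef (T (n + (m - M i)) k) (\<alpha>(i := Suc (\<alpha> i))) =
      - ((of_nat n - of_nat k + of_nat (dotM \<alpha>)) * coef (T n k) \<alpha>) - 0"
      unfolding coef_0 .
  qed (simp add: T_add)
  also have "of_nat n - of_nat k - of_nat m + of_nat (dotM (\<alpha>(i := Suc (\<alpha> i)))) = of_nat m * (?a - 1)"
    using m_pos by (simp add: field_simps)
  finally have e: "of_nat m * of_nat (Suc (\<alpha> i)) * coef (T n k) (\<alpha>(i := Suc (\<alpha> i))) =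
    - (of_nat m * (?a - 1) * coef (T n (k + (m - M i))) \<alpha>) - 0" .
  have "X = - ((a - 1) * Y) / S" if "mm * S * X = - (mm * (a - 1) * Y) - 0" "mm \<noteq> 0" "S \<noteq> 0" for X Y S a mm :: complex
  proof -
    have "mm * (S * X) = mm * (- ((a - 1) * Y))" using that(1) by (simp only: mult.assoc mult_minus_right diff_zero)
    then have "S * X = - ((a - 1) * Y)" using that(2) by (metis mult_left_cancel)
    then show ?thesis using that(3) by (metis nonzero_mult_div_cancel_left)
  qed
  from this[OF e] have "coef (T n k) (\<alpha>(i := Suc (\<alpha> i))) = - ((?a - 1) * coef (T n (k + (m - M i))) \<alpha>) / of_nat (Suc (\<alpha> i))"
    using m_pos by (simp del: of_nat_Suc)
  then show ?case
    unfolding sum_fun_upd_Suc afact_Suc 2 a by (simp add: mult_ac del: of_nat_Suc fun_upd_apply)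
qed

text \<open>Formally, log \<phi> times \<phi>^n is the derivative of \<phi>^n in n, and a depends on
  n through n / m; so the formula of \<open>coef_T\<close> is differentiated in a and divided once
  more by m.\<close>

lemma coef_Lam_T:
  "coef (Lam * T n k) \<alpha> = (-1) ^ sum \<alpha> UNIV * fd (sum \<alpha> UNIV) ((of_nat n - of_nat k + of_nat (dotM \<alpha>)) / of_nat m) / (of_nat m ^ 2 * afact \<alpha>)"
proof (induction \<alpha> arbitrary: n k rule: multi_index_induct)
  case 1
  then show ?case by (simp add: coef_zero ev0_simps Lam)
next
  case (2 \<alpha> i)
  let ?a = "(of_nat n - of_nat k + of_nat (dotM (\<alpha>(i := Suc (\<alpha> i))))) / of_nat m :: complex"
  have a: "(of_nat n - of_nat (k + (m - M i)) + of_nat (dotM \<alpha>)) / of_nat m = ?a - 1"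
    using M_le[of i] m_pos by (simp add: dotM_Suc of_nat_diff field_simps)
  have gL: "ganalytic (Lam * T n k)" for n k by (intro ganalytic_mult Lam ganalytic_T)
  have "of_nat m * of_nat (Suc (\<alpha> i)) * coef (Lam * T n k) (\<alpha>(i := Suc (\<alpha> i))) =
     - ((of_nat n - of_nat k - of_nat m + of_nat (dotM (\<alpha>(i := Suc (\<alpha> i))))) * coef (Lam * T n (k + (m - M i))) \<alpha>)
     - coef (T n (k + (m - M i))) \<alpha>"
    by (rule coef_T_aux[where r = "\<lambda>n k. coef (T n k)" and b = "\<lambda>n k. coef (Lam * T n k)"],
        rule PDE_coef[OF gL gL ganalytic_T Lam_T_PDE]) (simp add: T_add)
  also have "of_nat n - of_nat k - of_nat m + of_nat (dotM (\<alpha>(i := Suc (\<alpha> i)))) = of_nat m * (?a - 1)"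
    using m_pos by (simp add: field_simps)
  finally have e: "of_nat m * of_nat (Suc (\<alpha> i)) * coef (Lam * T n k) (\<alpha>(i := Suc (\<alpha> i))) =
    - (of_nat m * (?a - 1) * coef (Lam * T n (k + (m - M i))) \<alpha>) - coef (T n (k + (m - M i))) \<alpha>" .
  define N where "N = sum \<alpha> UNIV"
  define A where "A = afact \<alpha>"
  define mm where "mm = (of_nat m :: complex)"
  have nz: "mm \<noteq> 0" "A \<noteq> 0" using m_pos afact_nonzero by (simp_all add: mm_def A_def)
  have "mm * of_nat (Suc (\<alpha> i)) * coef (Lam * T n k) (\<alpha>(i := Suc (\<alpha> i))) =
    - (mm * (?a - 1) * ((-1) ^ N * fd N (?a - 1) / (mm ^ 2 * A))) - (-1) ^ N * fp N (?a - 1) / (mm * A)"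
    using e unfolding 2 coef_T a unfolding N_def[symmetric] A_def[symmetric] mm_def[symmetric] .
  also have "\<dots> = (-1) ^ Suc N * fd (Suc N) ?a / (mm * A)"
    using nz by (simp add: field_simps power2_eq_square)
  finally have "coef (Lam * T n k) (\<alpha>(i := Suc (\<alpha> i))) = (-1) ^ Suc N * fd (Suc N) ?a / (mm ^ 2 * (of_nat (Suc (\<alpha> i)) * A))"
    using nz by (simp add: divide_simps power2_eq_square del: of_nat_Suc fd.simps power_Suc) (simp add: mult_ac del: of_nat_Suc fd.simps power_Suc)
  then show ?case unfolding sum_fun_upd_Suc afact_Suc N_def A_def mm_def .
qed

definition psi :: "'n germ" where "psi = phi * Lam"

lemma ganalytic_psi: "ganalytic psi"
  unfolding psi_def by (intro ganalytic_mult phi Lam)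

text \<open>The common argument a of the falling factorials in the coefficients of
  \<open>phi\<close> and \<open>psi\<close>.\<close>

definition aval :: "('n \<Rightarrow> nat) \<Rightarrow> complex" where "aval \<alpha> = (1 + of_nat (dotM \<alpha>)) / of_nat m"

lemma pd_phi_T: "pd j phi = - T (M j + 1) 0"
  by (simp add: pd_phi ell_def T_def mult_ac)

lemma pd_psi_T: "pd j psi = - (T (M j + 1) 0 + Lam * T (M j + 1) 0)"
proof -
  have "pd j psi = (1 + Lam) * pd j phi"
    by (simp add: psi_def pd_mult phi(1) Lam(1) pd_Lam pd_phi algebra_simps)
  then show ?thesis by (simp add: pd_phi_T algebra_simps)
qed

lemma dec_index:
  assumes "\<alpha> \<noteq> (\<lambda>_. 0)"
  obtains \<gamma> :: "'n \<Rightarrow> nat" and j where "\<alpha> = \<gamma>(j := Suc (\<gamma> j))" "sum \<gamma> UNIV = sum \<alpha> UNIV - 1"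
proof -
  obtain j where "\<alpha> j \<noteq> 0" using assms by auto
  then have "\<alpha> = (\<alpha>(j := \<alpha> j - 1))(j := Suc ((\<alpha>(j := \<alpha> j - 1)) j))" by auto
  moreover from this have "sum (\<alpha>(j := \<alpha> j - 1)) UNIV = sum \<alpha> UNIV - 1" by (metis sum_fun_upd_Suc diff_Suc_1)
  ultimately show ?thesis by (rule that)
qed

lemma coef_phi_0: "coef phi (\<lambda>_. 0) = 1"
  by (simp add: coef_zero phi)

text \<open>One derivative in a direction j turns \<open>phi\<close> into
  \<open>- T (M j + 1) 0\<close>; hence the length is one less than the degree of \<alpha>, and M j
  + 1 completes the argument to (1 + dotM \<alpha>) / m.\<close>

lemma coef_phi:
  assumes "\<alpha> \<noteq> (\<lambda>_. 0)"
  shows "coef phi \<alpha> = (-1) ^ sum \<alpha> UNIV * fp (sum \<alpha> UNIV - 1) (aval \<alpha>) / (of_nat m * afact \<alpha>)"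
proof -
  obtain \<gamma> j where \<gamma>: "\<alpha> = \<gamma>(j := Suc (\<gamma> j))" "sum \<gamma> UNIV = sum \<alpha> UNIV - 1" by (rule dec_index[OF assms])
  have s: "sum \<alpha> UNIV = Suc (sum \<gamma> UNIV)" unfolding \<gamma>(1) by (rule sum_fun_upd_Suc)
  have av: "(of_nat (M j + 1) - of_nat 0 + of_nat (dotM \<gamma>)) / of_nat m = aval \<alpha>"
    by (simp add: \<gamma>(1) aval_def dotM_Suc add_ac)
  have af: "afact \<alpha> = of_nat (Suc (\<gamma> j)) * afact \<gamma>" by (simp only: \<gamma>(1) afact_Suc)
  have "coef phi \<alpha> = - coef (T (M j + 1) 0) \<gamma> / of_nat (Suc (\<gamma> j))"
    unfolding \<gamma>(1) coef_Suc[OF phi(1)] pd_phi_T coef_uminus[OF ganalytic_T] ..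
  also have "\<dots> = (-1) ^ sum \<alpha> UNIV * fp (sum \<gamma> UNIV) (aval \<alpha>) / (of_nat m * afact \<alpha>)"
    unfolding coef_T s av af by (simp add: mult_ac del: of_nat_Suc)
  finally show ?thesis unfolding \<gamma>(2) .
qed

lemma coef_psi:
  assumes "\<alpha> \<noteq> (\<lambda>_. 0)"
  shows "coef psi \<alpha> = (-1) ^ sum \<alpha> UNIV *
    (fp (sum \<alpha> UNIV - 1) (aval \<alpha>) + fd (sum \<alpha> UNIV - 1) (aval \<alpha>) / of_nat m) / (of_nat m * afact \<alpha>)"
proof -
  obtain \<gamma> j where \<gamma>: "\<alpha> = \<gamma>(j := Suc (\<gamma> j))" "sum \<gamma> UNIV = sum \<alpha> UNIV - 1" by (rule dec_index[OF assms])
  have s: "sum \<alpha> UNIV = Suc (sum \<gamma> UNIV)" unfolding \<gamma>(1) by (rule sum_fun_upd_Suc)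
  have g: "ganalytic (Lam * T n k)" for n k by (intro ganalytic_mult Lam ganalytic_T)
  have av: "(of_nat (M j + 1) - of_nat 0 + of_nat (dotM \<gamma>)) / of_nat m = aval \<alpha>"
    by (simp add: \<gamma>(1) aval_def dotM_Suc add_ac)
  have "coef psi \<alpha> = - (coef (T (M j + 1) 0) \<gamma> + coef (Lam * T (M j + 1) 0) \<gamma>) / of_nat (Suc (\<gamma> j))"
    unfolding \<gamma>(1) coef_Suc[OF ganalytic_psi] pd_psi_T coef_uminus[OF ganalytic_add[OF ganalytic_T g]] coef_add[OF ganalytic_T g] ..
  also have "\<dots> = (-1) ^ sum \<alpha> UNIV *
    (fp (sum \<gamma> UNIV) (aval \<alpha>) + fd (sum \<gamma> UNIV) (aval \<alpha>) / of_nat m) / (of_nat m * (of_nat (Suc (\<gamma> j)) * afact \<gamma>))"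
    unfolding coef_T coef_Lam_T s av using m_pos afact_nonzero[of \<gamma>]
    by (simp add: divide_simps power2_eq_square del: of_nat_Suc) (simp add: algebra_simps del: of_nat_Suc)
  also have "of_nat (Suc (\<gamma> j)) * afact \<gamma> = afact \<alpha>" by (simp only: \<gamma>(1) afact_Suc)
  finally show ?thesis unfolding \<gamma>(2) .
qed

end

section \<open>The recursion for explicit coefficients\<close>

lemma fp_add: "fp (p + q) a = fp p a * fp q (a - of_nat p)"
  by (induction p arbitrary: a) (simp_all add: algebra_simps)

lemma fp_rise: "fp q (a + of_nat q) = (\<Prod>k<q. a + of_nat k)"
  by (induction q) (simp_all add: algebra_simps)

lemma fp_neg: "fp q (1 - b) = (-1) ^ q * (\<Prod>k<q. b + of_nat k)"
proof (induction q arbitrary: b)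
  case (Suc q)
  have "fp (Suc q) (1 - b) = - b * fp q (1 - (b + 1))" by simp
  also have "\<dots> = (-1) ^ Suc q * (b * (\<Prod>k<q. b + of_nat (Suc k)))"
    unfolding Suc by (simp add: algebra_simps)
  also have "b * (\<Prod>k<q. b + of_nat (Suc k)) = (\<Prod>k<Suc q. b + of_nat k)"
    unfolding prod.lessThan_Suc_shift by simp
  finally show ?case .
qed simp

lemma fp_eq_0_iff: "fp N a = 0 \<longleftrightarrow> (\<exists>k\<in>{1..N}. a = of_nat k)"
proof (induction N arbitrary: a)
  case (Suc N)
  have "(\<exists>k\<in>{1..Suc N}. a = of_nat k) \<longleftrightarrow> a = 1 \<or> (\<exists>k\<in>{1..N}. a - 1 = of_nat k)"
  proof safe
    fix k assume "k \<in> {1..Suc N}" "a = of_nat k" "\<not> (\<exists>k'\<in>{1..N}. of_nat k - 1 = (of_nat k' :: complex))"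
    then show "of_nat k = (1 :: complex)" by (cases "k = 1") (auto dest!: bspec[of _ _ "k - 1"] simp: of_nat_diff)
  next
    fix k assume "k \<in> {1..N}" "a - 1 = of_nat k"
    then show "\<exists>k\<in>{1..Suc N}. a = of_nat k" by (intro bexI[of _ "Suc k"]) (auto simp: algebra_simps)
  qed auto
  then show ?case by (simp add: Suc)
qed simp

lemma fp_zero: "fp N 0 = (-1) ^ N * fact N"
proof -
  have "(\<Prod>k<N. 1 + of_nat k) = (fact N :: complex)" by (induction N) (simp_all add: algebra_simps)
  then show ?thesis using fp_neg[of N 1] by simp
qed

text \<open>Among the factors c - 1, ..., c - N exactly the c-th is zero, so only the term
  differentiating it survives: the factors before it give (c - 1)!, those after it (-1)^(N - c) (N -
  c)!.\<close>

lemma fd_of_nat: "1 \<le> c \<Longrightarrow> c \<le> N \<Longrightarrow> fd N (of_nat c) = (-1) ^ (N - c) * fact (c - 1) * fact (N - c)"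
proof (induction N arbitrary: c)
  case (Suc N)
  show ?case
  proof (cases "c = 1")
    case True
    then show ?thesis by (simp add: fp_zero)
  next
    case False
    then obtain d where d: "c = Suc d" "1 \<le> d" "d \<le> N" using Suc.prems by (cases c) auto
    have "fp N (of_nat d) = 0" using d by (auto simp: fp_eq_0_iff)
    moreover have "of_nat d * fact (d - 1) = (fact d :: complex)" using d by (simp add: fact_reduce)
    ultimately show ?thesis using Suc.IH[of d] d by (simp add: mult_ac)
  qed
qed simp

lemma prod_of_nat_rise:
  assumes "c \<ge> 1"
  shows "(\<Prod>k<q. of_nat c + of_nat k) * fact (c - 1) = (fact (c + q - 1) :: complex)"
proof (induction q)
  case (Suc q)
  have "c + Suc q - 1 = Suc (c + q - 1)" using assms by simp
  then have "fact (c + Suc q - 1) = (of_nat (Suc (c + q - 1)) * fact (c + q - 1) :: complex)"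
    by (simp only: fact_Suc)
  also have "Suc (c + q - 1) = c + q" using assms by simp
  finally show ?case using Suc by (simp add: mult_ac)
qed simp

text \<open>A single equation of the recursion; components in one residue class are treated by
  asserting it only for the indices of that class.\<close>

definition mellin_rec_at :: "nat \<Rightarrow> ('n::finite \<Rightarrow> nat) \<Rightarrow> (('n \<Rightarrow> nat) \<Rightarrow> complex) \<Rightarrow> 'n \<Rightarrow> ('n \<Rightarrow> nat) \<Rightarrow> bool" where
  "mellin_rec_at m M c j \<alpha> \<longleftrightarrow>
     (\<Prod>k<M j. of_nat (\<Sum>i\<in>UNIV. M i * \<alpha> i) + (of_nat m * of_nat k + 1)) *
     (\<Prod>k<m - M j. of_nat (\<Sum>i\<in>UNIV. (m - M i) * \<alpha> i) + (of_nat m * of_nat k - 1)) * c \<alpha> =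
     (-1) ^ M j * of_nat m ^ m * (\<Prod>k<m. of_nat (\<alpha> j + k + 1)) * c (\<alpha>(j := \<alpha> j + m))"

lemma mellin_rec_iff: "mellin_rec m M c \<longleftrightarrow> (\<forall>j \<alpha>. mellin_rec_at m M c j \<alpha>)"
  unfolding mellin_rec_def mellin_rec_at_def ..

context mellin_data
begin

abbreviation deg :: "('n \<Rightarrow> nat) \<Rightarrow> nat" where "deg \<alpha> \<equiv> sum \<alpha> (UNIV :: 'n set)"

lemma dotM_compl: "(\<Sum>i\<in>UNIV. (m - M i) * \<alpha> i) + dotM \<alpha> = m * deg \<alpha>"
  unfolding dotM_def sum.distrib[symmetric] sum_distrib_left
  by (rule sum.cong) (simp_all add: distrib_right[symmetric] M_le)

lemma m_nz: "(of_nat m :: complex) \<noteq> 0"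
  using m_pos by simp

lemma of_nat_dotM: "of_nat (dotM \<alpha>) = of_nat m * aval \<alpha> - 1"
  using m_nz by (simp add: aval_def)

lemma of_nat_dotM_compl: "of_nat (\<Sum>i\<in>UNIV. (m - M i) * \<alpha> i) = of_nat m * (of_nat (deg \<alpha>) - aval \<alpha>) + (1 :: complex)"
  using arg_cong[OF dotM_compl[of \<alpha>], of "of_nat :: nat \<Rightarrow> complex"] unfolding of_nat_add of_nat_mult of_nat_dotM
  by (simp add: algebra_simps)

text \<open>In terms of a = \<open>aval \<alpha>\<close> each of the m linear factors on the left
  contains a factor m, and together these cancel m^m on the right.\<close>

lemma mellin_rec_at_eq:
  "mellin_rec_at m M c j \<alpha> \<longleftrightarrow>
     (\<Prod>k<M j. aval \<alpha> + of_nat k) * (\<Prod>k<m - M j. of_nat (deg \<alpha>) - aval \<alpha> + of_nat k) * c \<alpha> =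
     (-1) ^ M j * (\<Prod>k<m. of_nat (\<alpha> j + k + 1)) * c (\<alpha>(j := \<alpha> j + m))"
proof -
  have 1: "(\<Prod>k<M j. of_nat (\<Sum>i\<in>UNIV. M i * \<alpha> i) + (of_nat m * of_nat k + 1)) = of_nat m ^ M j * (\<Prod>k<M j. aval \<alpha> + of_nat k)"
  proof -
    have "of_nat (\<Sum>i\<in>UNIV. M i * \<alpha> i) + (of_nat m * of_nat k + 1) = of_nat m * (aval \<alpha> + of_nat k)" for k
      using of_nat_dotM[of \<alpha>] unfolding dotM_def by (simp only:) (simp add: algebra_simps)
    then show ?thesis by (simp only: prod.distrib prod_constant card_lessThan)
  qed
  have 2: "(\<Prod>k<m - M j. of_nat (\<Sum>i\<in>UNIV. (m - M i) * \<alpha> i) + (of_nat m * of_nat k - 1)) =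
     of_nat m ^ (m - M j) * (\<Prod>k<m - M j. of_nat (deg \<alpha>) - aval \<alpha> + of_nat k)"
  proof -
    have "of_nat (\<Sum>i\<in>UNIV. (m - M i) * \<alpha> i) + (of_nat m * of_nat k - 1) = of_nat m * (of_nat (deg \<alpha>) - aval \<alpha> + of_nat k)" for k
      unfolding of_nat_dotM_compl by (simp add: algebra_simps)
    then show ?thesis by (simp only: prod.distrib prod_constant card_lessThan)
  qed
  have p: "(of_nat m :: complex) ^ m = of_nat m ^ M j * of_nat m ^ (m - M j)"
    using M_le[of j] by (simp add: power_add[symmetric])
  have nz: "(of_nat m :: complex) ^ M j * of_nat m ^ (m - M j) \<noteq> 0" using m_nz by simp
  have "x * A * (y * B) * C = S * (x * y) * R * D \<longleftrightarrow> A * B * C = S * R * D" if "x * y \<noteq> 0" for x y A B C S R D :: complex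
  proof -
    have "x * A * (y * B) * C = (x * y) * (A * B * C)" "S * (x * y) * R * D = (x * y) * (S * R * D)" by simp_all
    then show ?thesis using that by (metis mult_left_cancel)
  qed
  from this[OF nz] show ?thesis unfolding mellin_rec_at_def 1 2 p .
qed

lemma deg_add: "deg (\<alpha>(j := \<alpha> j + x)) = deg \<alpha> + x"
  using sum_fun_upd[of \<alpha> j "\<alpha> j + x"] by simp

lemma dotM_add: "dotM (\<alpha>(j := \<alpha> j + x)) = dotM \<alpha> + M j * x"
  using dotM_upd[of \<alpha> j "\<alpha> j + x"] by (simp add: algebra_simps)

lemma aval_add: "aval (\<alpha>(j := \<alpha> j + m)) = aval \<alpha> + of_nat (M j)"
  unfolding aval_def dotM_add using m_nz by (simp add: field_simps)

lemma afact_add: "afact (\<alpha>(j := \<alpha> j + x)) = afact \<alpha> * (\<Prod>k<x. of_nat (\<alpha> j + k + 1))"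
proof -
  have "fact (\<alpha> j + x) = fact (\<alpha> j) * (\<Prod>k<x. of_nat (\<alpha> j + k + 1) :: complex)"
    by (induction x) (simp_all add: algebra_simps)
  then show ?thesis by (simp add: afact_def prod.remove[of UNIV j] mult_ac del: of_nat_Suc)
qed

lemma prod_shift_nonzero: "(\<Prod>k<x. of_nat (a + k + 1) :: complex) \<noteq> 0"
  by (simp del: of_nat_Suc of_nat_add)

text \<open>With d the degree of \<alpha>, the falling factorial of length d + m - 1 at a + m_j
  splits into m_j factors rising from a, the falling factorial of length d - 1 at a that belongs to
  \<alpha>, and m - m_j factors that form the second product up to sign.\<close>

lemma phi_rec: "mellin_rec m M (coef phi)"
  unfolding mellin_rec_iff mellin_rec_at_eq
proof (intro allI)
  fix j \<alpha>
  define a where "a = aval \<alpha>"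
  define R where "R = (\<Prod>k<m. of_nat (\<alpha> j + k + 1) :: complex)"
  define A where "A = (\<Prod>k<M j. a + of_nat k)"
  define B where "B = (\<Prod>k<m - M j. of_nat (deg \<alpha>) - a + of_nat k)"
  let ?\<alpha>' = "\<alpha>(j := \<alpha> j + m)"
  have ne: "?\<alpha>' \<noteq> (\<lambda>_. 0)" using m_pos by (metis add_is_0 fun_upd_same less_irrefl)
  have R: "R \<noteq> 0" unfolding R_def by (rule prod_shift_nonzero)
  have c': "coef phi ?\<alpha>' = (-1) ^ (deg \<alpha> + m) * fp (deg \<alpha> + m - 1) (a + of_nat (M j)) / (of_nat m * (afact \<alpha> * R))"
    unfolding coef_phi[OF ne] deg_add aval_add afact_add R_def a_def ..
  have sg: "(-1) ^ M j * (-1) ^ m * (-1) ^ (m - M j) = (1 :: complex)"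
    using M_le[of j] by (simp add: power_add[symmetric])
  show "(\<Prod>k<M j. aval \<alpha> + of_nat k) * (\<Prod>k<m - M j. of_nat (deg \<alpha>) - aval \<alpha> + of_nat k) * coef phi \<alpha> =
     (-1) ^ M j * (\<Prod>k<m. of_nat (\<alpha> j + k + 1)) * coef phi ?\<alpha>'"
  proof (cases "\<alpha> = (\<lambda>_. 0)")
    case False
    define F where "F = fp (deg \<alpha> - 1) a"
    have d: "deg \<alpha> \<ge> 1" using False by (auto simp: Suc_le_eq intro!: Nat.gr0I)
    have "deg \<alpha> + m - 1 = M j + ((deg \<alpha> - 1) + (m - M j))" using d M_le[of j] by simp
    then have "fp (deg \<alpha> + m - 1) (a + of_nat (M j)) =
      fp (M j) (a + of_nat (M j)) * (fp (deg \<alpha> - 1) a * fp (m - M j) (a - of_nat (deg \<alpha> - 1)))"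
      by (simp only: fp_add) simp
    also have "a - of_nat (deg \<alpha> - 1) = 1 - (of_nat (deg \<alpha>) - a)" using d by (simp add: of_nat_diff)
    finally have f: "fp (deg \<alpha> + m - 1) (a + of_nat (M j)) = A * (F * ((-1) ^ (m - M j) * B))"
      unfolding fp_rise fp_neg A_def B_def F_def .
    have c: "coef phi \<alpha> = (-1) ^ deg \<alpha> * F / (of_nat m * afact \<alpha>)"
      unfolding coef_phi[OF False] F_def a_def ..
    have "(-1) ^ M j * R * coef phi ?\<alpha>' = ((-1) ^ M j * (-1) ^ m * (-1) ^ (m - M j)) * (A * B * coef phi \<alpha>)"
      unfolding c' f c using R m_nz afact_nonzero[of \<alpha>] by (simp add: power_add field_simps)
    then show ?thesis unfolding sg A_def B_def a_def R_def by simp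
  next
    \<comment> \<open>At \<alpha> = 0 the splitting would require length -1. Here a = 1 / m, and the
      factor - a at the start of \<open>B\<close> supplies the 1 / m that the constant coefficient 1
      of \<open>phi\<close> lacks.\<close>
    case True
    have a: "a = 1 / of_nat m" and d: "deg \<alpha> = 0" using True by (simp_all add: a_def aval_def dotM_def)
    have af: "afact \<alpha> = 1" using True afact_0 by simp
    define F where "F = fp (m - M j - 1) a"
    have "m - 1 = M j + (m - M j - 1)" using M_less[of j] by simp
    then have f: "fp (m - 1) (a + of_nat (M j)) = A * F"
      unfolding A_def F_def by (simp only: fp_add fp_rise) simp
    have B: "B = (-1) ^ (m - M j) * (a * F)"
    proof -
      have "fp (m - M j) (1 - (- a)) = (-1) ^ (m - M j) * B" unfolding fp_neg B_def d by simp
      moreover have "fp (m - M j) (1 - (- a)) = a * F"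
        using M_less[of j] fp.simps(2)[of "m - M j - 1" "1 + a"] by (simp add: F_def Suc_diff_Suc)
      ultimately have "(-1) ^ (m - M j) * ((-1) ^ (m - M j) * B) = (-1) ^ (m - M j) * (a * F)" by simp
      then show ?thesis by (simp add: mult.assoc[symmetric] power_mult_distrib[symmetric])
    qed
    have c: "coef phi \<alpha> = 1" using True coef_phi_0 by simp
    have "(-1) ^ M j * R * coef phi ?\<alpha>' = ((-1) ^ M j * (-1) ^ m) * (A * F) / of_nat m"
      unfolding c' d af using f R m_nz by (simp add: field_simps)
    moreover have "A * B * coef phi \<alpha> = (-1) ^ (m - M j) * (A * F) / of_nat m"
      unfolding B c a by simp
    moreover have "(-1) ^ M j * (-1) ^ m = ((-1) ^ (m - M j) :: complex)"
      using sg by (metis minus_one_mult_self mult.assoc mult.right_neutral)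
    ultimately show ?thesis unfolding A_def B_def a_def R_def by simp
  qed
qed

text \<open>If m divides 1 + dotM \<alpha>, this is the integer value of
  \<open>aval \<alpha>\<close>, the N of the explicit coefficients; N' is then
  \<open>deg \<alpha> - zc \<alpha>\<close>.\<close>

definition zc :: "('n \<Rightarrow> nat) \<Rightarrow> nat" where "zc \<alpha> = (1 + dotM \<alpha>) div m"

text \<open>Equivalently, \<open>aval \<alpha>\<close> is one of 1, ..., deg \<alpha> - 1, a zero of
  the falling factorial in \<open>coef_phi\<close>. The excluded equality says that
  \<open>aval \<alpha>\<close> is deg \<alpha>, just beyond the last zero.\<close>

definition regular :: "('n \<Rightarrow> nat) \<Rightarrow> bool" where
  "regular \<alpha> \<longleftrightarrow> m dvd 1 + dotM \<alpha> \<and> 1 + dotM \<alpha> \<noteq> m * deg \<alpha>"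

lemma dotM_le: "\<alpha> \<noteq> (\<lambda>_. 0) \<Longrightarrow> 1 + dotM \<alpha> \<le> m * deg \<alpha>"
proof -
  assume "\<alpha> \<noteq> (\<lambda>_. 0)"
  then have "deg \<alpha> \<ge> 1" by (auto simp: Suc_le_eq intro!: Nat.gr0I)
  moreover have "1 * deg \<alpha> \<le> (\<Sum>i\<in>UNIV. (m - M i) * \<alpha> i)"
    unfolding sum_distrib_left using M_less by (intro sum_mono mult_right_mono) (auto simp: Suc_le_eq)
  ultimately show ?thesis using dotM_compl[of \<alpha>] by simp
qed

lemma Z_nonzero: "m dvd 1 + dotM \<alpha> \<Longrightarrow> \<alpha> \<noteq> (\<lambda>_. 0)"
  using m_ge2 by (auto simp: dotM_def)

lemma Z_zc:
  assumes "m dvd 1 + dotM \<alpha>"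
  shows "1 + dotM \<alpha> = m * zc \<alpha>" "1 \<le> zc \<alpha>" "zc \<alpha> \<le> deg \<alpha>" "aval \<alpha> = of_nat (zc \<alpha>)"
proof -
  show 1: "1 + dotM \<alpha> = m * zc \<alpha>" using assms by (simp add: zc_def)
  then show "1 \<le> zc \<alpha>" by (cases "zc \<alpha>") auto
  show "zc \<alpha> \<le> deg \<alpha>" using dotM_le[OF Z_nonzero[OF assms]] m_pos unfolding 1 by simp
  have "of_nat (1 + dotM \<alpha>) = (of_nat m * of_nat (zc \<alpha>) :: complex)" by (simp only: 1 of_nat_mult)
  then show "aval \<alpha> = of_nat (zc \<alpha>)" using m_nz by (simp add: aval_def)
qed

lemma regular_zc:
  assumes "regular \<alpha>"
  shows "1 + dotM \<alpha> = m * zc \<alpha>" "1 \<le> zc \<alpha>" "zc \<alpha> < deg \<alpha>" "aval \<alpha> = of_nat (zc \<alpha>)" "\<alpha> \<noteq> (\<lambda>_. 0)"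
  using Z_zc[of \<alpha>] Z_nonzero[of \<alpha>] assms unfolding regular_def by (auto simp: le_less)

lemma coef_phi_eq_0_iff: "coef phi \<alpha> = 0 \<longleftrightarrow> regular \<alpha>"
proof (cases "\<alpha> = (\<lambda>_. 0)")
  case True
  then show ?thesis using coef_phi_0 Z_nonzero[of \<alpha>] by (auto simp: regular_def)
next
  case False
  have "coef phi \<alpha> = 0 \<longleftrightarrow> (\<exists>k\<in>{1..deg \<alpha> - 1}. aval \<alpha> = of_nat k)"
    unfolding coef_phi[OF False] using m_nz afact_nonzero by (simp add: fp_eq_0_iff)
  also have "\<dots> \<longleftrightarrow> regular \<alpha>"
  proof
    assume "\<exists>k\<in>{1..deg \<alpha> - 1}. aval \<alpha> = of_nat k"
    then obtain k where k: "1 \<le> k" "k \<le> deg \<alpha> - 1" "aval \<alpha> = of_nat k" by auto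
    have "(of_nat (1 + dotM \<alpha>) :: complex) = of_nat (m * k)"
      using k(3) m_nz by (simp add: aval_def field_simps)
    then have "1 + dotM \<alpha> = m * k" by (simp only: of_nat_eq_iff)
    moreover have "k < deg \<alpha>" using k by simp
    ultimately show "regular \<alpha>" using m_pos unfolding regular_def by simp
  next
    assume "regular \<alpha>"
    from regular_zc[OF this] show "\<exists>k\<in>{1..deg \<alpha> - 1}. aval \<alpha> = of_nat k"
      by (intro bexI[of _ "zc \<alpha>"]) auto
  qed
  finally show ?thesis .
qed

text \<open>For regular \<alpha> this is the coefficient of \<open>psi\<close> up to the constant -
  1 / m^2: the falling factorial vanishes and its derivative is given by
  \<open>fd_of_nat\<close>.\<close>

definition gc :: "('n \<Rightarrow> nat) \<Rightarrow> complex" where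
  "gc \<alpha> = (-1) ^ zc \<alpha> * fact (zc \<alpha> - 1) * fact (deg \<alpha> - zc \<alpha> - 1) / afact \<alpha>"

lemma gc_nonzero: "gc \<alpha> \<noteq> 0"
  by (simp add: gc_def afact_nonzero)

lemma coef_psi_regular:
  assumes "regular \<alpha>"
  shows "coef psi \<alpha> = - gc \<alpha> / of_nat m ^ 2"
proof -
  note r = regular_zc[OF assms]
  have 0: "fp (deg \<alpha> - 1) (of_nat (zc \<alpha>)) = 0" using r by (auto simp: fp_eq_0_iff)
  have 1: "fd (deg \<alpha> - 1) (of_nat (zc \<alpha>)) = (-1) ^ (deg \<alpha> - 1 - zc \<alpha>) * fact (zc \<alpha> - 1) * fact (deg \<alpha> - 1 - zc \<alpha>)"
    using r by (intro fd_of_nat) auto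
  define d where "d = deg \<alpha> - zc \<alpha> - 1"
  have "deg \<alpha> = Suc (zc \<alpha> + d)" using r by (simp add: d_def)
  then have d: "deg \<alpha> - 1 - zc \<alpha> = d" "deg \<alpha> = Suc (zc \<alpha> + d)" by simp_all
  have s: "(-1) ^ Suc (zc \<alpha> + d) * (-1) ^ d = (- ((-1) ^ zc \<alpha>) :: complex)"
    by (simp add: power_add mult.assoc)
  have "coef psi \<alpha> = ((-1) ^ Suc (zc \<alpha> + d) * (-1) ^ d) * fact (zc \<alpha> - 1) * fact d / (of_nat m ^ 2 * afact \<alpha>)"
    unfolding coef_psi[OF r(5)] r(4) 0 1 unfolding d(1) unfolding d(2) by (simp add: power2_eq_square mult_ac)
  then show ?thesis unfolding s gc_def d_def[symmetric] by simp
qed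

lemma regular_add: "regular \<alpha> \<Longrightarrow> regular (\<alpha>(j := \<alpha> j + m))"
proof -
  assume r: "regular \<alpha>"
  have "1 + dotM (\<alpha>(j := \<alpha> j + m)) = m * (zc \<alpha> + M j)"
    unfolding dotM_add using regular_zc(1)[OF r] by (simp add: algebra_simps)
  moreover have "zc \<alpha> + M j < deg (\<alpha>(j := \<alpha> j + m))"
    unfolding deg_add using regular_zc(3)[OF r] M_le[of j] by simp
  ultimately show ?thesis unfolding regular_def using m_pos by simp
qed

text \<open>Passing from \<alpha> to \<alpha> + m e_j raises N by m_j and N' by m - m_j. The two
  products on the left extend (N - 1)! and (N' - 1)! accordingly, m further factors extend
  \<alpha>_j!, and (-1)^N absorbs the sign.\<close>

lemma gc_rec:
  assumes r: "regular \<alpha>"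
  shows "mellin_rec_at m M gc j \<alpha>"
  unfolding mellin_rec_at_eq
proof -
  note z = regular_zc[OF r]
  let ?\<alpha>' = "\<alpha>(j := \<alpha> j + m)"
  define R where "R = (\<Prod>k<m. of_nat (\<alpha> j + k + 1) :: complex)"
  have R: "R \<noteq> 0" unfolding R_def by (rule prod_shift_nonzero)
  define c' where "c' = deg \<alpha> - zc \<alpha>"
  have c': "c' \<ge> 1" "of_nat (deg \<alpha>) - aval \<alpha> = of_nat c'" using z by (simp_all add: c'_def of_nat_diff)
  have zc: "zc ?\<alpha>' = zc \<alpha> + M j"
  proof -
    have "1 + dotM ?\<alpha>' = m * (zc \<alpha> + M j)"
      unfolding dotM_add using z(1) by (simp add: algebra_simps)
    then show ?thesis unfolding zc_def using m_pos by simp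
  qed
  have d': "deg ?\<alpha>' - zc ?\<alpha>' = c' + (m - M j)"
    unfolding deg_add zc c'_def using z(3) M_le[of j] by simp
  have A: "(\<Prod>k<M j. aval \<alpha> + of_nat k) * fact (zc \<alpha> - 1) = fact (zc \<alpha> + M j - 1)"
    unfolding z(4) by (rule prod_of_nat_rise[OF z(2)])
  have B: "(\<Prod>k<m - M j. of_nat (deg \<alpha>) - aval \<alpha> + of_nat k) * fact (c' - 1) = fact (c' + (m - M j) - 1)"
    unfolding c'(2) by (rule prod_of_nat_rise[OF c'(1)])
  have g: "gc \<alpha> = (-1) ^ zc \<alpha> * fact (zc \<alpha> - 1) * fact (c' - 1) / afact \<alpha>" by (simp add: gc_def c'_def)
  have g': "gc ?\<alpha>' = (-1) ^ (zc \<alpha> + M j) * fact (zc \<alpha> + M j - 1) * fact (c' + (m - M j) - 1) / (afact \<alpha> * R)"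
    unfolding gc_def d' unfolding zc afact_add R_def ..
  have "(-1) ^ M j * R * gc ?\<alpha>' = ((-1) ^ M j * (-1) ^ M j) * ((-1) ^ zc \<alpha> * fact (zc \<alpha> + M j - 1) * fact (c' + (m - M j) - 1) / afact \<alpha>)"
    unfolding g' using R by (simp add: power_add)
  also have "\<dots> = (-1) ^ zc \<alpha> * fact (zc \<alpha> + M j - 1) * fact (c' + (m - M j) - 1) / afact \<alpha>" by simp
  finally show "(\<Prod>k<M j. aval \<alpha> + of_nat k) * (\<Prod>k<m - M j. of_nat (deg \<alpha>) - aval \<alpha> + of_nat k) * gc \<alpha> =
     (-1) ^ M j * (\<Prod>k<m. of_nat (\<alpha> j + k + 1)) * gc ?\<alpha>'"
    unfolding g A[symmetric] B[symmetric] R_def by simp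
qed

section \<open>Residue classes of multi-indices modulo m\<close>

definition amod :: "('n \<Rightarrow> nat) \<Rightarrow> 'n \<Rightarrow> nat" where "amod \<alpha> = (\<lambda>i. \<alpha> i mod m)"

definition box :: "('n \<Rightarrow> nat) set" where "box = {\<beta>. \<forall>i. \<beta> i < m}"

lemma amod_box: "amod \<alpha> \<in> box"
  using m_pos by (simp add: amod_def box_def)

lemma amod_id: "\<beta> \<in> box \<Longrightarrow> amod \<beta> = \<beta>"
  by (simp add: amod_def box_def)

lemma amod_add: "amod (\<alpha>(j := \<alpha> j + m)) = amod \<alpha>"
  by (auto simp: amod_def)

lemma class_induct:
  assumes "P (amod \<alpha>)" "\<And>\<gamma> j. amod \<gamma> = amod \<alpha> \<Longrightarrow> P \<gamma> \<Longrightarrow> P (\<gamma>(j := \<gamma> j + m))"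
  shows "P \<alpha>"
  using assms
proof (induction "deg \<alpha>" arbitrary: \<alpha> rule: less_induct)
  case less
  show ?case
  proof (cases "\<alpha> \<in> box")
    case True
    then show ?thesis using less.prems(1) amod_id by simp
  next
    case False
    then obtain j where j: "\<alpha> j \<ge> m" by (auto simp: box_def not_less)
    define \<gamma> where "\<gamma> = \<alpha>(j := \<alpha> j - m)"
    have \<alpha>: "\<alpha> = \<gamma>(j := \<gamma> j + m)" using j by (auto simp: \<gamma>_def)
    have am: "amod \<gamma> = amod \<alpha>" by (subst \<alpha>) (simp only: amod_add)
    have "deg \<gamma> < deg \<alpha>" using deg_add[of \<gamma> j m] m_pos \<alpha> by simp
    then have "P \<gamma>" using less.hyps[of \<gamma>] less.prems am by simp
    then show ?thesis using less.prems(2)[OF am, of j] \<alpha> by simp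
  qed
qed

text \<open>The factor in front of the shifted coefficient never vanishes, so the recursion can be
  solved upwards from the representative in the box.\<close>

lemma rec_determined:
  assumes "\<And>j \<gamma>. amod \<gamma> = amod \<alpha> \<Longrightarrow> mellin_rec_at m M u j \<gamma>"
    and "\<And>j \<gamma>. amod \<gamma> = amod \<alpha> \<Longrightarrow> mellin_rec_at m M v j \<gamma>"
    and "u (amod \<alpha>) = v (amod \<alpha>)"
  shows "u \<alpha> = v \<alpha>"
proof (induction \<alpha> rule: class_induct)
  case 1
  show ?case by (rule assms(3))
next
  case (2 \<gamma> j)
  have "(-1) ^ M j * (\<Prod>k<m. of_nat (\<gamma> j + k + 1)) * u (\<gamma>(j := \<gamma> j + m)) =
        (-1) ^ M j * (\<Prod>k<m. of_nat (\<gamma> j + k + 1)) * v (\<gamma>(j := \<gamma> j + m))"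
    using assms(1,2)[OF 2(1), of j] unfolding mellin_rec_at_eq 2(2) by metis
  moreover have "(-1) ^ M j * (\<Prod>k<m. of_nat (\<gamma> j + k + 1) :: complex) \<noteq> 0"
    using prod_shift_nonzero[of "\<gamma> j" m] by simp
  ultimately show ?case by (metis mult_left_cancel)
qed

lemma regular_class: "regular (amod \<alpha>) \<Longrightarrow> regular \<alpha>"
  by (rule class_induct[of regular \<alpha>], assumption, rule regular_add)

lemma rec_scale: "mellin_rec_at m M u j \<gamma> \<Longrightarrow> mellin_rec_at m M (\<lambda>\<alpha>. c * u \<alpha>) j \<gamma>"
  unfolding mellin_rec_at_eq by (simp add: mult.left_commute)

lemma rec_add: "mellin_rec_at m M u j \<gamma> \<Longrightarrow> mellin_rec_at m M v j \<gamma> \<Longrightarrow> mellin_rec_at m M (\<lambda>\<alpha>. u \<alpha> + v \<alpha>) j \<gamma>"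
  unfolding mellin_rec_at_eq by (simp add: distrib_left)

lemma rec_class_mult:
  assumes "mellin_rec_at m M u j \<gamma>" "f (\<gamma>(j := \<gamma> j + m)) = f \<gamma>"
  shows "mellin_rec_at m M (\<lambda>\<alpha>. f \<alpha> * u \<alpha>) j \<gamma>"
  using assms(1) unfolding mellin_rec_at_eq assms(2) by (simp add: mult.left_commute)

end

section \<open>Isotypic components and the space generated by the roots\<close>

text \<open>The matrix of coefficients at the indices in \<open>B\<close> is diagonal with nonzero
  diagonal.\<close>

lemma germ_independent_diag:
  fixes f :: "('n::finite \<Rightarrow> nat) \<Rightarrow> 'n germ"
  assumes fin: "finite B" and an: "\<And>b. b \<in> B \<Longrightarrow> ganalytic (f b)"
    and nz: "\<And>b. b \<in> B \<Longrightarrow> coef (f b) b \<noteq> 0"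
    and z: "\<And>b b'. b \<in> B \<Longrightarrow> b' \<in> B \<Longrightarrow> b \<noteq> b' \<Longrightarrow> coef (f b) b' = 0"
  shows "inj_on f B" "germ.independent (f ` B)"
proof -
  show inj: "inj_on f B" by (rule inj_onI) (metis nz z)
  show "germ.independent (f ` B)"
  proof
    assume "germ.dependent (f ` B)"
    then obtain u b where u: "b \<in> B" "u (f b) \<noteq> 0" "(\<Sum>v\<in>f ` B. scale_germ (u v) v) = 0"
      using fin by (auto simp: germ.dependent_finite)
    have "0 = coef (\<Sum>c\<in>B. scale_germ (u (f c)) (f c)) b"
      using u(3) by (simp add: sum.reindex[OF inj] coef_0)
    also have "\<dots> = (\<Sum>c\<in>B. if c = b then u (f b) * coef (f b) b else 0)"
      by (subst coef_sum) (auto intro!: sum.cong ganalytic_scale an simp: coef_scale[OF an] z u(1))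
    also have "\<dots> = u (f b) * coef (f b) b" using fin u(1) by simp
    finally show False using u nz by simp
  qed
qed

lemma power_int_sum:
  fixes x :: complex
  assumes "x \<noteq> 0" "finite A"
  shows "x powi (\<Sum>i\<in>A. f i) = (\<Prod>i\<in>A. x powi f i)"
  using assms(2) by (induction rule: finite_induct) (auto simp: power_int_add assms(1))

context mellin_data
begin

section \<open>Characters of (Z/m)^n\<close>

abbreviation om :: complex where "om \<equiv> unity_root m"

lemma om_powi: "om powi k = exp (2 * of_real pi * \<i> * of_int k / of_nat m)"
  unfolding unity_root_def exp_power_int by (simp add: mult_ac)

lemma om_nonzero: "om \<noteq> 0"
  by (simp add: unity_root_def)

lemma om_powi_eq_1: "om powi k = 1 \<longleftrightarrow> int m dvd k"
proof -
  have "2 * of_real pi * \<i> * of_int k / of_nat m = \<i> * of_real (2 * pi * of_int k / real m)" by simp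
  then have "om powi k = 1 \<longleftrightarrow> (\<exists>n::int. 2 * pi * of_int k / real m = of_int (2 * n) * pi)"
    unfolding om_powi exp_eq_1 by simp
  also have "\<dots> \<longleftrightarrow> (\<exists>n::int. (of_int k :: real) = of_int (int m * n))"
    using m_pos by (simp add: field_simps)
  also have "\<dots> \<longleftrightarrow> int m dvd k" unfolding of_int_eq_iff dvd_def ..
  finally show ?thesis .
qed

lemma om_power_m: "om ^ m = 1"
  using om_powi_eq_1[of "int m"] by simp

lemma om_geometric: "(\<Sum>k<m. om powi (int k * d)) = (if int m dvd d then of_nat m else 0)"
proof -
  define z where "z = om powi d"
  have "om powi (int k * d) = z ^ k" for k
    unfolding z_def by (metis mult.commute power_int_mult power_int_of_nat)
  moreover have "z ^ m = 1"
    unfolding z_def using om_powi_eq_1[of "d * int m"] by (simp add: power_int_mult)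
  moreover have "z = 1 \<longleftrightarrow> int m dvd d" unfolding z_def by (rule om_powi_eq_1)
  ultimately show ?thesis using geometric_sum[of z m] by auto
qed

text \<open>The character of (Z/m)^n belonging to J; the dilation \<open>udil J\<close> multiplies
  the coefficient of x^\<alpha> by its value at \<alpha>. Integer arguments allow negatives and
  differences of multi-indices.\<close>

definition chr :: "int^'n \<Rightarrow> ('n \<Rightarrow> int) \<Rightarrow> complex" where
  "chr J d = om powi (\<Sum>i\<in>UNIV. J $ i * d i)"

lemma chr_nonzero: "chr J d \<noteq> 0"
  by (simp add: chr_def om_nonzero)

lemma chr_add: "chr J (\<lambda>i. a i + b i) = chr J a * chr J b"
  unfolding chr_def by (simp add: distrib_left sum.distrib power_int_add om_nonzero)

lemma chr_eq_1: "(\<And>i. int m dvd d i) \<Longrightarrow> chr J d = 1"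
  unfolding chr_def om_powi_eq_1 by (intro dvd_sum) simp

lemma chr_cong: "(\<And>i. int m dvd a i - b i) \<Longrightarrow> chr J a = chr J b"
  using chr_add[of J b "\<lambda>i. a i - b i"] chr_eq_1[of "\<lambda>i. a i - b i" J] by simp

lemma chr_prod: "chr J d = (\<Prod>i\<in>UNIV. om powi (J $ i * d i))"
  unfolding chr_def by (rule power_int_sum) (simp_all add: om_nonzero)

lemma sum_index_box: "(\<Sum>J\<in>index_box m. \<Prod>i\<in>UNIV. f i (J $ i)) = (\<Prod>i\<in>UNIV. \<Sum>k<m. f i (int k) :: complex)"
proof -
  have "(\<Prod>i\<in>UNIV. \<Sum>k<m. f i (int k)) = (\<Sum>g\<in>PiE UNIV (\<lambda>_. {..<m}). \<Prod>i\<in>UNIV. f i (int (g i)))"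
    by (rule prod_sum_PiE) auto
  also have "\<dots> = (\<Sum>J\<in>index_box m. \<Prod>i\<in>UNIV. f i (J $ i))"
    by (rule sum.reindex_bij_witness[of _ "\<lambda>J i. nat (J $ i)" "\<lambda>g. \<chi> i. int (g i)"])
       (auto simp: index_box_def PiE_UNIV_domain fun_eq_iff vec_eq_iff nat_less_iff zle_diff1_eq)
  finally show ?thesis ..
qed

lemma sum_chr: "(\<Sum>J\<in>index_box m. chr J d) = (if \<forall>i. int m dvd d i then of_nat m ^ CARD('n) else 0)"
proof -
  have "(\<Sum>J\<in>index_box m. chr J d) = (\<Prod>i\<in>UNIV. \<Sum>k<m. om powi (int k * d i))"
    unfolding chr_prod by (rule sum_index_box[of "\<lambda>i a. om powi (a * d i)"])
  also have "\<dots> = (\<Prod>i\<in>UNIV. if int m dvd d i then of_nat m else 0)" by (simp only: om_geometric)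
  also have "\<dots> = (if \<forall>i. int m dvd d i then of_nat m ^ CARD('n) else 0)"
  proof (cases "\<forall>i. int m dvd d i")
    case False
    then have "(\<Prod>i\<in>UNIV. if int m dvd d i then of_nat m else (0 :: complex)) = 0" by (intro prod_zero) auto
    then show ?thesis unfolding if_not_P[OF False] .
  qed simp
  finally show ?thesis .
qed

lemma finite_index_box: "finite (index_box m :: (int^'n) set)"
proof -
  have "index_box m \<subseteq> vec_lambda ` PiE UNIV (\<lambda>_::'n. {0..int m - 1})"
  proof
    fix J :: "int^'n" assume "J \<in> index_box m"
    then have "vec_nth J \<in> PiE UNIV (\<lambda>_::'n. {0..int m - 1})" by (auto simp: index_box_def)
    then have "vec_lambda (vec_nth J) \<in> vec_lambda ` PiE UNIV (\<lambda>_::'n. {0..int m - 1})" by (rule imageI)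
    then show "J \<in> vec_lambda ` PiE UNIV (\<lambda>_::'n. {0..int m - 1})" by simp
  qed
  then show ?thesis by (rule finite_subset) (intro finite_imageI finite_PiE, auto)
qed

definition udil :: "int^'n \<Rightarrow> 'n germ \<Rightarrow> 'n germ" where
  "udil J = dil (\<lambda>i. om powi (J $ i))"

lemma ganalytic_udil: "ganalytic g \<Longrightarrow> ganalytic (udil J g)"
  unfolding udil_def by (rule ganalytic_dil)

lemma coef_udil: "ganalytic g \<Longrightarrow> coef (udil J g) \<alpha> = chr J (int \<circ> \<alpha>) * coef g \<alpha>"
  unfolding udil_def chr_prod by (simp add: coef_dil power_int_mult)

text \<open>The isotypic projection for the action of (Z/m)^n by dilations: by orthogonality of
  characters, for \<beta> in the box the average keeps exactly the monomials congruent to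
  \<beta>.\<close>

definition proj :: "('n \<Rightarrow> nat) \<Rightarrow> 'n germ \<Rightarrow> 'n germ" where
  "proj \<beta> g = scale_germ (1 / of_nat m ^ CARD('n)) (\<Sum>J\<in>index_box m. scale_germ (chr J (\<lambda>i. - int (\<beta> i))) (udil J g))"

lemma ganalytic_proj: "ganalytic g \<Longrightarrow> ganalytic (proj \<beta> g)"
  unfolding proj_def by (intro ganalytic_intros ganalytic_udil)

lemma dvd_amod: "\<beta> \<in> box \<Longrightarrow> (\<forall>i. int m dvd int (\<alpha> i) - int (\<beta> i)) \<longleftrightarrow> amod \<alpha> = \<beta>"
proof -
  assume b: "\<beta> \<in> box"
  have "int m dvd int (\<alpha> i) - int (\<beta> i) \<longleftrightarrow> \<alpha> i mod m = \<beta> i" for i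
  proof -
    have "int m dvd int (\<alpha> i) - int (\<beta> i) \<longleftrightarrow> int (\<alpha> i) mod int m = int (\<beta> i) mod int m" by (simp add: mod_eq_dvd_iff)
    also have "\<dots> \<longleftrightarrow> \<alpha> i mod m = \<beta> i mod m" by (simp add: zmod_int[symmetric])
    also have "\<beta> i mod m = \<beta> i" using b by (simp add: box_def)
    finally show ?thesis .
  qed
  then show ?thesis by (auto simp: amod_def)
qed

lemma coef_proj:
  assumes "ganalytic g" "\<beta> \<in> box"
  shows "coef (proj \<beta> g) \<alpha> = (if amod \<alpha> = \<beta> then coef g \<alpha> else 0)"
proof -
  have "coef (proj \<beta> g) \<alpha> = 1 / of_nat m ^ CARD('n) * (\<Sum>J\<in>index_box m. chr J (\<lambda>i. - int (\<beta> i)) * (chr J (int \<circ> \<alpha>) * coef g \<alpha>))"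
    unfolding proj_def using assms(1)
    by (simp add: coef_scale coef_sum ganalytic_udil ganalytic_scale ganalytic_sum coef_udil)
  also have "(\<Sum>J\<in>index_box m. chr J (\<lambda>i. - int (\<beta> i)) * (chr J (int \<circ> \<alpha>) * coef g \<alpha>)) =
     (\<Sum>J\<in>index_box m. chr J (\<lambda>i. int (\<alpha> i) - int (\<beta> i))) * coef g \<alpha>"
    unfolding sum_distrib_right
  proof (rule sum.cong)
    fix J :: "int^'n"
    have "chr J (\<lambda>i. int (\<alpha> i) - int (\<beta> i)) = chr J (\<lambda>i. - int (\<beta> i)) * chr J (int \<circ> \<alpha>)"
      using chr_add[of J "\<lambda>i. - int (\<beta> i)" "int \<circ> \<alpha>"] by simp
    then show "chr J (\<lambda>i. - int (\<beta> i)) * (chr J (int \<circ> \<alpha>) * coef g \<alpha>) = chr J (\<lambda>i. int (\<alpha> i) - int (\<beta> i)) * coef g \<alpha>"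
      by simp
  qed simp
  finally show ?thesis unfolding sum_chr dvd_amod[OF assms(2)] using m_nz by simp
qed

lemma chr_amod: "chr J (int \<circ> \<alpha>) = chr J (int \<circ> amod \<alpha>)"
  by (rule chr_cong) (simp add: amod_def zmod_int minus_mod_eq_mult_div)

section \<open>Closure properties of the solution space\<close>

abbreviation "sols \<equiv> (mellin_solutions m M :: 'n germ set)"

lemma sols_iff: "g \<in> sols \<longleftrightarrow> ganalytic g \<and> (\<forall>j \<alpha>. mellin_rec_at m M (coef g) j \<alpha>)"
  by (simp add: mellin_solutions_eq mellin_rec_iff)

lemma phi_sols: "phi \<in> sols"
  using phi(1) phi_rec by (simp add: sols_iff mellin_rec_iff)

text \<open>Both indices in an equation of the recursion lie in one residue class, so a factor
  depending only on the class passes through. Dilations, projections and scalar multiples are the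
  instances.\<close>

lemma sols_class_mult:
  assumes g: "g \<in> sols" and h: "ganalytic h" "\<And>\<alpha>. coef h \<alpha> = f (amod \<alpha>) * coef g \<alpha>"
  shows "h \<in> sols"
proof -
  have "coef h = (\<lambda>\<alpha>. f (amod \<alpha>) * coef g \<alpha>)" using h(2) by (rule ext)
  then show ?thesis using g h(1) unfolding sols_iff
    by (auto intro!: rec_class_mult[of "coef g" _ _ "\<lambda>\<alpha>. f (amod \<alpha>)"] simp: amod_add)
qed

lemma ganalytic_sols: "g \<in> sols \<Longrightarrow> ganalytic g"
  by (simp add: sols_iff)

lemma sols_udil: "g \<in> sols \<Longrightarrow> udil J g \<in> sols"
  by (rule sols_class_mult[of g _ "\<lambda>\<beta>. chr J (int \<circ> \<beta>)"])
     (simp_all only: ganalytic_sols ganalytic_udil coef_udil chr_amod[symmetric])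

lemma sols_proj: "g \<in> sols \<Longrightarrow> \<beta> \<in> box \<Longrightarrow> proj \<beta> g \<in> sols"
  by (rule sols_class_mult[of g _ "\<lambda>\<gamma>. if \<gamma> = \<beta> then 1 else 0"])
     (auto simp: sols_iff ganalytic_proj coef_proj)

lemma sols_scale: "g \<in> sols \<Longrightarrow> scale_germ c g \<in> sols"
  by (rule sols_class_mult[of g _ "\<lambda>_. c"]) (auto simp: sols_iff ganalytic_scale coef_scale)

lemma sols_add: "g \<in> sols \<Longrightarrow> h \<in> sols \<Longrightarrow> g + h \<in> sols"
proof -
  assume g: "g \<in> sols" "h \<in> sols"
  then have "coef (g + h) = (\<lambda>\<alpha>. coef g \<alpha> + coef h \<alpha>)" by (intro ext) (simp add: coef_add sols_iff)
  with g show ?thesis by (auto simp: sols_iff ganalytic_add intro!: rec_add)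
qed

lemma sols_0: "0 \<in> sols"
  using sols_scale[OF phi_sols, of 0] by simp

lemma subspace_sols: "germ.subspace sols"
  by (auto simp: germ.subspace_def sols_0 sols_add sols_scale)

lemma sols_eqI:
  assumes "g \<in> sols" "h \<in> sols" "\<And>\<beta>. \<beta> \<in> box \<Longrightarrow> coef g \<beta> = coef h \<beta>"
  shows "g = h"
  by (rule coef_eqI) (use assms rec_determined[of _ "coef g" "coef h"] amod_box in \<open>auto simp: sols_iff\<close>)

definition NR :: "('n \<Rightarrow> nat) set" where "NR = {\<beta>\<in>box. \<not> regular \<beta>}"

lemma finite_box: "finite box" and card_box: "card box = m ^ CARD('n)"
proof -
  have b: "box = PiE UNIV (\<lambda>_. {..<m})" by (auto simp: box_def PiE_UNIV_domain)
  show "finite box" unfolding b by (rule finite_PiE) auto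
  show "card box = m ^ CARD('n)" unfolding b by (simp add: card_PiE)
qed

definition phiB :: "('n \<Rightarrow> nat) \<Rightarrow> 'n germ" where "phiB \<beta> = proj \<beta> phi"

lemma phiB_sols: "\<beta> \<in> box \<Longrightarrow> phiB \<beta> \<in> sols"
  unfolding phiB_def by (intro sols_proj phi_sols)

lemma coef_phiB: "\<beta> \<in> box \<Longrightarrow> coef (phiB \<beta>) \<alpha> = (if amod \<alpha> = \<beta> then coef phi \<alpha> else 0)"
  unfolding phiB_def by (rule coef_proj[OF phi(1)])

lemma phiB_independent: "inj_on phiB NR" "germ.independent (phiB ` NR)"
proof -
  have fin: "finite NR" using finite_box by (simp add: NR_def)
  have 1: "ganalytic (phiB b)" if "b \<in> NR" for b using that phiB_sols ganalytic_sols by (auto simp: NR_def)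
  have 2: "coef (phiB b) b \<noteq> 0" if "b \<in> NR" for b using that by (auto simp: NR_def coef_phiB amod_id coef_phi_eq_0_iff)
  have 3: "coef (phiB b) b' = 0" if "b \<in> NR" "b' \<in> NR" "b \<noteq> b'" for b b' using that by (auto simp: NR_def coef_phiB amod_id)
  show "inj_on phiB NR" "germ.independent (phiB ` NR)"
    using germ_independent_diag[of NR phiB] fin 1 2 3 by blast+
qed

text \<open>Box coefficients determine a solution, and on the box the germs
  \<open>phiB \<beta>\<close> form a diagonal system with nonzero entries at \<open>NR\<close>.
  Membership in the root space is tested by this criterion from here on.\<close>

lemma span_phiB_iff: "g \<in> germ.span (phiB ` NR) \<longleftrightarrow> g \<in> sols \<and> (\<forall>\<beta>\<in>box. regular \<beta> \<longrightarrow> coef g \<beta> = 0)"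
proof
  assume "g \<in> germ.span (phiB ` NR)"
  then show "g \<in> sols \<and> (\<forall>\<beta>\<in>box. regular \<beta> \<longrightarrow> coef g \<beta> = 0)"
  proof (induction rule: germ.span_induct_alt)
    case base
    then show ?case by (simp add: sols_0 coef_0)
  next
    case (step c x y)
    then obtain \<beta> where b: "x = phiB \<beta>" "\<beta> \<in> box" "\<not> regular \<beta>" by (auto simp: NR_def)
    then have x: "x \<in> sols" by (simp add: phiB_sols)
    then have "coef (scale_germ c x + y) \<gamma> = c * coef x \<gamma> + coef y \<gamma>" for \<gamma>
      using step by (simp add: coef_add coef_scale ganalytic_scale ganalytic_sols)
    moreover have "coef x \<gamma> = 0" if "\<gamma> \<in> box" "regular \<gamma>" for \<gamma>
      using that b by (auto simp: coef_phiB amod_id)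
    ultimately show ?case using step x by (simp add: sols_add sols_scale)
  qed
next
  assume g: "g \<in> sols \<and> (\<forall>\<beta>\<in>box. regular \<beta> \<longrightarrow> coef g \<beta> = 0)"
  define h where "h = (\<Sum>\<beta>\<in>NR. scale_germ (coef g \<beta> / coef phi \<beta>) (phiB \<beta>))"
  have hs: "h \<in> germ.span (phiB ` NR)"
    unfolding h_def by (intro germ.span_sum germ.span_scale germ.span_base) auto
  have fin: "finite NR" using finite_box by (simp add: NR_def)
  have "g = h"
  proof (rule sols_eqI)
    show "g \<in> sols" using g by simp
    show "h \<in> sols" unfolding h_def
      by (intro germ.subspace_sum[OF subspace_sols] sols_scale phiB_sols) (simp add: NR_def)
    fix \<beta> assume b: "\<beta> \<in> box"
    have "coef h \<beta> = (\<Sum>\<gamma>\<in>NR. coef g \<gamma> / coef phi \<gamma> * coef (phiB \<gamma>) \<beta>)"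
      unfolding h_def by (subst coef_sum) (auto simp: NR_def coef_scale ganalytic_scale ganalytic_sols phiB_sols)
    also have "\<dots> = (\<Sum>\<gamma>\<in>NR. if \<gamma> = \<beta> then coef g \<beta> else 0)"
      by (rule sum.cong) (use b in \<open>auto simp: NR_def coef_phiB amod_id coef_phi_eq_0_iff\<close>)
    also have "\<dots> = coef g \<beta>" using fin g b by (auto simp: NR_def)
    finally show "coef g \<beta> = coef h \<beta>" ..
  qed
  then show "g \<in> germ.span (phiB ` NR)" using hs by simp
qed

text \<open>Substituting y = \<epsilon>^s z in the equation (I) multiplies the coefficient of x_j by
  \<epsilon>^(s m_j), so that \<open>rt I s\<close> becomes the root of (I) with value \<epsilon>^s
  at the origin. The shifted index is left unreduced, since only powers of \<epsilon> enter.\<close>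

definition shiftM :: "int^'n \<Rightarrow> nat \<Rightarrow> int^'n" where "shiftM I s = (\<chi> j. I $ j + int s * int (M j))"

definition rt :: "int^'n \<Rightarrow> nat \<Rightarrow> 'n germ" where
  "rt I s = scale_germ (om ^ s) (udil (shiftM I s) phi)"

lemma scale_power: "scale_germ c g ^ k = scale_germ (c ^ k) (g ^ k)"
  by (induction k) (simp_all add: scale_mult_left scale_mult_right mult_ac)

lemma root_germs_iff:
  "g \<in> root_germs m M I \<longleftrightarrow> ganalytic g \<and> g ^ m + (\<Sum>j\<in>UNIV. scale_germ (om powi (I $ j)) (gX j * g ^ M j)) - 1 = 0"
proof -
  have eq: "(\<forall>\<^sub>F x in nhds 0. f x ^ m + (\<Sum>j\<in>UNIV. om powi (I $ j) * x $ j * f x ^ M j) - 1 = 0) \<longleftrightarrow>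
    germ f ^ m + (\<Sum>j\<in>UNIV. scale_germ (om powi (I $ j)) (gX j * germ f ^ M j)) - 1 = 0" for f
  proof -
    have pw: "germ (\<lambda>x. f x ^ k) = germ f ^ k" for k
      by (induction k) (simp_all add: one_germ_def times_germ.abs_eq[symmetric])
    have "germ f ^ m + (\<Sum>j\<in>UNIV. scale_germ (om powi (I $ j)) (gX j * germ f ^ M j)) - 1 =
      germ (\<lambda>x. f x ^ m + (\<Sum>j\<in>UNIV. om powi (I $ j) * (x $ j * f x ^ M j)) - 1)"
      by (simp add: plus_germ.abs_eq[symmetric] minus_germ.abs_eq[symmetric] germ_sum scale_germ.abs_eq[symmetric]
          times_germ.abs_eq[symmetric] pw gX.abs_eq one_germ_def)
    also have "\<dots> = 0 \<longleftrightarrow> (\<forall>\<^sub>F x in nhds 0. f x ^ m + (\<Sum>j\<in>UNIV. om powi (I $ j) * (x $ j * f x ^ M j)) - 1 = 0)"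
      unfolding zero_germ_def germ.abs_eq_iff germ_eq_def ..
    finally show ?thesis by (simp add: mult.assoc)
  qed
  show ?thesis
  proof
    assume "g \<in> root_germs m M I"
    then show "ganalytic g \<and> g ^ m + (\<Sum>j\<in>UNIV. scale_germ (om powi (I $ j)) (gX j * g ^ M j)) - 1 = 0"
      unfolding root_germs_def eq by (auto simp: ganalytic.abs_eq)
  next
    obtain f where f: "g = germ f" by (rule germ_cases)
    assume "ganalytic g \<and> g ^ m + (\<Sum>j\<in>UNIV. scale_germ (om powi (I $ j)) (gX j * g ^ M j)) - 1 = 0"
    then show "g \<in> root_germs m M I"
      unfolding root_germs_def eq f by (auto simp: ganalytic.abs_eq)
  qed
qed

lemma ganalytic_rt: "ganalytic (rt I s)"
  unfolding rt_def by (intro ganalytic_scale ganalytic_udil phi)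

lemma rt_root: "rt I s \<in> root_germs m M I"
proof -
  define q where "q = udil (shiftM I s) phi"
  have r: "rt I s = scale_germ (om ^ s) q" by (simp add: rt_def q_def)
  have "udil (shiftM I s) (phi ^ m + (\<Sum>j\<in>UNIV. gX j * phi ^ M j)) = 1"
    unfolding phi(3) udil_def by (rule dil_1)
  then have q: "q ^ m + (\<Sum>j\<in>UNIV. scale_germ (om powi (shiftM I s $ j)) (gX j * q ^ M j)) = 1"
    by (simp add: q_def udil_def dil_add dil_sum dil_mult dil_power dil_X scale_mult_left)
  have "rt I s ^ m = q ^ m"
  proof -
    have "(om ^ s) ^ m = 1" using om_power_m by (metis power_commutes power_mult power_one mult.commute)
    then show ?thesis unfolding r scale_power by simp
  qed
  moreover have "scale_germ (om powi (I $ j)) (gX j * rt I s ^ M j) = scale_germ (om powi (shiftM I s $ j)) (gX j * q ^ M j)" for j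
  proof -
    have "om powi (shiftM I s $ j) = om powi (I $ j) * (om ^ s) ^ M j"
      unfolding shiftM_def by (simp add: power_int_add om_nonzero power_int_mult)
    then show ?thesis unfolding r scale_power by (simp add: scale_mult_right)
  qed
  ultimately show ?thesis unfolding root_germs_iff using q ganalytic_rt by simp
qed

lemma ev0_rt: "ev0 (rt I s) = om ^ s"
  by (simp add: rt_def udil_def ev0_simps phi)

text \<open>The quotient of \<open>F(x, f) - F(x, g)\<close> by \<open>f - g\<close> takes the value \<open>m f(0)\<^bsup>m - 1\<^esup>\<close> at the origin.\<close>

lemma root_unique:
  assumes f: "f \<in> root_germs m M I" and g: "g \<in> root_germs m M I" and e: "ev0 f = ev0 g"
  shows "f = g"
proof -
  define D where "D = (\<lambda>k. \<Sum>i<k. g ^ (k - Suc i) * f ^ i)"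
  define Q where "Q = D m + (\<Sum>j\<in>UNIV. scale_germ (om powi (I $ j)) (gX j * D (M j)))"
  have an: "ganalytic f" "ganalytic g" using f g by (simp_all add: root_germs_iff)
  have D: "f ^ k - g ^ k = (f - g) * D k" for k unfolding D_def by (rule power_diff_sumr2)
  have anQ: "ganalytic Q" unfolding Q_def D_def by (intro ganalytic_intros an)
  have "(f - g) * Q = (f ^ m + (\<Sum>j\<in>UNIV. scale_germ (om powi (I $ j)) (gX j * f ^ M j)) - 1)
     - (g ^ m + (\<Sum>j\<in>UNIV. scale_germ (om powi (I $ j)) (gX j * g ^ M j)) - 1)"
  proof -
    have "(\<Sum>j\<in>UNIV. scale_germ (om powi (I $ j)) (gX j * f ^ M j)) - (\<Sum>j\<in>UNIV. scale_germ (om powi (I $ j)) (gX j * g ^ M j))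
       = (\<Sum>j\<in>UNIV. (f - g) * scale_germ (om powi (I $ j)) (gX j * D (M j)))"
      unfolding sum_subtractf[symmetric]
    proof (rule sum.cong)
      fix j
      have "scale_germ (om powi (I $ j)) (gX j * f ^ M j) - scale_germ (om powi (I $ j)) (gX j * g ^ M j) =
        scale_germ (om powi (I $ j)) (gX j * (f ^ M j - g ^ M j))"
        by (simp add: right_diff_distrib germ.scale_right_diff_distrib)
      then show "scale_germ (om powi (I $ j)) (gX j * f ^ M j) - scale_germ (om powi (I $ j)) (gX j * g ^ M j) =
        (f - g) * scale_germ (om powi (I $ j)) (gX j * D (M j))"
        unfolding D by (simp add: scale_mult_right mult.left_commute)
    qed simp
    then show ?thesis unfolding Q_def distrib_left D[symmetric] sum_distrib_left by (simp add: algebra_simps)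
  qed
  then have "(f - g) * Q = 0"
    unfolding f[unfolded root_germs_iff, THEN conjunct2] g[unfolded root_germs_iff, THEN conjunct2] by simp
  then have "f - g = 0 \<or> Q = 0" by (intro ganalytic_no_zero_divisors ganalytic_diff an anQ)
  moreover have "Q \<noteq> 0"
  proof
    assume "Q = 0"
    then have "ev0 Q = 0" by (simp add: ev0_0)
    moreover have "ev0 Q = of_nat m * ev0 f ^ (m - 1)"
    proof -
      have "ev0 Q = (\<Sum>i<m. ev0 f ^ (m - Suc i) * ev0 f ^ i)"
        unfolding Q_def D_def by (simp add: ev0_simps e)
      also have "\<dots> = (\<Sum>i<m. ev0 f ^ (m - 1))"
        by (rule sum.cong) (simp_all add: power_add[symmetric])
      finally show ?thesis by simp
    qed
    moreover have "ev0 (f ^ m + (\<Sum>j\<in>UNIV. scale_germ (om powi (I $ j)) (gX j * f ^ M j)) - 1) = 0"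
      using f by (simp add: root_germs_iff ev0_0)
    then have "ev0 f ^ m = 1" by (simp add: ev0_simps)
    ultimately show False using m_pos by (auto simp: power_0_left)
  qed
  ultimately show "f = g" by simp
qed

lemma om_power_bij: "bij_betw (\<lambda>s. om ^ s) {..<m} {z. z ^ m = 1}"
proof -
  have "om ^ s = cis (2 * pi * real s / real m)" for s
    using om_powi[of "int s"] by (simp add: cis_conv_exp mult_ac)
  then show ?thesis using Complex.bij_betw_roots_unity[OF m_pos] by simp
qed

text \<open>At the origin every root takes an m-th root of unity as its value, this value determines
  the root, and \<open>rt I s\<close> realizes \<epsilon>^s.\<close>

lemma root_germs_eq: "root_germs m M I = rt I ` {..<m}" and inj_rt: "inj_on (rt I) {..<m}"
proof -
  show "inj_on (rt I) {..<m}"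
  proof (rule inj_onI)
    fix s t assume st: "s \<in> {..<m}" "t \<in> {..<m}" and "rt I s = rt I t"
    then have "om ^ s = om ^ t" using ev0_rt[of I s] ev0_rt[of I t] by simp
    then show "s = t" using inj_onD[OF bij_betw_imp_inj_on[OF om_power_bij]] st by blast
  qed
  show "root_germs m M I = rt I ` {..<m}"
  proof
    show "rt I ` {..<m} \<subseteq> root_germs m M I" using rt_root by auto
    show "root_germs m M I \<subseteq> rt I ` {..<m}"
    proof
      fix f assume f: "f \<in> root_germs m M I"
      then have "ev0 (f ^ m + (\<Sum>j\<in>UNIV. scale_germ (om powi (I $ j)) (gX j * f ^ M j)) - 1) = 0"
        by (simp add: root_germs_iff ev0_0)
      then have "ev0 f \<in> {z. z ^ m = 1}" by (simp add: ev0_simps)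
      then obtain s where s: "s < m" "ev0 f = om ^ s"
        using om_power_bij unfolding bij_betw_def by blast
      have "f = rt I s" by (rule root_unique[OF f rt_root]) (simp add: s ev0_rt)
      then show "f \<in> rt I ` {..<m}" using s by blast
    qed
  qed
qed

lemma rt_sols: "rt I s \<in> sols"
  unfolding rt_def by (intro sols_scale sols_udil phi_sols)

lemma coef_rt: "coef (rt I s) \<alpha> = om ^ s * (chr (shiftM I s) (int \<circ> \<alpha>) * coef phi \<alpha>)"
  unfolding rt_def by (simp add: coef_scale coef_udil ganalytic_udil phi)

text \<open>The dilates \<open>udil J phi\<close> are the roots \<open>rt J 0\<close>, and
  \<open>phiB\<close> averages them. Conversely, a root has the coefficients of \<open>phi\<close>
  up to nonzero factors, so it has none at regular indices.\<close>

lemma root_space_eq: "root_space m M = germ.span (phiB ` NR)"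
proof
  show "root_space m M \<subseteq> germ.span (phiB ` NR)"
    unfolding root_space_def
  proof (rule germ.span_minimal)
    show "(\<Union>I\<in>index_box m. root_germs m M I) \<subseteq> germ.span (phiB ` NR)"
      by (auto simp: root_germs_eq span_phiB_iff rt_sols coef_rt coef_phi_eq_0_iff)
  qed (rule germ.subspace_span)
  show "germ.span (phiB ` NR) \<subseteq> root_space m M"
    unfolding root_space_def
  proof (rule germ.span_minimal)
    have "udil J phi \<in> germ.span (\<Union>I\<in>index_box m. root_germs m M I)" if "J \<in> index_box m" for J
    proof -
      have "rt J 0 = udil J phi" by (simp add: rt_def shiftM_def)
      then show ?thesis using that rt_root[of J 0] by (intro germ.span_base) auto
    qed
    then show "phiB ` NR \<subseteq> germ.span (\<Union>I\<in>index_box m. root_germs m M I)"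
      unfolding phiB_def proj_def by (auto intro!: germ.span_scale germ.span_sum)
  qed (rule germ.subspace_span)
qed

lemma dim_root_space: "germ.dim (root_space m M) = card NR"
proof -
  have "germ.dim (root_space m M) = card (phiB ` NR)"
    unfolding root_space_eq germ.dim_span by (rule germ.dim_eq_card_independent[OF phiB_independent(2)])
  also have "\<dots> = card NR" by (rule card_image[OF phiB_independent(1)])
  finally show ?thesis .
qed

end

section \<open>Algebraic germs\<close>

text \<open>Algebraicity inside the ring of germs. \<open>S\<close> is any finite set of exponents
  on which \<open>p\<close> is not identically zero, the form in which linear dependence delivers
  relations.\<close>

definition galg :: "'n::finite germ \<Rightarrow> bool" where
  "galg g \<longleftrightarrow> (\<exists>S p. finite S \<and> (\<exists>x\<in>S. p x \<noteq> 0) \<and>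
     (\<Sum>x\<in>S. scale_germ (p x) (gmon (fst x) * g ^ snd x)) = 0)"

lemma germ_power: "germ (\<lambda>x. f x ^ k) = germ f ^ k"
  by (induction k) (simp_all add: one_germ_def times_germ.abs_eq[symmetric])

lemma germ_prod: "germ (\<lambda>x. \<Prod>i\<in>A. f i x) = (\<Prod>i\<in>A. germ (f i))"
  by (induction A rule: infinite_finite_induct)
     (simp_all add: one_germ_def times_germ.abs_eq[symmetric])

lemma gmon_germ: "gmon a = germ (\<lambda>x. \<Prod>i\<in>UNIV. (x $ i) ^ a i)"
  by (simp add: gmon_def germ_prod germ_power gX.abs_eq)

lemma germ_poly:
  "germ (\<lambda>x. \<Sum>(a, k)\<in>S. p a k * (\<Prod>i\<in>UNIV. (x $ i) ^ a i) * f x ^ k) =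
   (\<Sum>x\<in>S. scale_germ (p (fst x) (snd x)) (gmon (fst x) * germ f ^ snd x))"
  unfolding split_beta germ_sum
  by (rule sum.cong) (simp_all add: gmon_germ scale_germ.abs_eq times_germ.abs_eq germ_power[symmetric] mult.assoc)

lemma algebraic_germs_iff: "g \<in> algebraic_germs \<longleftrightarrow> galg g"
proof
  assume "g \<in> algebraic_germs"
  then obtain f p where g: "g = germ f" and p: "finite {(a, k). p a k \<noteq> 0}" "{(a, k). p a k \<noteq> 0} \<noteq> {}"
    "\<forall>\<^sub>F x in nhds 0. (\<Sum>(a, k)\<in>{(a, k). p a k \<noteq> 0}. p a k * (\<Prod>i\<in>UNIV. (x $ i) ^ a i) * f x ^ k) = 0"
    unfolding algebraic_germs_def algebraic_near_0_def by auto
  have "germ (\<lambda>x. \<Sum>(a, k)\<in>{(a, k). p a k \<noteq> 0}. p a k * (\<Prod>i\<in>UNIV. (x $ i) ^ a i) * f x ^ k) = 0"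
    using p(3) unfolding zero_germ_def germ.abs_eq_iff germ_eq_def .
  then show "galg g" unfolding galg_def g germ_poly
    using p(1,2) by (intro exI[of _ "{(a, k). p a k \<noteq> 0}"] exI[of _ "\<lambda>x. p (fst x) (snd x)"]) auto
next
  assume "galg g"
  then obtain S p where S: "finite S" "\<exists>x\<in>S. p x \<noteq> 0" "(\<Sum>x\<in>S. scale_germ (p x) (gmon (fst x) * g ^ snd x)) = 0"
    unfolding galg_def by auto
  obtain f where f: "g = germ f" by (rule germ_cases)
  define q where "q a k = (if (a, k) \<in> S then p (a, k) else 0)" for a k
  define S' where "S' = {(a, k). q a k \<noteq> 0}"
  have sub: "S' \<subseteq> S" by (auto simp: S'_def q_def split: if_splits)
  have "(\<Sum>x\<in>S'. scale_germ (q (fst x) (snd x)) (gmon (fst x) * germ f ^ snd x)) =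
        (\<Sum>x\<in>S. scale_germ (p x) (gmon (fst x) * g ^ snd x))"
    using S(1) sub by (intro sum.mono_neutral_cong_left) (auto simp: S'_def q_def f)
  then have "germ (\<lambda>x. \<Sum>(a, k)\<in>S'. q a k * (\<Prod>i\<in>UNIV. (x $ i) ^ a i) * f x ^ k) = 0"
    unfolding germ_poly S(3) .
  then have "\<forall>\<^sub>F x in nhds 0. (\<Sum>(a, k)\<in>S'. q a k * (\<Prod>i\<in>UNIV. (x $ i) ^ a i) * f x ^ k) = 0"
    unfolding zero_germ_def germ.abs_eq_iff germ_eq_def .
  moreover have "finite S'" using sub S(1) by (rule finite_subset)
  moreover have "S' \<noteq> {}" using S(2) by (auto simp: S'_def q_def)
  ultimately have "algebraic_near_0 f" unfolding algebraic_near_0_def S'_def by blast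
  then show "g \<in> algebraic_germs" unfolding algebraic_germs_def f by blast
qed

text \<open>Two equal members of the family already give a relation; otherwise the image has more
  elements than the spanning set.\<close>

lemma germ_relation_exists:
  fixes u :: "'i \<Rightarrow> 'n::finite germ"
  assumes A: "finite A" and B: "finite B" "card B < card A" and u: "\<And>i. i \<in> A \<Longrightarrow> u i \<in> germ.span B"
  shows "\<exists>c. (\<exists>i\<in>A. c i \<noteq> 0) \<and> (\<Sum>i\<in>A. scale_germ (c i) (u i)) = 0"
proof (cases "inj_on u A")
  case True
  have "germ.dependent (u ` A)"
  proof (rule ccontr)
    assume "germ.independent (u ` A)"
    then have "card (u ` A) \<le> card B" using germ.independent_span_bound[OF B(1)] u by blast
    then show False using B(2) card_image[OF True] by simp
  qed
  then obtain w where w: "\<exists>v\<in>u ` A. w v \<noteq> 0" "(\<Sum>v\<in>u ` A. scale_germ (w v) v) = 0"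
    using A by (auto simp: germ.dependent_finite)
  then show ?thesis by (intro exI[of _ "w \<circ> u"]) (auto simp: sum.reindex[OF True])
next
  case False
  then obtain i j where ij: "i \<in> A" "j \<in> A" "i \<noteq> j" "u i = u j" by (auto simp: inj_on_def)
  let ?c = "\<lambda>l. if l = i then 1 else if l = j then - 1 else 0 :: complex"
  have "(\<Sum>l\<in>A. scale_germ (?c l) (u l)) = (\<Sum>l\<in>{i, j}. scale_germ (?c l) (u l))"
    using A ij by (intro sum.mono_neutral_right) auto
  also have "\<dots> = 0" using ij by simp
  finally show ?thesis using ij by (intro exI[of _ ?c]) auto
qed

lemma span_mult:
  fixes x y :: "'n::finite germ"
  assumes x: "x \<in> germ.span A" and y: "y \<in> germ.span B" and ab: "\<And>a b. a \<in> A \<Longrightarrow> b \<in> B \<Longrightarrow> a * b \<in> germ.span C"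
  shows "x * y \<in> germ.span C"
proof -
  have 1: "a * y \<in> germ.span C" if a: "a \<in> A" for a
    using y
  proof (rule germ.span_induct[where P = "\<lambda>y. a * y \<in> germ.span C"])
    show "germ.subspace {y. a * y \<in> germ.span C}"
      by (auto simp: germ.subspace_def germ.span_zero distrib_left germ.span_add scale_mult_right germ.span_scale)
  qed (rule ab[OF a])
  from x show ?thesis
  proof (rule germ.span_induct[where P = "\<lambda>x. x * y \<in> germ.span C"])
    show "germ.subspace {x. x * y \<in> germ.span C}"
      by (auto simp: germ.subspace_def germ.span_zero distrib_right germ.span_add scale_mult_left germ.span_scale)
  qed (rule 1)
qed

section \<open>Polynomial germs and their degrees\<close>

definition polys :: "'n::finite germ set" where "polys = germ.span (range gmon)"

definition polys_le :: "nat \<Rightarrow> 'n::finite germ set" where "polys_le D = germ.span (gmon ` {a. \<forall>i. a i \<le> D})"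

lemma polys_le_mono: "D \<le> D' \<Longrightarrow> polys_le D \<subseteq> polys_le D'"
  unfolding polys_le_def by (intro germ.span_mono image_mono) (auto intro: order_trans)

lemma polys_le_ex: "x \<in> polys \<Longrightarrow> \<exists>D. x \<in> polys_le D"
  unfolding polys_def
proof (induction rule: germ.span_induct_alt)
  case base
  then show ?case by (auto simp: polys_le_def germ.span_zero)
next
  case (step c x y)
  then obtain a D where a: "x = gmon a" and D: "y \<in> polys_le D" by auto
  define D' where "D' = max D (Max (range a))"
  have "a i \<le> D'" for i unfolding D'_def by (rule max.coboundedI2) simp
  then have "x \<in> polys_le D'" unfolding polys_le_def a by (intro germ.span_base) auto
  moreover have "y \<in> polys_le D'" using D polys_le_mono[of D D'] by (auto simp: D'_def)
  ultimately have "scale_germ c x + y \<in> polys_le D'"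
    unfolding polys_le_def by (intro germ.span_add germ.span_scale)
  then show ?case ..
qed

lemma polys_mult: "x \<in> polys \<Longrightarrow> y \<in> polys \<Longrightarrow> x * y \<in> polys"
  unfolding polys_def by (erule (1) span_mult) (auto simp: gmon_add[symmetric] intro!: germ.span_base)

lemma gmon_polys: "gmon a \<in> polys"
  unfolding polys_def by (rule germ.span_base) simp

lemma one_polys: "1 \<in> polys"
  using gmon_polys[of "\<lambda>_. 0"] by (simp add: gmon_0)

lemma X_polys: "gX j \<in> polys"
  using gmon_polys[of "(\<lambda>_. 0)(j := Suc 0)"] gmon_Suc[of "\<lambda>_. 0" j] by (simp add: gmon_0)

lemma polys_scale: "x \<in> polys \<Longrightarrow> scale_germ c x \<in> polys"
  unfolding polys_def by (rule germ.span_scale)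

lemma polys_diff: "x \<in> polys \<Longrightarrow> y \<in> polys \<Longrightarrow> x - y \<in> polys"
  unfolding polys_def by (rule germ.span_diff)

lemma polys_uminus: "x \<in> polys \<Longrightarrow> - x \<in> polys"
  unfolding polys_def by (rule germ.span_neg)

lemma polys_0: "0 \<in> polys"
  unfolding polys_def by (rule germ.span_zero)

lemma polys_sum: "(\<And>i. i \<in> A \<Longrightarrow> F i \<in> polys) \<Longrightarrow> (\<Sum>i\<in>A. F i) \<in> polys"
  unfolding polys_def by (rule germ.span_sum)

lemma polys_prod: "(\<And>i. i \<in> A \<Longrightarrow> F i \<in> polys) \<Longrightarrow> (\<Prod>i\<in>A. F i) \<in> polys"
  by (induction A rule: infinite_finite_induct) (auto simp: one_polys polys_mult)

lemma polys_power: "x \<in> polys \<Longrightarrow> x ^ k \<in> polys"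
  by (induction k) (auto simp: one_polys polys_mult)

lemma ganalytic_polys: "x \<in> polys \<Longrightarrow> ganalytic x"
  unfolding polys_def
  by (induction rule: germ.span_induct_alt) (auto intro!: ganalytic_intros ganalytic_gmon)

text \<open>For fixed X the quotient (D + X + 1)^n / (D + 1)^n tends to 1, so it drops below (T + 1)
  / T. This provides the degree at which a family of germs outnumbers the generators of the space
  containing it.\<close>

lemma counting_exponent: "\<exists>D::nat. (D + X + 1) ^ n * T < (D + 1) ^ n * (T + 1)"
proof (cases "T = 0")
  case True
  then show ?thesis by (intro exI[of _ 0]) simp
next
  case False
  have "(\<lambda>D. (1 + real X * inverse (real (Suc D))) ^ n) \<longlonglongrightarrow> (1 + real X * 0) ^ n"
    by (intro tendsto_intros LIMSEQ_inverse_real_of_nat)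
  moreover have "(1 + real X * 0) ^ n < (real T + 1) / real T" using False by simp
  ultimately have "\<forall>\<^sub>F D in sequentially. (1 + real X * inverse (real (Suc D))) ^ n < (real T + 1) / real T"
    by (rule order_tendstoD(2))
  then obtain D where "(1 + real X * inverse (real (Suc D))) ^ n < (real T + 1) / real T"
    by (auto simp: eventually_sequentially)
  moreover have "1 + real X * inverse (real (Suc D)) = real (D + X + 1) / real (D + 1)"
    by (simp add: field_simps)
  ultimately have "real (D + X + 1) ^ n / real (D + 1) ^ n < (real T + 1) / real T" by (simp only: power_divide)
  then have "real (D + X + 1) ^ n * real T < real (D + 1) ^ n * (real T + 1)"
    using False by (simp add: divide_less_eq less_divide_eq mult_ac del: of_nat_add of_nat_Suc)
  then have "real ((D + X + 1) ^ n * T) < real ((D + 1) ^ n * (T + 1))"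
    by (simp only: of_nat_mult of_nat_power of_nat_add of_nat_1)
  then show ?thesis unfolding of_nat_less_iff by blast
qed

lemma card_le_box: "finite {a :: 'n::finite \<Rightarrow> nat. \<forall>i. a i \<le> D}" "card {a :: 'n::finite \<Rightarrow> nat. \<forall>i. a i \<le> D} = (D + 1) ^ CARD('n)"
proof -
  have b: "{a :: 'n \<Rightarrow> nat. \<forall>i. a i \<le> D} = PiE UNIV (\<lambda>_. {..D})" by (auto simp: PiE_UNIV_domain)
  show "finite {a :: 'n::finite \<Rightarrow> nat. \<forall>i. a i \<le> D}" unfolding b by (rule finite_PiE) auto
  show "card {a :: 'n::finite \<Rightarrow> nat. \<forall>i. a i \<le> D} = (D + 1) ^ CARD('n)" unfolding b by (simp add: card_PiE)
qed

text \<open>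
  The module spanned by the monomials \<open>x\<^sup>a \<Prod>\<^bsub>f \<in> F\<^esub> f\<^bsup>k f\<^esup>\<close> with \<open>k f < K\<close> is stable under multiplication
  by \<open>F\<close>, and multiplication raises the degree in \<open>x\<close> only by a bounded amount. Hence for \<open>T = K\<^bsup>|F|\<^esup>\<close> and large
  \<open>D\<close> the germs \<open>L\<^sup>T x\<^sup>a g\<^sup>e\<close>, \<open>a \<le> D\<close>, \<open>e \<le> T\<close>, are too numerous to be linearly independent.
\<close>

lemma integral_combination_algebraic:
  fixes F :: "'n::finite germ set"
  assumes F: "finite F" and K: "K \<ge> 1"
    and rel: "\<And>f. f \<in> F \<Longrightarrow> f ^ K = (\<Sum>k<K. C f k * f ^ k)" and C: "\<And>f k. f \<in> F \<Longrightarrow> k < K \<Longrightarrow> C f k \<in> polys"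
    and L: "L \<in> polys" "L \<noteq> 0" and g: "ganalytic g" and Lg: "L * g \<in> germ.span F"
  shows "galg g"
proof -
  have "finite (insert L ((\<lambda>(f, k). C f k) ` (F \<times> {..<K})))" using F by simp
  moreover have "\<forall>x\<in>insert L ((\<lambda>(f, k). C f k) ` (F \<times> {..<K})). \<exists>D. x \<in> polys_le D" using C L polys_le_ex by auto
  ultimately have "\<exists>D0. \<forall>x\<in>insert L ((\<lambda>(f, k). C f k) ` (F \<times> {..<K})). x \<in> polys_le D0"
  proof (induction rule: finite_induct)
    case (insert x Q)
    then obtain D D' where "x \<in> polys_le D" "\<forall>x\<in>Q. x \<in> polys_le D'" by auto
    then show ?case using polys_le_mono[of D "max D D'"] polys_le_mono[of D' "max D D'"]
      by (intro exI[of _ "max D D'"]) auto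
  qed simp
  then obtain D0 where D0: "L \<in> polys_le D0" "\<And>f k. f \<in> F \<Longrightarrow> k < K \<Longrightarrow> C f k \<in> polys_le D0" by auto
  define G where "G D = (\<lambda>(a, k). gmon a * (\<Prod>f\<in>F. f ^ k f)) ` ({a :: 'n \<Rightarrow> nat. \<forall>i. a i \<le> D} \<times> PiE F (\<lambda>_. {..<K}))" for D
  define E where "E D = germ.span (G D)" for D
  have GI: "gmon a * (\<Prod>f\<in>F. f ^ k f) \<in> G D" if "\<And>i. a i \<le> D" "k \<in> PiE F (\<lambda>_. {..<K})" for a k D
    unfolding G_def using that by (intro image_eqI[of _ _ "(a, k)"]) auto
  have G_mono: "E D \<subseteq> E D'" if "D \<le> D'" for D D'
    unfolding E_def G_def using that by (intro germ.span_mono image_mono) (auto intro: order_trans)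
  have PE: "p * x \<in> E (D + D')" if "p \<in> polys_le D'" "x \<in> E D" for p x D D'
    using that unfolding polys_le_def E_def
  proof (rule span_mult)
    fix a b :: "'n germ" assume "a \<in> gmon ` {a. \<forall>i. a i \<le> D'}" "b \<in> G D"
    then obtain a' b' k where a: "a = gmon a'" "\<forall>i. a' i \<le> D'" and b: "b = gmon b' * (\<Prod>f\<in>F. f ^ k f)" "\<forall>i. b' i \<le> D" "k \<in> PiE F (\<lambda>_. {..<K})"
      unfolding G_def by auto
    have "a * b = gmon (\<lambda>i. a' i + b' i) * (\<Prod>f\<in>F. f ^ k f)" by (simp add: a b gmon_add mult.assoc)
    moreover have "a' i + b' i \<le> D + D'" for i using a(2)[rule_format, of i] b(2)[rule_format, of i] by simp
    ultimately show "a * b \<in> germ.span (G (D + D'))"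
      using GI[OF _ b(3), of "\<lambda>i. a' i + b' i" "D + D'"] germ.span_base by simp
  qed
  have fG: "f * x \<in> E (D + D0)" if f: "f \<in> F" and x: "x \<in> G D" for f x D
  proof -
    obtain a k where xa: "x = gmon a * (\<Prod>f\<in>F. f ^ k f)" "\<forall>i. a i \<le> D" "k \<in> PiE F (\<lambda>_. {..<K})"
      using x unfolding G_def by auto
    define R where "R = (\<Prod>f'\<in>F - {f}. f' ^ k f')"
    have upd: "(\<Prod>f'\<in>F. f' ^ (k(f := l)) f') = f ^ l * R" for l
      unfolding R_def using f F by (simp add: prod.remove[of F f])
    have gen: "gmon a * (f ^ l * R) \<in> E D" if "l < K" for l
    proof -
      have "k(f := l) \<in> PiE F (\<lambda>_. {..<K})" using xa(3) f that by (auto simp: PiE_def extensional_def)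
      from GI[OF _ this] show ?thesis unfolding E_def upd[symmetric] using xa(2) by (intro germ.span_base) simp
    qed
    have kf: "k f < K" using xa(3) f by auto
    have fx: "f * x = gmon a * (f ^ Suc (k f) * R)"
      using upd[of "k f"] unfolding xa(1) by (simp add: mult_ac)
    show ?thesis
    proof (cases "Suc (k f) < K")
      case True
      from subsetD[OF G_mono gen[OF this]] show ?thesis unfolding fx by simp
    next
      case False
      then have "Suc (k f) = K" using kf by simp
      then have "f * x = gmon a * ((\<Sum>l<K. C f l * f ^ l) * R)"
        unfolding fx by (simp only: rel[OF f])
      also have "\<dots> = (\<Sum>l<K. C f l * (gmon a * (f ^ l * R)))"
        unfolding sum_distrib_left sum_distrib_right by (rule sum.cong) (simp_all add: mult_ac)
      also have "\<dots> \<in> E (D + D0)"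
        unfolding E_def by (rule germ.span_sum) (use PE[OF D0(2)[OF f] gen] in \<open>simp add: E_def\<close>)
      finally show ?thesis .
    qed
  qed
  have hE: "(L * g) * x \<in> E (D + D0)" if "x \<in> E D" for x D
    using Lg that unfolding E_def by (rule span_mult) (rule fG[unfolded E_def])
  have hE': "(L * g) ^ e * x \<in> E (D + e * D0)" if "x \<in> E D" for x D e
    using that
  proof (induction e)
    case (Suc e)
    have "(L * g) ^ Suc e * x = (L * g) * ((L * g) ^ e * x)" "D + Suc e * D0 = (D + e * D0) + D0" by (simp_all add: mult.assoc)
    then show ?case using hE[OF Suc.IH[OF Suc.prems]] by (simp only:)
  qed simp
  have LE': "L ^ e * x \<in> E (D + e * D0)" if "x \<in> E D" for x D e
    using that
  proof (induction e)
    case (Suc e)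
    have "L ^ Suc e * x = L * (L ^ e * x)" "D + Suc e * D0 = (D + e * D0) + D0" by (simp_all add: mult.assoc)
    then show ?case using PE[OF D0(1) Suc.IH[OF Suc.prems]] by (simp only:)
  qed simp
  define T where "T = K ^ card F"
  obtain D where D: "(D + T * D0 + 1) ^ CARD('n) * T < (D + 1) ^ CARD('n) * (T + 1)" using counting_exponent by blast
  define S where "S = {a :: 'n \<Rightarrow> nat. \<forall>i. a i \<le> D} \<times> {..T}"
  \<comment> \<open>The same power \<open>L ^ T\<close> is used for all e \<le> T: e of the factors
    clear the denominator of g^e, and the common power can be cancelled from the relation
    obtained.\<close>
  define u where "u = (\<lambda>x :: ('n \<Rightarrow> nat) \<times> nat. L ^ T * (gmon (fst x) * g ^ snd x))"
  have "u x \<in> E (D + T * D0)" if "x \<in> S" for x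
  proof -
    obtain a e where x: "x = (a, e)" "\<forall>i. a i \<le> D" "e \<le> T" using \<open>x \<in> S\<close> by (cases x) (auto simp: S_def)
    have "(\<lambda>f\<in>F. 0) \<in> PiE F (\<lambda>_. {..<K})" using K by auto
    moreover have "(\<Prod>f\<in>F. f ^ (\<lambda>f\<in>F. 0) f) = 1" by simp
    ultimately have "gmon a \<in> E D" using x(2) GI[of a D "\<lambda>f\<in>F. 0"] unfolding E_def by (intro germ.span_base) simp
    then have "(L * g) ^ e * (L ^ (T - e) * gmon a) \<in> E ((D + (T - e) * D0) + e * D0)" by (intro hE' LE')
    moreover have "(L * g) ^ e * (L ^ (T - e) * gmon a) = (L ^ e * L ^ (T - e)) * (gmon a * g ^ e)"
      by (simp add: power_mult_distrib mult_ac)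
    moreover have "L ^ e * L ^ (T - e) = L ^ T" using x(3) by (simp add: power_add[symmetric])
    moreover have "(D + (T - e) * D0) + e * D0 = D + T * D0" using x(3) by (simp add: add_mult_distrib[symmetric])
    ultimately show ?thesis by (simp add: u_def x)
  qed
  moreover have "finite S" unfolding S_def using card_le_box(1) by blast
  moreover have "finite (G (D + T * D0))" unfolding G_def using card_le_box(1) F by (intro finite_imageI finite_cartesian_product finite_PiE) auto
  moreover have "card (G (D + T * D0)) < card S"
  proof -
    have "card (G (D + T * D0)) \<le> card ({a :: 'n \<Rightarrow> nat. \<forall>i. a i \<le> D + T * D0} \<times> PiE F (\<lambda>_. {..<K}))"
      unfolding G_def using card_le_box(1) F by (intro card_image_le finite_cartesian_product finite_PiE) auto
    also have "\<dots> = (D + T * D0 + 1) ^ CARD('n) * T"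
      unfolding card_cartesian_product card_le_box(2) T_def using F by (simp add: card_PiE)
    also have "\<dots> < card S" unfolding S_def card_cartesian_product card_le_box(2) using D by simp
    finally show ?thesis .
  qed
  ultimately obtain c where c: "\<exists>x\<in>S. c x \<noteq> 0" "(\<Sum>x\<in>S. scale_germ (c x) (u x)) = 0"
    using germ_relation_exists[of S "G (D + T * D0)" u] unfolding E_def by blast
  define H where "H = (\<Sum>x\<in>S. scale_germ (c x) (gmon (fst x) * g ^ snd x))"
  have "L ^ T * H = 0" using c(2) by (simp add: H_def u_def sum_distrib_left scale_mult_right)
  moreover have anH: "ganalytic H" unfolding H_def by (intro ganalytic_intros ganalytic_gmon g)
  have "H = 0" if "L ^ e * H = 0" for e
    using that
  proof (induction e)
    case (Suc e)
    have "L * (L ^ e * H) = 0" using Suc.prems by (simp add: mult.assoc)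
    moreover have "ganalytic (L ^ e * H)" by (intro ganalytic_intros ganalytic_polys[OF L(1)] anH)
    ultimately have "L ^ e * H = 0" using ganalytic_no_zero_divisors[OF ganalytic_polys[OF L(1)]] L(2) by blast
    then show ?case by (rule Suc.IH)
  qed simp
  ultimately have "H = 0" by blast
  then show ?thesis unfolding galg_def H_def using \<open>finite S\<close> c(1) by blast
qed

text \<open>Monomials with the same power of g are collected, and K is the largest power with a
  nonzero coefficient; the leading coefficient serves as denominator in
  \<open>galg_proj\<close>.\<close>

lemma galg_relation:
  assumes "galg g"
  obtains c K where "\<And>k. c k \<in> polys" "c K \<noteq> 0" "(\<Sum>k\<le>K. c k * g ^ k) = 0"
proof -
  obtain S p where S: "finite S" "\<exists>x\<in>S. p x \<noteq> 0" "(\<Sum>x\<in>S. scale_germ (p x) (gmon (fst x) * g ^ snd x)) = 0"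
    using assms unfolding galg_def by auto
  define c where "c k = (\<Sum>x\<in>{x\<in>S. snd x = k}. scale_germ (p x) (gmon (fst x)))" for k
  have cp: "c k \<in> polys" for k unfolding c_def by (intro polys_sum polys_scale gmon_polys)
  have cz: "c k = 0" if "k \<notin> snd ` S" for k
    unfolding c_def using that by (intro sum.neutral) force
  obtain a0 k0 where x0: "(a0, k0) \<in> S" "p (a0, k0) \<noteq> 0" using S(2) by auto
  have "coef (c k0) a0 = (\<Sum>x\<in>{x\<in>S. snd x = k0}. p x * (if a0 = fst x then 1 else 0))"
    unfolding c_def by (subst coef_sum) (auto intro!: ganalytic_scale ganalytic_gmon simp: coef_scale ganalytic_gmon coef_gmon)
  also have "\<dots> = (\<Sum>x\<in>{(a0, k0)}. p x * (if a0 = fst x then 1 else 0))"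
    using S(1) x0 by (intro sum.mono_neutral_right) auto
  finally have "c k0 \<noteq> 0" using x0 by (auto simp: coef_0)
  define N where "N = {k. c k \<noteq> 0}"
  have Nsub: "N \<subseteq> snd ` S" unfolding N_def using cz by blast
  have fS: "finite (snd ` S)" using S(1) by (rule finite_imageI)
  have fN: "finite N" by (rule finite_subset[OF Nsub fS])
  have N0: "k0 \<in> N" using \<open>c k0 \<noteq> 0\<close> by (simp add: N_def)
  define K where "K = Max N"
  have KN: "K \<in> N" unfolding K_def using fN N0 by (intro Max_in) auto
  have "(\<Sum>k\<le>K. c k * g ^ k) = (\<Sum>k\<in>N. c k * g ^ k)"
    using fN by (intro sum.mono_neutral_right) (auto simp: K_def N_def)
  also have "\<dots> = (\<Sum>k\<in>snd ` S. c k * g ^ k)"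
    by (rule sum.mono_neutral_left[OF fS Nsub]) (simp add: N_def)
  also have "\<dots> = (\<Sum>k\<in>snd ` S. \<Sum>x\<in>{x\<in>S. snd x = k}. scale_germ (p x) (gmon (fst x) * g ^ snd x))"
    by (rule sum.cong) (auto simp: c_def sum_distrib_right scale_mult_left intro!: sum.cong)
  also have "\<dots> = (\<Sum>x\<in>S. scale_germ (p x) (gmon (fst x) * g ^ snd x))"
    by (rule sum.image_gen[OF S(1), symmetric])
  finally have "(\<Sum>k\<le>K. c k * g ^ k) = 0" using S(3) by simp
  then show ?thesis using that[of c K] cp KN by (auto simp: N_def)
qed

context mellin_data
begin

section \<open>Algebraicity of the root space and of isotypic components\<close>

lemma udil_polys: "x \<in> polys \<Longrightarrow> udil J x \<in> polys"
  unfolding polys_def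
proof (induction rule: germ.span_induct_alt)
  case base
  then show ?case by (simp add: udil_def dil_0 germ.span_zero)
next
  case (step c x y)
  then obtain a where a: "x = gmon a" by auto
  have "udil J x = scale_germ (\<Prod>i\<in>UNIV. (om powi (J $ i)) ^ a i) x"
    by (rule coef_eqI) (auto simp: a udil_def ganalytic_dil ganalytic_gmon ganalytic_scale coef_dil coef_scale coef_gmon)
  then have "udil J (scale_germ c x + y) = scale_germ c (scale_germ (\<Prod>i\<in>UNIV. (om powi (J $ i)) ^ a i) x) + udil J y"
    by (simp add: udil_def dil_add dil_scale)
  then show ?case using step by (simp add: germ.span_add germ.span_scale germ.span_base)
qed

lemma udil_eq_0: "ganalytic x \<Longrightarrow> udil J x = 0 \<Longrightarrow> x = 0"
  by (rule coef_eq_0_imp_eq_0) (use coef_udil[of x J] chr_nonzero in \<open>auto simp: coef_0\<close>)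

text \<open>Every dilate of \<open>phi\<close> satisfies a monic equation of degree m over the
  polynomials, since all m_j < m, and these dilates span the root space; the denominator is
  1.\<close>

lemma root_space_algebraic:
  assumes "g \<in> root_space m M"
  shows "galg g"
proof -
  define F where "F = (\<lambda>J. udil J phi) ` index_box m"
  have "phiB ` NR \<subseteq> germ.span F"
    unfolding phiB_def proj_def F_def
    by (intro image_subsetI germ.span_scale germ.span_sum germ.span_base imageI)
  then have gF: "g \<in> germ.span F"
    using assms germ.span_minimal[of "phiB ` NR" "germ.span F"] unfolding root_space_eq by auto
  have ex: "\<exists>C. (\<forall>k<m. C k \<in> polys) \<and> f ^ m = (\<Sum>k<m. C k * f ^ k)" if "f \<in> F" for f
  proof -
    obtain J where f: "f = udil J phi" using \<open>f \<in> F\<close> by (auto simp: F_def)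
    have "udil J (phi ^ m + (\<Sum>j\<in>UNIV. gX j * phi ^ M j)) = 1"
      unfolding phi(3) udil_def by (rule dil_1)
    then have eq: "f ^ m + (\<Sum>j\<in>UNIV. scale_germ (om powi (J $ j)) (gX j * f ^ M j)) = 1"
      by (simp add: f udil_def dil_add dil_sum dil_mult dil_power dil_X scale_mult_left)
    define C where "C k = (if k = 0 then 1 else 0) - (\<Sum>j\<in>UNIV. if M j = k then scale_germ (om powi (J $ j)) (gX j) else 0)" for k
    have "(\<Sum>k<m. C k * f ^ k) = (\<Sum>k<m. (if k = 0 then 1 else 0) * f ^ k) -
       (\<Sum>k<m. \<Sum>j\<in>UNIV. (if M j = k then scale_germ (om powi (J $ j)) (gX j) else 0) * f ^ k)"
      unfolding C_def left_diff_distrib sum_subtractf sum_distrib_right ..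
    also have "(\<Sum>k<m. (if k = 0 then 1 else 0) * f ^ k) = (\<Sum>k<m. if k = 0 then 1 else 0)"
      by (rule sum.cong) auto
    also have "\<dots> = 1" using m_pos by simp
    also have "(\<Sum>k<m. \<Sum>j\<in>UNIV. (if M j = k then scale_germ (om powi (J $ j)) (gX j) else 0) * f ^ k) =
       (\<Sum>j\<in>UNIV. \<Sum>k<m. (if M j = k then scale_germ (om powi (J $ j)) (gX j * f ^ M j) else 0))"
      by (subst sum.swap) (auto intro!: sum.cong simp: scale_mult_left)
    also have "\<dots> = (\<Sum>j\<in>UNIV. scale_germ (om powi (J $ j)) (gX j * f ^ M j))"
      using M_less by simp
    finally have "f ^ m = (\<Sum>k<m. C k * f ^ k)" using eq by (metis add_diff_cancel_right')
    moreover have "C k \<in> polys" for k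
      unfolding C_def by (intro polys_diff polys_sum) (auto simp: one_polys polys_0 polys_scale X_polys)
    ultimately show ?thesis by blast
  qed
  then obtain C where C: "\<And>f. f \<in> F \<Longrightarrow> (\<forall>k<m. C f k \<in> polys) \<and> f ^ m = (\<Sum>k<m. C f k * f ^ k)" by metis
  show ?thesis
  proof (rule integral_combination_algebraic[of F m C 1])
    show "finite F" unfolding F_def by (intro finite_imageI finite_index_box)
    show "ganalytic g" using assms unfolding root_space_eq span_phiB_iff by (simp add: ganalytic_sols)
  qed (use C m_pos one_polys gF in auto)
qed

text \<open>Each dilate of h satisfies the dilated relation, with leading coefficient
  \<open>l J\<close>. Multiplied by the product \<open>L\<close> of these it becomes integral over
  the polynomials, and the projection is a linear combination of the dilates.\<close>

lemma galg_proj: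
  assumes "galg h" and h: "ganalytic h"
  shows "galg (proj \<beta> h)"
proof -
  obtain c K where c: "\<And>k. c k \<in> polys" "c K \<noteq> 0" "(\<Sum>k\<le>K. c k * h ^ k) = 0" using galg_relation[OF assms(1)] by metis
  have K: "K \<ge> 1" using c(2,3) by (cases K) auto
  define B where "B = (index_box m :: (int^'n) set)"
  have fB: "finite B" unfolding B_def by (rule finite_index_box)
  define l where "l J = udil J (c K)" for J
  have l: "l J \<in> polys" "l J \<noteq> 0" for J
    unfolding l_def using udil_polys c(1) udil_eq_0[OF ganalytic_polys[OF c(1)]] c(2) by auto
  define L where "L = (\<Prod>J\<in>B. l J)"
  have prod_nz: "(\<Prod>J\<in>A. l J) \<noteq> 0" if "finite A" for A
    using that
  proof (induction rule: finite_induct)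
    case (insert x A)
    then show ?case
      using ganalytic_no_zero_divisors[OF ganalytic_polys[OF l(1)[of x]] ganalytic_polys[OF polys_prod], of A l] l by auto
  qed simp
  have L: "L \<in> polys" "L \<noteq> 0" unfolding L_def using l prod_nz fB by (auto intro!: polys_prod)
  define F where "F = (\<lambda>J. L * udil J h) ` B"
  have ex: "\<exists>C. (\<forall>k<K. C k \<in> polys) \<and> f ^ K = (\<Sum>k<K. C k * f ^ k)" if "f \<in> F" for f
  proof -
    obtain J where f: "f = L * udil J h" and J: "J \<in> B" using \<open>f \<in> F\<close> by (auto simp: F_def)
    define q where "q = udil J h"
    define L' where "L' = (\<Prod>J'\<in>B - {J}. l J')"
    have LL: "L = l J * L'" unfolding L_def L'_def using J fB by (simp add: prod.remove)
    have L': "L' \<in> polys" unfolding L'_def using l by (auto intro!: polys_prod)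
    have "udil J (\<Sum>k\<le>K. c k * h ^ k) = 0" unfolding c(3) udil_def by (rule dil_0)
    then have "(\<Sum>k\<le>K. udil J (c k) * q ^ k) = 0"
      by (simp add: udil_def q_def dil_sum dil_mult dil_power)
    moreover have "(\<Sum>k\<le>K. udil J (c k) * q ^ k) = (\<Sum>k<K. udil J (c k) * q ^ k) + l J * q ^ K"
      unfolding l_def lessThan_Suc_atMost[symmetric] by simp
    ultimately have lq: "l J * q ^ K = - (\<Sum>k<K. udil J (c k) * q ^ k)" by (simp add: eq_neg_iff_add_eq_0 add.commute)
    \<comment> \<open>The monic equation for L q arises from the relation for q by multiplying with
      \<open>L ^ (K - 1) * L'\<close> and distributing the powers of \<open>L\<close>.\<close>
    define C where "C k = - (L' * udil J (c k) * L ^ (K - 1 - k))" for k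
    have "L ^ K = L ^ (K - 1) * (l J * L')" using K LL by (cases K) (simp_all add: mult.commute)
    then have "f ^ K = L ^ (K - 1) * L' * (l J * q ^ K)"
      unfolding f q_def[symmetric] power_mult_distrib by (simp add: mult_ac)
    also have "\<dots> = (\<Sum>k<K. C k * f ^ k)"
      unfolding lq sum_negf[symmetric] sum_distrib_left
    proof (rule sum.cong)
      fix k assume "k \<in> {..<K}"
      then have "L ^ (K - 1) = L ^ (K - 1 - k) * L ^ k" by (simp add: power_add[symmetric])
      then show "L ^ (K - 1) * L' * - (udil J (c k) * q ^ k) = C k * f ^ k"
        by (simp add: C_def f q_def[symmetric] power_mult_distrib mult_ac)
    qed simp
    finally have "f ^ K = (\<Sum>k<K. C k * f ^ k)" .
    moreover have "C k \<in> polys" for k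
      unfolding C_def by (intro polys_uminus polys_mult polys_power L' L udil_polys c)
    ultimately show ?thesis by blast
  qed
  then obtain C where C: "\<And>f. f \<in> F \<Longrightarrow> (\<forall>k<K. C f k \<in> polys) \<and> f ^ K = (\<Sum>k<K. C f k * f ^ k)" by metis
  show ?thesis
  proof (rule integral_combination_algebraic[of F K C L])
    show "finite F" unfolding F_def using fB by simp
    show "ganalytic (proj \<beta> h)" using h by (rule ganalytic_proj)
    show "L * proj \<beta> h \<in> germ.span F"
      unfolding proj_def scale_mult_right sum_distrib_left F_def B_def
      by (intro germ.span_scale germ.span_sum germ.span_base) auto
  qed (use C K L in auto)
qed

end

section \<open>Non-algebraic solutions\<close>

text \<open>For prime q, membership in the local ring of the integers at q.\<close>

definition qint :: "nat \<Rightarrow> rat \<Rightarrow> bool" where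
  "qint q r \<longleftrightarrow> (\<exists>a b. r = of_int a / of_int b \<and> \<not> int q dvd b)"

lemma qintI: "r = of_int a / of_int b \<Longrightarrow> \<not> int q dvd b \<Longrightarrow> qint q r"
  unfolding qint_def by blast

context
  fixes q :: nat
  assumes q: "prime q"
begin

lemma not_dvd_1: "\<not> int q dvd 1"
  using q by (metis of_nat_dvd_iff of_nat_1 not_prime_unit)

lemma qint_of_int: "qint q (of_int a)"
  using not_dvd_1 by (intro qintI[of _ a 1]) auto

lemma qint_0: "qint q 0" and qint_1: "qint q 1"
  using qint_of_int[of 0] qint_of_int[of 1] by simp_all

lemma not_dvd_mult: "\<not> int q dvd b \<Longrightarrow> \<not> int q dvd d \<Longrightarrow> \<not> int q dvd b * d"
  using q by (simp add: prime_dvd_mult_iff)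

lemma qint_mult: "qint q x \<Longrightarrow> qint q y \<Longrightarrow> qint q (x * y)"
proof -
  assume "qint q x" "qint q y"
  then obtain a b c d where x: "x = of_int a / of_int b" "\<not> int q dvd b" and y: "y = of_int c / of_int d" "\<not> int q dvd d"
    unfolding qint_def by blast
  show ?thesis by (rule qintI[of _ "a * c" "b * d"]) (simp_all add: x(1) y(1) not_dvd_mult[OF x(2) y(2)])
qed

lemma qint_add: "qint q x \<Longrightarrow> qint q y \<Longrightarrow> qint q (x + y)"
proof -
  assume "qint q x" "qint q y"
  then obtain a b c d where x: "x = of_int a / of_int b" "\<not> int q dvd b" and y: "y = of_int c / of_int d" "\<not> int q dvd d"
    unfolding qint_def by blast
  have "b \<noteq> 0" "d \<noteq> 0" using x y by auto
  then show ?thesis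
    by (intro qintI[of _ "a * d + c * b" "b * d"]) (simp_all add: x(1) y(1) not_dvd_mult[OF x(2) y(2)] field_simps)
qed

lemma qint_uminus: "qint q x \<Longrightarrow> qint q (- x)"
  using qint_mult[OF qint_of_int[of "-1"]] by simp

lemma qint_diff: "qint q x \<Longrightarrow> qint q y \<Longrightarrow> qint q (x - y)"
  using qint_add[of x "- y"] qint_uminus by simp

lemma qint_sum: "(\<And>i. i \<in> A \<Longrightarrow> qint q (f i)) \<Longrightarrow> qint q (\<Sum>i\<in>A. f i)"
  by (induction A rule: infinite_finite_induct) (auto simp: qint_0 qint_add)

lemma qint_fps_mult:
  "(\<And>i. qint q (fps_nth f i)) \<Longrightarrow> (\<And>i. qint q (fps_nth g i)) \<Longrightarrow> qint q (fps_nth (f * g) i)"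
  unfolding fps_mult_nth by (intro qint_sum qint_mult)

lemma qint_fps_power:
  assumes "\<And>i. qint q (fps_nth f i)"
  shows "qint q (fps_nth (f ^ k) i)"
proof (induction k arbitrary: i)
  case 0
  then show ?case by (cases i) (simp_all add: qint_0 qint_1)
next
  case (Suc k)
  show ?case unfolding power_Suc by (intro qint_fps_mult assms Suc)
qed

end

text \<open>Primes beyond |a| + |b| divide neither a nonzero numerator a nor the denominator
  b.\<close>

lemma qint_large: "\<exists>B. \<forall>q. prime q \<longrightarrow> q > B \<longrightarrow> qint q r \<and> (r \<noteq> 0 \<longrightarrow> qint q (inverse r))"
proof -
  obtain a b where ab: "quotient_of r = (a, b)" by (cases "quotient_of r")
  then have r: "r = of_int a / of_int b" and b: "b > 0" by (auto intro: quotient_of_div quotient_of_denom_pos)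
  have nd: "\<not> int q dvd z" if "q > nat \<bar>a\<bar> + nat \<bar>b\<bar>" "z \<noteq> 0" "\<bar>z\<bar> \<le> \<bar>a\<bar> + \<bar>b\<bar>" for q z
    using that zdvd_imp_le[of "int q" "\<bar>z\<bar>"] by auto
  show ?thesis
  proof (intro exI[of _ "nat \<bar>a\<bar> + nat \<bar>b\<bar>"] allI impI conjI)
    fix q assume q: "q > nat \<bar>a\<bar> + nat \<bar>b\<bar>"
    show "qint q r" by (rule qintI[OF r nd[OF q]]) (use b in auto)
    assume "r \<noteq> 0"
    then have "a \<noteq> 0" using r by auto
    then show "qint q (inverse r)" by (intro qintI[of _ b a] nd[OF q]) (auto simp: r)
  qed
qed

lemma qint_large_set:
  assumes "finite S"
  shows "\<exists>B. \<forall>q. prime q \<longrightarrow> q > B \<longrightarrow> (\<forall>r\<in>S. qint q r)"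
  using assms
proof (induction rule: finite_induct)
  case (insert r S)
  then obtain B where B: "\<forall>q. prime q \<longrightarrow> q > B \<longrightarrow> (\<forall>r\<in>S. qint q r)" by auto
  obtain B' where B': "\<forall>q. prime q \<longrightarrow> q > B' \<longrightarrow> qint q r" using qint_large[of r] by auto
  show ?case using B B' by (intro exI[of _ "max B B'"]) auto
qed auto

text \<open>Expansion to first order with quadratic remainder. With v divisible by X^i the remainder
  does not reach the degree that is compared in Eisenstein's argument.\<close>

lemma power_diff_expand:
  fixes x v :: "'a::comm_ring_1"
  shows "\<exists>r. (x - v) ^ k = x ^ k - of_nat k * x ^ (k - 1) * v + v ^ 2 * r"
proof (induction k)
  case (Suc k)
  then obtain r where r: "(x - v) ^ k = x ^ k - of_nat k * x ^ (k - 1) * v + v ^ 2 * r" by auto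
  have x: "of_nat k * (x * x ^ (k - 1)) = of_nat k * x ^ k" by (cases k) auto
  have "(x - v) ^ Suc k = (x - v) * (x ^ k - of_nat k * x ^ (k - 1) * v + v ^ 2 * r)" by (simp add: r)
  also have "\<dots> = x * x ^ k - x ^ k * v - (of_nat k * (x * x ^ (k - 1))) * v + v ^ 2 * (of_nat k * x ^ (k - 1) + (x - v) * r)"
    by (simp add: algebra_simps power2_eq_square)
  also have "\<dots> = x ^ Suc k - of_nat (Suc k) * x ^ (Suc k - 1) * v + v ^ 2 * (of_nat k * x ^ (k - 1) + (x - v) * r)"
    unfolding x by (simp add: algebra_simps)
  finally show ?case by blast
qed (auto intro: exI[of _ 0])

text \<open>
  Eisenstein's theorem. Truncating \<open>F\<close> below degree \<open>i\<close> and comparing coefficients of degree \<open>i + \<delta>\<close>, where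
  \<open>\<delta>\<close> is the order of \<open>P'(F)\<close>, expresses the coefficient \<open>F\<^sub>i\<close> through the preceding ones with a fixed denominator.
\<close>

lemma Eisenstein_step:
  fixes F :: "rat fps" and c :: "nat \<Rightarrow> rat fps"
  assumes fin: "\<And>k. k \<le> K \<Longrightarrow> finite (range (fps_nth (c k)))"
    and P: "(\<Sum>k\<le>K. c k * F ^ k) = 0"
    and D0: "(\<Sum>k\<le>K. of_nat k * c k * F ^ (k - 1)) \<noteq> 0"
  shows "\<exists>B. \<forall>q. prime q \<longrightarrow> q > B \<longrightarrow> (\<forall>i. qint q (fps_nth F i))"
proof -
  define D where "D = (\<Sum>k\<le>K. of_nat k * c k * F ^ (k - 1))"
  define \<delta> where "\<delta> = subdegree D"
  define d where "d = fps_nth D \<delta>"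
  have d: "d \<noteq> 0" unfolding d_def \<delta>_def using D0 by (simp add: D_def)
  have "finite ((\<Union>k\<in>{..K}. range (fps_nth (c k))) \<union> fps_nth F ` {..\<delta>})" using fin by auto
  from qint_large_set[OF this] obtain B1 where B1: "\<And>q k i. prime q \<Longrightarrow> q > B1 \<Longrightarrow> k \<le> K \<Longrightarrow> qint q (fps_nth (c k) i)"
    "\<And>q i. prime q \<Longrightarrow> q > B1 \<Longrightarrow> i \<le> \<delta> \<Longrightarrow> qint q (fps_nth F i)" by blast
  obtain B2 where B2: "\<And>q. prime q \<Longrightarrow> q > B2 \<Longrightarrow> qint q (inverse d)" using qint_large[of d] d by auto
  show ?thesis
  proof (intro exI[of _ "max B1 B2"] allI impI)
    fix q i assume q: "prime q" and "q > max B1 B2"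
    then have qB: "q > B1" "q > B2" by auto
    show "qint q (fps_nth F i)"
    proof (induction i rule: less_induct)
      case (less i)
      show ?case
      proof (cases "i \<le> \<delta>")
        case True
        then show ?thesis using B1(2)[OF q qB(1)] by simp
      next
        case False
        define u where "u = fps_cutoff i F"
        define w where "w = fps_shift i F"
        define v where "v = w * fps_X ^ i"
        have u: "u = F - v" using fps_shift_cutoff[of i F] by (simp add: u_def v_def w_def algebra_simps)
        have uq: "qint q (fps_nth u l)" for l using less.IH[of l] by (auto simp: u_def qint_0[OF q])
        obtain r where r: "\<And>k. u ^ k = F ^ k - of_nat k * F ^ (k - 1) * v + v ^ 2 * r k"
          unfolding u using power_diff_expand[of F v] by metis
        have "(\<Sum>k\<le>K. c k * u ^ k) = (\<Sum>k\<le>K. c k * F ^ k) - D * v + v ^ 2 * (\<Sum>k\<le>K. c k * r k)"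
          unfolding D_def sum_distrib_left sum_distrib_right sum.distrib[symmetric] sum_subtractf[symmetric]
          by (rule sum.cong) (simp_all only: r, simp add: algebra_simps)
        then have "fps_nth (\<Sum>k\<le>K. c k * u ^ k) (i + \<delta>) =
            - fps_nth (D * v) (i + \<delta>) + fps_nth (v ^ 2 * (\<Sum>k\<le>K. c k * r k)) (i + \<delta>)"
          by (simp add: P)
        \<comment> \<open>Below degree \<delta> the series D vanishes, so only its lowest
          coefficient d meets the constant term of w, which is the coefficient of F at i.\<close>
        moreover have "fps_nth (D * v) (i + \<delta>) = d * fps_nth F i"
        proof -
          have "fps_nth (D * v) (i + \<delta>) = fps_nth (D * w) \<delta>"
            unfolding v_def by (simp add: mult.assoc[symmetric] fps_X_power_mult_right_nth)
          also have "\<dots> = (\<Sum>l=0..\<delta>. fps_nth D l * fps_nth w (\<delta> - l))" by (rule fps_mult_nth)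
          also have "\<dots> = (\<Sum>l\<in>{\<delta>}. fps_nth D l * fps_nth w (\<delta> - l))"
          proof (rule sum.mono_neutral_right)
            show "\<forall>l\<in>{0..\<delta>} - {\<delta>}. fps_nth D l * fps_nth w (\<delta> - l) = 0"
            proof
              fix l assume "l \<in> {0..\<delta>} - {\<delta>}"
              then have "l < subdegree D" unfolding \<delta>_def[symmetric] by simp
              then show "fps_nth D l * fps_nth w (\<delta> - l) = 0" by (simp only: nth_less_subdegree_zero mult_zero_left)
            qed
          qed simp_all
          finally show ?thesis by (simp add: d_def w_def)
        qed
        \<comment> \<open>Since \<delta> < i, the degree i + \<delta> is below 2 i, the order of
          v^2.\<close>
        moreover have "fps_nth (v ^ 2 * (\<Sum>k\<le>K. c k * r k)) (i + \<delta>) = 0"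
        proof -
          have "v ^ 2 * (\<Sum>k\<le>K. c k * r k) = (w ^ 2 * (\<Sum>k\<le>K. c k * r k)) * fps_X ^ (2 * i)"
            by (simp add: v_def power_mult_distrib power_mult[symmetric] mult_ac)
          then show ?thesis using False by (simp only: fps_X_power_mult_right_nth) simp
        qed
        ultimately have "d * fps_nth F i = - fps_nth (\<Sum>k\<le>K. c k * u ^ k) (i + \<delta>)" by simp
        then have "fps_nth F i = inverse d * (- fps_nth (\<Sum>k\<le>K. c k * u ^ k) (i + \<delta>))"
          using d by (simp add: field_simps)
        moreover have "qint q (fps_nth (\<Sum>k\<le>K. c k * u ^ k) (i + \<delta>))"
          unfolding fps_sum_nth
          by (rule qint_sum[OF q], rule qint_fps_mult[OF q], rule B1(1)[OF q qB(1)], simp, rule qint_fps_power[OF q uq])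
        ultimately show ?thesis using qint_mult[OF q B2[OF q qB(2)]] qint_uminus[OF q] by simp
      qed
    qed
  qed
qed

text \<open>If the derivative of the relation also vanishes at F, it is a relation of smaller
  degree. It is nontrivial in characteristic 0, because otherwise the original relation would reduce
  to \<open>c 0\<close> = 0 with \<open>c 0\<close> nonzero.\<close>

lemma Eisenstein:
  fixes F :: "rat fps" and c :: "nat \<Rightarrow> rat fps"
  assumes "\<And>k. k \<le> K \<Longrightarrow> finite (range (fps_nth (c k)))"
    and "(\<Sum>k\<le>K. c k * F ^ k) = 0" and "\<exists>k\<le>K. c k \<noteq> 0"
  shows "\<exists>B. \<forall>q. prime q \<longrightarrow> q > B \<longrightarrow> (\<forall>i. qint q (fps_nth F i))"
  using assms
proof (induction K arbitrary: c)
  case 0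
  then show ?case by simp
next
  case (Suc K)
  have D: "(\<Sum>k\<le>Suc K. of_nat k * c k * F ^ (k - 1)) = (\<Sum>k\<le>K. (of_nat (Suc k) * c (Suc k)) * F ^ k)"
    unfolding sum.atMost_Suc_shift by simp
  show ?case
  proof (cases "(\<Sum>k\<le>Suc K. of_nat k * c k * F ^ (k - 1)) = 0")
    case False
    show ?thesis by (rule Eisenstein_step[OF Suc.prems(1,2) False])
  next
    case True
    have nz: "\<exists>k\<le>K. of_nat (Suc k) * c (Suc k) \<noteq> 0"
    proof (rule ccontr)
      assume "\<not> (\<exists>k\<le>K. of_nat (Suc k) * c (Suc k) \<noteq> 0)"
      then have z: "c (Suc k) = 0" if "k \<le> K" for k using that by (metis mult_eq_0_iff of_nat_eq_0_iff nat.simps(3))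
      then have "c 0 \<noteq> 0" using Suc.prems(3) by (metis Suc_le_mono not0_implies_Suc)
      moreover have "(\<Sum>k\<le>Suc K. c k * F ^ k) = c 0" unfolding sum.atMost_Suc_shift by (simp add: z)
      ultimately show False using Suc.prems(2) by simp
    qed
    show ?thesis
    proof (rule Suc.IH[of "\<lambda>k. of_nat (Suc k) * c (Suc k)"])
      fix k assume "k \<le> K"
      then have "finite ((*) (of_nat (Suc k)) ` range (fps_nth (c (Suc k))))" using Suc.prems(1)[of "Suc k"] by simp
      moreover have "range (fps_nth (of_nat (Suc k) * c (Suc k))) \<subseteq> (*) (of_nat (Suc k)) ` range (fps_nth (c (Suc k)))"
        by (auto simp: fps_mult_of_nat_nth simp del: of_nat_Suc)
      ultimately show "finite (range (fps_nth (of_nat (Suc k) * c (Suc k))))" by (rule finite_subset[rotated])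
    qed (use True D nz in auto)
  qed
qed

text \<open>The coordinate at z0 with respect to a basis of the complex numbers over the rationals
  that contains z0. It turns relations with complex coefficients into rational ones.\<close>

lemma ex_rat_linear:
  assumes "(z0::complex) \<noteq> 0"
  obtains lam :: "complex \<Rightarrow> rat" where "\<And>x y. lam (x + y) = lam x + lam y"
    "\<And>r x. lam (of_rat r * x) = r * lam x" "lam z0 \<noteq> 0"
proof -
  interpret rv: vector_space "\<lambda>(r::rat) (z::complex). of_rat r * z"
    by standard (simp_all add: algebra_simps of_rat_add of_rat_mult)
  have ind: "rv.independent {z0}" using assms by simp
  define B where "B = rv.extend_basis {z0}"
  have B: "rv.independent B" "rv.span B = UNIV" "z0 \<in> B"
    unfolding B_def using rv.independent_extend_basis[OF ind] rv.span_extend_basis[OF ind] rv.extend_basis_superset[OF ind] by auto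
  show ?thesis
    by (rule that[of "\<lambda>x. rv.representation B x z0"])
       (simp_all add: rv.representation_add B rv.representation_scale rv.representation_basis)
qed

text \<open>Digits in base B at distinct places: the lowest one is read off modulo B and removed. It
  keeps the exponent vectors of a relation apart on the curve.\<close>

lemma base_digits_inj:
  fixes a b e :: "'i \<Rightarrow> nat"
  assumes "finite A" "inj_on e A" "\<And>i. i \<in> A \<Longrightarrow> a i < B" "\<And>i. i \<in> A \<Longrightarrow> b i < B"
    and "(\<Sum>i\<in>A. B ^ e i * a i) = (\<Sum>i\<in>A. B ^ e i * b i)"
  shows "\<forall>i\<in>A. a i = b i"
  using assms
proof (induction "card A" arbitrary: A)
  case (Suc n)
  then have "A \<noteq> {}" by auto
  obtain i0 where i0: "i0 \<in> A" "\<And>i. i \<in> A \<Longrightarrow> e i0 \<le> e i"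
    using ex_min_if_finite[of "e ` A"] Suc.prems(1) \<open>A \<noteq> {}\<close> by (metis (no_types, lifting) arg_min_if_finite(1) arg_min_least)
  define A' where "A' = A - {i0}"
  have B: "B > 0" using Suc.prems(3)[OF i0(1)] by simp
  have split: "(\<Sum>i\<in>A. B ^ e i * x i) = B ^ e i0 * (x i0 + B * (\<Sum>i\<in>A'. B ^ (e i - Suc (e i0)) * x i))" for x
  proof -
    have "(\<Sum>i\<in>A'. B ^ e i * x i) = (\<Sum>i\<in>A'. B ^ e i0 * (B * (B ^ (e i - Suc (e i0)) * x i)))"
    proof (rule sum.cong)
      fix i assume i: "i \<in> A'"
      then have "e i \<noteq> e i0" using Suc.prems(2) i0(1) by (auto simp: A'_def inj_on_def)
      then have "e i0 < e i" using i0(2)[of i] i by (auto simp: A'_def)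
      then have "B ^ e i = B ^ e i0 * (B * B ^ (e i - Suc (e i0)))"
        by (metis power_Suc power_add le_add_diff_inverse Suc_leI add_Suc_right add_Suc)
      then show "B ^ e i * x i = B ^ e i0 * (B * (B ^ (e i - Suc (e i0)) * x i))" by simp
    qed simp
    then show ?thesis unfolding A'_def using Suc.prems(1) i0(1)
      by (simp add: sum.remove[of A i0] distrib_left sum_distrib_left)
  qed
  have "a i0 + B * (\<Sum>i\<in>A'. B ^ (e i - Suc (e i0)) * a i) = b i0 + B * (\<Sum>i\<in>A'. B ^ (e i - Suc (e i0)) * b i)"
    using Suc.prems(5) B unfolding split by simp
  then have "(a i0 + B * (\<Sum>i\<in>A'. B ^ (e i - Suc (e i0)) * a i)) mod B = (b i0 + B * (\<Sum>i\<in>A'. B ^ (e i - Suc (e i0)) * b i)) mod B"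
    by simp
  then have eq0: "a i0 = b i0" using Suc.prems(3,4)[OF i0(1)] by simp
  have "(\<Sum>i\<in>A'. B ^ e i * a i) = (\<Sum>i\<in>A'. B ^ e i * b i)"
    using Suc.prems(5) Suc.prems(1) i0(1) eq0 unfolding A'_def by (simp add: sum.remove[of A i0])
  moreover have "n = card A'" using Suc.hyps(2) Suc.prems(1) i0(1) by (simp add: A'_def)
  ultimately have "\<forall>i\<in>A'. a i = b i"
    using Suc.prems by (intro Suc.hyps(1)) (auto simp: A'_def inj_on_def)
  then show ?case using eq0 by (auto simp: A'_def)
qed simp

section \<open>Algebraic relations restricted to a curve and made rational\<close>

definition of_rat_fps :: "rat fps \<Rightarrow> complex fps" where
  "of_rat_fps f = Abs_fps (\<lambda>n. of_rat (fps_nth f n))"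

lemma of_rat_fps_nth [simp]: "fps_nth (of_rat_fps f) n = of_rat (fps_nth f n)"
  by (simp add: of_rat_fps_def)

lemma of_rat_fps_mult: "of_rat_fps (f * g) = of_rat_fps f * of_rat_fps g"
  by (rule fps_ext) (simp add: fps_mult_nth of_rat_sum of_rat_mult)

lemma of_rat_fps_power: "of_rat_fps (f ^ k) = of_rat_fps f ^ k"
proof (induction k)
  case 0
  show ?case by (rule fps_ext) simp
qed (simp add: of_rat_fps_mult)

lemma cfps_hom:
  fixes w :: "'n::finite \<Rightarrow> nat"
  assumes w: "\<And>i. w i > 0" and g: "ganalytic g" and S: "finite S"
  shows "cfps w (\<Sum>x\<in>S. scale_germ (p x) (gmon (fst x) * g ^ snd x)) =
    (\<Sum>x\<in>S. fps_const (p x) * (fps_X ^ (\<Sum>i\<in>UNIV. w i * fst x i) * cfps w g ^ snd x))"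
proof -
  have one: "cfps w 1 = 1" using cfps_const[OF w, where c = 1] by simp
  have pow: "cfps w (f ^ k) = cfps w f ^ k" if "ganalytic f" for f k
    using that by (induction k) (simp_all add: one cfps_mult[OF w] ganalytic_power)
  have prod: "cfps w (\<Prod>i\<in>A. gX i ^ a i) = (\<Prod>i\<in>A. fps_X ^ (w i * a i))" for A a
  proof (induction A rule: infinite_finite_induct)
    case (insert x A)
    have "ganalytic (gX x ^ a x)" "ganalytic (\<Prod>i\<in>A. gX i ^ a i)" by (intro ganalytic_intros)+
    then show ?case using insert by (simp add: cfps_mult[OF w] pow[OF ganalytic_X] cfps_X[OF w] power_mult)
  qed (simp_all add: one)
  have "cfps w (gmon a) = fps_X ^ (\<Sum>i\<in>UNIV. w i * a i)" for a
    unfolding gmon_def prod power_sum ..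
  then have monom: "cfps w (scale_germ c (gmon a * g ^ k)) = fps_const c * (fps_X ^ (\<Sum>i\<in>UNIV. w i * a i) * cfps w g ^ k)" for c a k
    by (subst scale_germ_eq_mult) (simp add: cfps_mult[OF w] cfps_const[OF w] pow g ganalytic_const ganalytic_mult ganalytic_gmon ganalytic_power)
  have an: "ganalytic (scale_germ (p x) (gmon (fst x) * g ^ snd x))" for x
    by (intro ganalytic_intros ganalytic_gmon g)
  show ?thesis using S
  proof (induction S rule: finite_induct)
    case empty
    show ?case using cfps_const[OF w, where c = 0] by simp
  next
    case (insert x S)
    then show ?case using an by (simp add: cfps_add[OF w] ganalytic_sum monom)
  qed
qed

text \<open>The functional acts only on the coefficients \<open>p x\<close>, because powers of F
  have rational coefficients. The term x0 survives: its coefficient is not annihilated, and by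
  \<open>inj\<close> no other term shares both its power of X and its power of F.\<close>

lemma rational_relation:
  fixes F :: "rat fps" and W :: "'x \<Rightarrow> nat" and e :: "'x \<Rightarrow> nat"
  assumes S: "finite S" and x0: "x0 \<in> S" "p x0 \<noteq> 0"
    and inj: "\<And>x. x \<in> S \<Longrightarrow> e x = e x0 \<Longrightarrow> W x = W x0 \<Longrightarrow> x = x0"
    and rel: "(\<Sum>x\<in>S. fps_const (p x) * (fps_X ^ W x * of_rat_fps F ^ e x)) = 0"
  shows "\<exists>B. \<forall>q. prime q \<longrightarrow> q > B \<longrightarrow> (\<forall>i. qint q (fps_nth F i))"
proof -
  obtain lam :: "complex \<Rightarrow> rat" where lam: "\<And>x y. lam (x + y) = lam x + lam y"
    "\<And>r x. lam (of_rat r * x) = r * lam x" "lam (p x0) \<noteq> 0" using ex_rat_linear[OF x0(2)] by blast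
  have lam0: "lam 0 = 0" using lam(2)[of 0 0] by simp
  have lamsum: "lam (\<Sum>x\<in>A. f x) = (\<Sum>x\<in>A. lam (f x))" for f A
    by (induction A rule: infinite_finite_induct) (simp_all add: lam0 lam(1))
  have relQ: "(\<Sum>x\<in>S. fps_const (lam (p x)) * (fps_X ^ W x * F ^ e x)) = 0"
  proof (rule fps_ext)
    fix l
    have pt: "fps_nth (fps_const (p x) * (fps_X ^ W x * of_rat_fps F ^ e x)) l =
        of_rat (fps_nth (fps_X ^ W x * F ^ e x) l) * p x" for x
      unfolding fps_mult_left_const_nth of_rat_fps_power[symmetric] fps_X_power_mult_nth by simp
    have "0 = lam (fps_nth (\<Sum>x\<in>S. fps_const (p x) * (fps_X ^ W x * of_rat_fps F ^ e x)) l)"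
      by (simp add: rel lam0)
    also have "\<dots> = (\<Sum>x\<in>S. lam (of_rat (fps_nth (fps_X ^ W x * F ^ e x) l) * p x))"
      unfolding fps_sum_nth lamsum pt ..
    also have "\<dots> = fps_nth (\<Sum>x\<in>S. fps_const (lam (p x)) * (fps_X ^ W x * F ^ e x)) l"
      unfolding fps_sum_nth lam(2) fps_mult_left_const_nth by (rule sum.cong) (simp_all only: mult.commute)
    finally show "fps_nth (\<Sum>x\<in>S. fps_const (lam (p x)) * (fps_X ^ W x * F ^ e x)) l = fps_nth 0 l" by simp
  qed
  define c where "c k = (\<Sum>x\<in>{x\<in>S. e x = k}. fps_const (lam (p x)) * fps_X ^ W x)" for k
  define K where "K = Max (e ` S)"
  have eK: "e ` S \<subseteq> {..K}" using S by (auto simp: K_def)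
  have nth: "fps_nth (c k) l = (\<Sum>x\<in>{x\<in>S. e x = k}. if W x = l then lam (p x) else 0)" for k l
    unfolding c_def fps_sum_nth by (rule sum.cong) (auto simp: fps_X_power_nth)
  show ?thesis
  proof (rule Eisenstein[of K c])
    fix k
    have "range (fps_nth (c k)) \<subseteq> insert 0 (fps_nth (c k) ` (W ` S))"
    proof
      fix y assume "y \<in> range (fps_nth (c k))"
      then obtain l where l: "y = fps_nth (c k) l" by auto
      show "y \<in> insert 0 (fps_nth (c k) ` (W ` S))"
      proof (cases "l \<in> W ` S")
        case False
        then have "y = 0" unfolding l nth by (intro sum.neutral) auto
        then show ?thesis by simp
      qed (simp add: l)
    qed
    then show "finite (range (fps_nth (c k)))" by (rule finite_subset) (simp add: S)
  next
    have "(\<Sum>k\<le>K. c k * F ^ k) = (\<Sum>k\<le>K. \<Sum>x\<in>{x\<in>S. e x = k}. fps_const (lam (p x)) * (fps_X ^ W x * F ^ e x))"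
      unfolding c_def sum_distrib_right by (intro sum.cong) (auto simp: mult.assoc)
    also have "\<dots> = (\<Sum>x\<in>S. fps_const (lam (p x)) * (fps_X ^ W x * F ^ e x))"
      by (rule sum.group) (use S eK in auto)
    finally show "(\<Sum>k\<le>K. c k * F ^ k) = 0" using relQ by simp
  next
    have "fps_nth (c (e x0)) (W x0) = (\<Sum>x\<in>{x0}. if W x = W x0 then lam (p x) else 0)"
      unfolding nth using S x0(1) inj by (intro sum.mono_neutral_right) auto
    then have "c (e x0) \<noteq> 0" using lam(3) by auto
    then show "\<exists>k\<le>K. c k \<noteq> 0" using eK x0(1) by auto
  qed
qed


context mellin_data
begin

section \<open>Arithmetic of the coefficients in a regular class\<close>

lemma zc_add: "m dvd 1 + dotM \<alpha> \<Longrightarrow> zc (\<alpha>(j := \<alpha> j + m * g)) = zc \<alpha> + M j * g"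
proof -
  assume d: "m dvd 1 + dotM \<alpha>"
  have "1 + dotM (\<alpha>(j := \<alpha> j + m * g)) = m * (zc \<alpha> + M j * g)"
    unfolding dotM_add using Z_zc(1)[OF d] by (simp add: algebra_simps)
  then show ?thesis unfolding zc_def using m_pos by simp
qed

definition gr :: "('n \<Rightarrow> nat) \<Rightarrow> rat" where
  "gr \<alpha> = of_int ((-1) ^ zc \<alpha> * fact (zc \<alpha> - 1) * fact (deg \<alpha> - zc \<alpha> - 1)) / of_int (\<Prod>i\<in>UNIV. fact (\<alpha> i))"

lemma gc_of_rat: "gc \<alpha> = of_rat (gr \<alpha>)"
proof -
  have "of_rat (fact k) = (fact k :: complex)" for k by (metis of_nat_fact of_rat_of_nat_eq)
  then show ?thesis
    by (simp add: gc_def gr_def afact_def of_rat_divide of_rat_mult of_rat_power of_rat_minus of_rat_prod)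
qed

lemma not_dvd_fact_prod:
  fixes \<alpha> :: "'n \<Rightarrow> nat"
  assumes "prime (q::nat)" "\<And>i. \<alpha> i < q"
  shows "\<not> int q dvd (\<Prod>i\<in>UNIV. fact (\<alpha> i :: nat))"
proof
  assume "int q dvd (\<Prod>i\<in>UNIV. fact (\<alpha> i))"
  then obtain i where "int q dvd fact (\<alpha> i)"
    using assms(1) prime_dvd_prod_iff[of UNIV "int q" "\<lambda>i. fact (\<alpha> i)"] by auto
  then have "q dvd fact (\<alpha> i)" by (metis of_nat_dvd_iff of_nat_fact)
  then show False using assms prime_dvd_fact_iff[of q "\<alpha> i"] by (simp add: not_le[symmetric])
qed

lemma gr_qint:
  assumes "prime q" "\<And>i. \<alpha> i < q"
  shows "qint q (gr \<alpha>)"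
  unfolding gr_def by (rule qintI[OF refl not_dvd_fact_prod[OF assms]])

text \<open>The prime q divides \<alpha>_j! in the denominator, but neither factorial in the
  numerator.\<close>

lemma gr_not_qint:
  assumes q: "prime q" and j: "\<alpha> j \<ge> q" and z: "zc \<alpha> - 1 < q" "deg \<alpha> - zc \<alpha> - 1 < q"
  shows "\<not> qint q (gr \<alpha>)"
proof
  define N :: int where "N = (-1) ^ zc \<alpha> * fact (zc \<alpha> - 1) * fact (deg \<alpha> - zc \<alpha> - 1)"
  define P :: int where "P = (\<Prod>i\<in>UNIV. fact (\<alpha> i))"
  have P0: "P \<noteq> 0" by (simp add: P_def)
  have pq: "prime (int q)" using q by simp
  have "q dvd fact (\<alpha> j)" using j q by (simp add: prime_dvd_fact_iff)
  then have "int q dvd fact (\<alpha> j)" by (metis of_nat_dvd_iff of_nat_fact)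
  then have qP: "int q dvd P" unfolding P_def by (rule dvd_trans) (rule dvd_prodI, simp_all)
  have nf: "\<not> int q dvd fact k" if "k < q" for k
    using that q prime_dvd_fact_iff[of q k] by (metis not_le of_nat_dvd_iff of_nat_fact)
  have "\<not> int q dvd (-1) ^ zc \<alpha>"
    using prime_dvd_power[OF pq, of "-1" "zc \<alpha>"] not_dvd_1[OF q] by auto
  then have qN: "\<not> int q dvd N"
    unfolding N_def using nf[OF z(1)] nf[OF z(2)] pq by (simp add: prime_dvd_mult_iff)
  assume "qint q (gr \<alpha>)"
  then obtain a b where ab: "gr \<alpha> = of_int a / of_int b" "\<not> int q dvd b" unfolding qint_def by blast
  then have b0: "b \<noteq> 0" by auto
  have "(of_int N / of_int P :: rat) = of_int a / of_int b" using ab(1) by (simp only: gr_def N_def P_def)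
  then have "(of_int (N * b) :: rat) = of_int (a * P)" using P0 b0 by (simp add: field_simps)
  then have "N * b = a * P" by (simp only: of_int_eq_iff)
  then have "int q dvd N * b" using qP by simp
  then show False using qN ab(2) pq by (simp add: prime_dvd_mult_iff)
qed

text \<open>By Eisenstein's theorem the coefficients along the curve would be integral at every
  large prime q. A degree k is exhibited in which exactly one index, \<open>\<alpha>0\<close>,
  contributes a term that is not q-integral.\<close>

lemma regular_class_not_algebraic:
  assumes b: "\<beta> \<in> box" "regular \<beta>" and f: "ganalytic f"
    and cf: "\<And>\<alpha>. coef f \<alpha> = (if amod \<alpha> = \<beta> then gc \<alpha> else 0)"
  shows "\<not> galg f"
proof
  assume "galg f"
  then obtain S p where S: "finite S" "\<exists>x\<in>S. p x \<noteq> 0" "(\<Sum>x\<in>S. scale_germ (p x) (gmon (fst x) * f ^ snd x)) = 0"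
    unfolding galg_def by auto
  obtain x0 where x0: "x0 \<in> S" "p x0 \<noteq> 0" using S(2) by auto
  obtain j :: 'n where True by simp
  obtain e0 :: "'n \<Rightarrow> nat" where e0: "inj e0"
    using ex_bij_betw_finite_nat[of "UNIV :: 'n set"] by (auto simp: bij_betw_def)
  \<comment> \<open>Place 0 is reserved for \<open>j\<close>, so that \<open>w j\<close> is 1 and
    all other weights are at least 2.\<close>
  define e where "e i = (if i = j then 0 else Suc (e0 i))" for i
  have inje: "inj e" using e0 by (auto simp: inj_on_def e_def)
  \<comment> \<open>The base exceeds all exponents in the relation, so that distinct exponent
    vectors give distinct powers of t; adding 2 also ensures B \<ge> 2.\<close>
  define B where "B = Max (insert 0 (\<Union>x\<in>S. range (fst x))) + 2"
  have fin: "finite (insert 0 (\<Union>x\<in>S. range (fst x)))" using S(1) by auto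
  have B: "fst x i < B" if "x \<in> S" for x i
    using Max_ge[OF fin, of "fst x i"] that by (fastforce simp: B_def)
  have B2: "B \<ge> 2" by (simp add: B_def)
  define w where "w i = B ^ e i" for i
  have w: "w i > 0" for i using B2 by (simp add: w_def)
  have wj: "w j = 1" by (simp add: w_def e_def)
  have w2: "w i \<ge> 2" if "i \<noteq> j" for i
  proof -
    have "B ^ 1 \<le> B ^ e i" using B2 that by (intro power_increasing) (auto simp: e_def)
    then show ?thesis using B2 by (simp add: w_def)
  qed
  define fr where "fr \<alpha> = (if amod \<alpha> = \<beta> then gr \<alpha> else 0)" for \<alpha>
  define lev where "lev k = {\<alpha>. (\<Sum>i\<in>UNIV. w i * \<alpha> i) = k}" for k
  have flev: "finite (lev k)" for k unfolding lev_def by (rule finite_weighted[OF w])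
  define FQ where "FQ = Abs_fps (\<lambda>k. \<Sum>\<alpha>\<in>lev k. fr \<alpha>)"
  have FQ: "of_rat_fps FQ = cfps w f"
    by (rule fps_ext) (auto simp: FQ_def cfps_nth[OF w f] lev_def of_rat_sum fr_def cf gc_of_rat intro!: sum.cong)
  have "cfps w (\<Sum>x\<in>S. scale_germ (p x) (gmon (fst x) * f ^ snd x)) = 0"
    unfolding S(3) using cfps_const[OF w, where c = 0] by simp
  then have rel: "(\<Sum>x\<in>S. fps_const (p x) * (fps_X ^ (\<Sum>i\<in>UNIV. w i * fst x i) * of_rat_fps FQ ^ snd x)) = 0"
    unfolding FQ cfps_hom[OF w f S(1)] .
  have "\<exists>Q. \<forall>q. prime q \<longrightarrow> q > Q \<longrightarrow> (\<forall>i. qint q (fps_nth FQ i))"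
  proof (rule rational_relation[where S = S and p = p and W = "\<lambda>x. \<Sum>i\<in>UNIV. w i * fst x i" and e = snd, OF S(1) x0 _ rel])
    fix x assume x: "x \<in> S" "snd x = snd x0" "(\<Sum>i\<in>UNIV. w i * fst x i) = (\<Sum>i\<in>UNIV. w i * fst x0 i)"
    have "\<forall>i\<in>UNIV. fst x i = fst x0 i"
      by (rule base_digits_inj[of UNIV e _ B]) (use inje B x x0 in \<open>auto simp: w_def\<close>)
    then show "x = x0" using x(2) by (simp add: prod_eq_iff fun_eq_iff)
  qed
  then obtain Q where Q: "\<And>q i. prime q \<Longrightarrow> q > Q \<Longrightarrow> qint q (fps_nth FQ i)" by blast
  define wb where "wb = (\<Sum>i\<in>UNIV. w i * \<beta> i)"
  define c' where "c' = deg \<beta> - zc \<beta>"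
  \<comment> \<open>\<open>Q\<close> is the bound from Eisenstein's theorem, \<open>wb + m\<close>
    keeps k below 2 q, and the remaining terms keep the numerator factorials below q.\<close>
  obtain q where q: "prime q" and qbig: "q > Q + wb + m * (zc \<beta> + c') + m * m + m"
    using bigger_prime by blast
  have bj: "\<beta> j < m" using b(1) by (simp add: box_def)
  \<comment> \<open>The least multiple m g that lifts coordinate \<open>j\<close> to at least q; by
    minimality the lifted coordinate stays below q + m.\<close>
  define g where "g = (LEAST g. q \<le> \<beta> j + m * g)"
  have ex: "\<exists>g. q \<le> \<beta> j + m * g" using m_pos by (intro exI[of _ q]) (simp add: trans_le_add2)
  have g1: "q \<le> \<beta> j + m * g" unfolding g_def using ex by (rule LeastI_ex)
  have gmin: "g \<le> t" if "q \<le> \<beta> j + m * t" for t unfolding g_def using that by (rule Least_le)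
  have g2: "\<beta> j + m * g < q + m"
  proof -
    have "g \<noteq> 0"
    proof
      assume "g = 0"
      then have "q \<le> \<beta> j" using g1 by simp
      then show False using bj qbig by simp
    qed
    then have "\<not> q \<le> \<beta> j + m * (g - 1)" using gmin[of "g - 1"] by auto
    moreover have "m * g = m * (g - 1) + m" using \<open>g \<noteq> 0\<close> by (cases g) auto
    ultimately show ?thesis by simp
  qed
  define \<alpha>0 where "\<alpha>0 = \<beta>(j := \<beta> j + m * g)"
  note rz = regular_zc[OF b(2)]
  have zd: "m dvd 1 + dotM \<beta>" using b(2) by (simp add: regular_def)
  have zc0: "zc \<alpha>0 = zc \<beta> + M j * g" unfolding \<alpha>0_def by (rule zc_add[OF zd])
  have dc0: "deg \<alpha>0 - zc \<alpha>0 = c' + (m - M j) * g"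
  proof -
    have "m * g = M j * g + (m - M j) * g" using M_le[of j] by (simp add: add_mult_distrib[symmetric])
    then have "deg \<alpha>0 = deg \<beta> + (M j * g + (m - M j) * g)" unfolding \<alpha>0_def deg_add by simp
    then show ?thesis unfolding zc0 c'_def using rz(3) by simp
  qed
  \<comment> \<open>From m g < q + m and y \<le> m - 1 follows m y g \<le> (m - 1)(q + m), and the
    slack q between (m - 1) q and m q absorbs all constants. It is applied with y = m_j and y = m -
    m_j.\<close>
  have small: "x + y * g \<le> q" if "y < m" "x \<le> zc \<beta> + c'" for x y
  proof -
    have "y \<le> m - 1" using that(1) by simp
    then have "y * (m * g) \<le> (m - 1) * (m * g)" by (rule mult_le_mono1)
    then have "m * (y * g) \<le> (m - 1) * (m * g)" by (simp only: mult.left_commute)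
    also have "\<dots> \<le> (m - 1) * (q + m)" using g2 by (intro mult_le_mono) auto
    finally have "m * (x + y * g) \<le> m * (zc \<beta> + c') + (m - 1) * (q + m)"
      using mult_le_mono2[OF that(2), of m] unfolding distrib_left[of m x] by (rule add_le_mono[rotated])
    also have "\<dots> \<le> m * (zc \<beta> + c') + (m - 1) * q + m * m"
      using mult_le_mono1[of "m - 1" m m] by (simp add: distrib_left)
    also have "\<dots> \<le> q + (m - 1) * q" using qbig by simp
    also have "\<dots> = m * q" using m_pos by (cases m) simp_all
    finally show ?thesis using m_pos by simp
  qed
  have c'1: "c' \<ge> 1" using rz(3) by (simp add: c'_def)
  have not: "\<not> qint q (gr \<alpha>0)"
  proof (rule gr_not_qint[OF q, of _ j])
    show "\<alpha>0 j \<ge> q" using g1 by (simp add: \<alpha>0_def)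
    show "zc \<alpha>0 - 1 < q" using small[of "M j" "zc \<beta>"] M_less[of j] rz(2) unfolding zc0 by simp
    show "deg \<alpha>0 - zc \<alpha>0 - 1 < q" using small[of "m - M j" c'] M_pos[of j] m_pos c'1 unfolding dc0 by simp
  qed
  have am0: "amod \<alpha>0 = \<beta>" using b(1) by (auto simp: amod_def \<alpha>0_def box_def fun_eq_iff)
  define k where "k = (\<Sum>i\<in>UNIV. w i * \<alpha>0 i)"
  have kval: "k = wb + m * g"
    unfolding k_def wb_def \<alpha>0_def by (simp add: sum.remove[of UNIV j] wj)
  \<comment> \<open>A coordinate i \<noteq> j of size q would push the weighted degree to 2 q,
    beyond k. A coordinate j of size q is at least that of \<open>\<alpha>0\<close> by minimality of
    g; then all coordinates dominate those of \<open>\<alpha>0\<close>, and equal weight forces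
    equality.\<close>
  have other: "qint q (fr \<alpha>)" if al: "\<alpha> \<in> lev k - {\<alpha>0}" for \<alpha>
  proof (cases "amod \<alpha> = \<beta>")
    case False
    then show ?thesis by (simp add: fr_def qint_0[OF q])
  next
    case True
    have wa: "(\<Sum>i\<in>UNIV. w i * \<alpha> i) = k" "\<alpha> \<noteq> \<alpha>0" using al by (auto simp: lev_def)
    have ge: "\<alpha> i \<ge> \<beta> i" for i using True by (auto simp: amod_def)
    have "\<alpha> i < q" for i
    proof (rule ccontr)
      assume "\<not> \<alpha> i < q"
      then have qi: "q \<le> \<alpha> i" by simp
      show False
      proof (cases "i = j")
        case False
        have "2 * q \<le> w i * \<alpha> i" using w2[OF False] qi by (rule mult_le_mono)
        also have "\<dots> \<le> k" unfolding wa(1)[symmetric] by (rule member_le_sum) auto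
        finally show False using kval g2 qbig by simp
      next
        case eq: True
        have "\<alpha> j = \<beta> j + m * (\<alpha> j div m)" using True by (auto simp: amod_def)
        moreover from this have "g \<le> \<alpha> j div m" using gmin qi eq by metis
        ultimately have "\<alpha> j \<ge> \<beta> j + m * g" by (metis add_le_cancel_left mult_le_mono2)
        then have ge0: "\<alpha> i \<ge> \<alpha>0 i" for i using ge by (simp add: \<alpha>0_def)
        have "\<alpha> = \<alpha>0"
        proof (rule ext, rule ccontr)
          fix i assume "\<alpha> i \<noteq> \<alpha>0 i"
          then have "\<alpha>0 i < \<alpha> i" using ge0[of i] by simp
          then have "(\<Sum>i\<in>UNIV. w i * \<alpha>0 i) < (\<Sum>i\<in>UNIV. w i * \<alpha> i)"
            using ge0 w by (intro sum_strict_mono_ex1) auto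
          then show False unfolding wa(1) k_def by simp
        qed
        then show False using wa(2) by simp
      qed
    qed
    then show ?thesis using True gr_qint[OF q] by (simp add: fr_def)
  qed
  have "\<alpha>0 \<in> lev k" by (simp add: lev_def k_def)
  then have "fps_nth FQ k = fr \<alpha>0 + (\<Sum>\<alpha>\<in>lev k - {\<alpha>0}. fr \<alpha>)"
    unfolding FQ_def by (simp add: sum.remove[OF flev])
  then have "fr \<alpha>0 = fps_nth FQ k - (\<Sum>\<alpha>\<in>lev k - {\<alpha>0}. fr \<alpha>)" by simp
  moreover have "qint q (fps_nth FQ k - (\<Sum>\<alpha>\<in>lev k - {\<alpha>0}. fr \<alpha>))"
    using qbig by (intro qint_diff[OF q] Q[OF q] qint_sum[OF q] other) auto
  ultimately show False using not am0 by (simp add: fr_def)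
qed

text \<open>The component of h in the class of \<beta> is again algebraic, and by the recursion it
  is a multiple of the component with coefficients \<open>gc\<close>, which is not
  algebraic.\<close>

lemma sols_algebraic_coef:
  assumes h: "h \<in> sols" "galg h" and b: "\<beta> \<in> box" "regular \<beta>"
  shows "coef h \<beta> = 0"
proof (rule ccontr)
  assume nz: "coef h \<beta> \<noteq> 0"
  define \<kappa> where "\<kappa> = gc \<beta> / coef h \<beta>"
  define f where "f = scale_germ \<kappa> (proj \<beta> h)"
  have an: "ganalytic h" using h(1) by (rule ganalytic_sols)
  have anf: "ganalytic f" unfolding f_def by (intro ganalytic_scale ganalytic_proj an)
  have "coef f \<alpha> = (if amod \<alpha> = \<beta> then gc \<alpha> else 0)" for \<alpha>
  proof (cases "amod \<alpha> = \<beta>")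
    case True
    have "\<kappa> * coef h \<alpha> = gc \<alpha>"
    proof (rule rec_determined[where u = "\<lambda>\<alpha>. \<kappa> * coef h \<alpha>"])
      show "mellin_rec_at m M (\<lambda>\<alpha>. \<kappa> * coef h \<alpha>) j \<gamma>" for j \<gamma> by (rule rec_scale) (use h(1) in \<open>simp add: sols_iff\<close>)
      show "mellin_rec_at m M gc j \<gamma>" if "amod \<gamma> = amod \<alpha>" for j \<gamma>
        by (rule gc_rec, rule regular_class) (use that True b(2) in simp)
      show "\<kappa> * coef h (amod \<alpha>) = gc (amod \<alpha>)" using True nz by (simp add: \<kappa>_def)
    qed
    then show ?thesis using True unfolding f_def by (simp add: coef_scale ganalytic_proj an coef_proj b)
  qed (simp add: f_def coef_scale ganalytic_proj an coef_proj b)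
  then have "\<not> galg f" by (rule regular_class_not_algebraic[OF b anf])
  moreover have "galg f"
  proof -
    obtain S p where S: "finite S" "\<exists>x\<in>S. p x \<noteq> 0" "(\<Sum>x\<in>S. scale_germ (p x) (gmon (fst x) * proj \<beta> h ^ snd x)) = 0"
      using galg_proj[OF h(2) an, of \<beta>] unfolding galg_def by auto
    have k0: "\<kappa> \<noteq> 0" using nz gc_nonzero by (simp add: \<kappa>_def)
    have "scale_germ (p x / \<kappa> ^ snd x) (gmon (fst x) * f ^ snd x) = scale_germ (p x) (gmon (fst x) * proj \<beta> h ^ snd x)" for x
      unfolding f_def scale_power using k0 by (simp add: scale_mult_right)
    then have "(\<Sum>x\<in>S. scale_germ (p x / \<kappa> ^ snd x) (gmon (fst x) * f ^ snd x)) = 0" using S(3) by simp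
    moreover have "\<exists>x\<in>S. p x / \<kappa> ^ snd x \<noteq> 0" using S(2) k0 by simp
    ultimately show ?thesis unfolding galg_def using S(1) by (intro exI[of _ S] exI[of _ "\<lambda>x. p x / \<kappa> ^ snd x"]) simp
  qed
  ultimately show False by simp
qed

lemma root_space_iff: "root_space m M = sols \<inter> algebraic_germs"
proof (intro set_eqI iffI)
  fix g assume "g \<in> root_space m M"
  then show "g \<in> sols \<inter> algebraic_germs"
    using root_space_algebraic[of g] unfolding algebraic_germs_iff[abs_def] root_space_eq span_phiB_iff
    by (auto simp: algebraic_germs_iff)
next
  fix g assume "g \<in> sols \<inter> algebraic_germs"
  then show "g \<in> root_space m M"
    using sols_algebraic_coef[of g] by (auto simp: root_space_eq span_phiB_iff algebraic_germs_iff)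
qed

end

section \<open>The full solution space\<close>

locale mellin_classes = mellin_data m M for m :: nat and M :: "'n::{finite,linorder} \<Rightarrow> nat" +
  fixes G :: "'k::finite \<Rightarrow> (int, 'n) vec set"
  assumes M_decreasing: "\<And>i j. i < j \<Longrightarrow> M j < M i"
    and coprime: "Gcd (insert m (range M)) = 1"
    and card_classes: "CARD('k) = m ^ (CARD('n) - 1)"
    and classes: "bij_betw G UNIV (index_box m // same_class m M)"
begin

text \<open>Representatives of the residue classes that survive summation over the m roots of one
  equation.\<close>

definition Z :: "('n \<Rightarrow> nat) set" where "Z = {\<beta>\<in>box. m dvd 1 + dotM \<beta>}"

definition Reg :: "('n \<Rightarrow> nat) set" where "Reg = {\<beta>\<in>box. regular \<beta>}"

text \<open>Coprimality enters here: m divides s m and all s m_i, hence s times their greatest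
  common divisor 1.\<close>

lemma dvd_if_dvd_all: "(\<And>i. m dvd s * M i) \<Longrightarrow> m dvd s"
proof -
  assume "\<And>i. m dvd s * M i"
  then have "m dvd Gcd ((*) s ` insert m (range M))" by (intro Gcd_greatest) auto
  then show "m dvd s" unfolding Gcd_mult coprime by simp
qed

lemma sum_box: "(\<Sum>\<beta>\<in>box. \<Prod>i\<in>UNIV. f i (\<beta> i)) = (\<Prod>i\<in>UNIV. \<Sum>k<m. f i k :: complex)"
proof -
  have b: "box = PiE UNIV (\<lambda>_. {..<m})" by (auto simp: box_def PiE_UNIV_domain)
  show ?thesis unfolding b by (rule prod_sum_PiE[symmetric]) auto
qed

text \<open>Divisibility by m is detected by a sum over m-th roots of unity. After exchanging the
  sums the contribution of s factors over the coordinates, and for s \<noteq> 0 some factor vanishes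
  because m does not divide every s m_i.\<close>

lemma card_Z: "card Z = m ^ (CARD('n) - 1)"
proof -
  have "of_nat (card Z * m) = (\<Sum>\<beta>\<in>box. if m dvd 1 + dotM \<beta> then of_nat m else (0 :: complex))"
    using finite_box by (simp add: Z_def sum.If_cases Int_def mult.commute)
  also have "\<dots> = (\<Sum>\<beta>\<in>box. \<Sum>s<m. om powi (int s * int (1 + dotM \<beta>)))"
    unfolding om_geometric int_dvd_int_iff ..
  also have "\<dots> = (\<Sum>s<m. \<Sum>\<beta>\<in>box. om powi (int s * int (1 + dotM \<beta>)))" by (rule sum.swap)
  also have "\<dots> = (\<Sum>s<m. if s = 0 then of_nat m ^ CARD('n) else 0)"
  proof (rule sum.cong)
    fix s assume s: "s \<in> {..<m}"
    have e: "om powi (int s * int (1 + dotM \<beta>)) = om ^ s * (\<Prod>i\<in>UNIV. om powi (int (\<beta> i) * (int s * int (M i))))" for \<beta>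
    proof -
      have "int s * int (1 + dotM \<beta>) = int s + (\<Sum>i\<in>UNIV. int (\<beta> i) * (int s * int (M i)))"
        by (simp add: dotM_def distrib_left sum_distrib_left mult_ac)
      then show ?thesis by (simp add: power_int_add om_nonzero power_int_sum)
    qed
    have "(\<Sum>\<beta>\<in>box. om powi (int s * int (1 + dotM \<beta>))) = om ^ s * (\<Prod>i\<in>UNIV. \<Sum>b<m. om powi (int b * (int s * int (M i))))"
      unfolding e sum_distrib_left[symmetric] by (simp only: sum_box[of "\<lambda>i b. om powi (int b * (int s * int (M i)))"])
    also have "\<dots> = (if s = 0 then of_nat m ^ CARD('n) else 0)"
    proof (cases "s = 0")
      case False
      then have "\<not> m dvd s" using s by (auto dest: dvd_imp_le)
      then obtain i where "\<not> m dvd s * M i" using dvd_if_dvd_all by blast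
      then have "\<not> int m dvd int s * int (M i)" by (simp only: of_nat_mult[symmetric] int_dvd_int_iff not_False_eq_True)
      then have "(\<Prod>i\<in>UNIV. \<Sum>b<m. om powi (int b * (int s * int (M i)))) = 0"
        by (intro prod_zero) (auto simp: om_geometric)
      then show ?thesis using False by simp
    qed simp
    finally show "(\<Sum>\<beta>\<in>box. om powi (int s * int (1 + dotM \<beta>))) = (if s = 0 then of_nat m ^ CARD('n) else 0)" .
  qed simp
  also have "\<dots> = of_nat (m ^ CARD('n))" using m_pos by simp
  finally have "card Z * m = m ^ CARD('n)" by (simp only: of_nat_eq_iff)
  also have "m ^ CARD('n) = m ^ (CARD('n) - 1) * m" by (simp add: power_Suc2[symmetric] del: power_Suc)
  finally show ?thesis using m_pos by simp
qed

text \<open>Divisibility without regularity means equality of 1 + dotM \<alpha> and m deg \<alpha>,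
  that is, the sum of all (m - m_i) \<alpha>_i is 1. So \<alpha> is a unit vector at an index with
  m_i = m - 1, which by monotonicity is the first one.\<close>

lemma exceptional_iff:
  "m dvd 1 + dotM \<alpha> \<and> \<not> regular \<alpha> \<longleftrightarrow> M (Min UNIV) = m - 1 \<and> \<alpha> = (\<lambda>_. 0)(Min UNIV := 1)"
proof -
  have "m dvd 1 + dotM \<alpha> \<and> \<not> regular \<alpha> \<longleftrightarrow> 1 + dotM \<alpha> = m * deg \<alpha>" by (auto simp: regular_def)
  also have "\<dots> \<longleftrightarrow> (\<Sum>i\<in>UNIV. (m - M i) * \<alpha> i) = 1" using dotM_compl[of \<alpha>] by linarith
  also have "\<dots> \<longleftrightarrow> (\<exists>i. (m - M i) * \<alpha> i = 1 \<and> (\<forall>b. i \<noteq> b \<longrightarrow> (m - M b) * \<alpha> b = 0))"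
    by (subst sum_eq_1_iff) auto
  also have "\<dots> \<longleftrightarrow> (\<exists>i. M i = m - 1 \<and> \<alpha> = (\<lambda>_. 0)(i := 1))"
  proof (intro ex_cong1 iffI)
    fix i assume a: "(m - M i) * \<alpha> i = 1 \<and> (\<forall>b. i \<noteq> b \<longrightarrow> (m - M b) * \<alpha> b = 0)"
    then have "\<alpha> b = 0" if "b \<noteq> i" for b using that M_less[of b] by auto
    with a show "M i = m - 1 \<and> \<alpha> = (\<lambda>_. 0)(i := 1)" by (auto simp: fun_eq_iff)
  next
    fix i assume "M i = m - 1 \<and> \<alpha> = (\<lambda>_. 0)(i := 1)"
    then show "(m - M i) * \<alpha> i = 1 \<and> (\<forall>b. i \<noteq> b \<longrightarrow> (m - M b) * \<alpha> b = 0)" using m_pos by auto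
  qed
  also have "\<dots> \<longleftrightarrow> M (Min UNIV) = m - 1 \<and> \<alpha> = (\<lambda>_. 0)(Min UNIV := 1)"
  proof -
    have eq: "i = Min UNIV" if "M i = m - 1" for i
    proof (rule ccontr)
      assume ne: "i \<noteq> Min UNIV"
      have "Min UNIV \<le> i" by (rule Min_le) simp_all
      with ne have "Min UNIV < i" unfolding less_le by simp
      then have "M i < M (Min UNIV)" by (rule M_decreasing)
      then show False using that M_less[of "Min UNIV"] by simp
    qed
    show ?thesis
    proof (rule iffI, elim exE conjE)
      fix i assume i: "M i = m - 1" "\<alpha> = (\<lambda>_. 0)(i := 1)"
      show "M (Min UNIV) = m - 1 \<and> \<alpha> = (\<lambda>_. 0)(Min UNIV := 1)"
        using i unfolding eq[OF i(1), symmetric] by (rule conjI)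
    qed (rule exI)
  qed
  finally show ?thesis .
qed

lemma exceptional_box: "m dvd 1 + dotM \<alpha> \<Longrightarrow> \<not> regular \<alpha> \<Longrightarrow> \<alpha> \<in> box"
  using exceptional_iff[of \<alpha>] m_ge2 by (auto simp: box_def)

lemma Reg_Z: "Reg \<subseteq> Z" and finite_Z: "finite Z" and finite_Reg: "finite Reg"
  using finite_box by (auto simp: Reg_def Z_def regular_def)

lemma card_Reg: "card Reg = (if M (Min UNIV) = m - 1 then m ^ (CARD('n) - 1) - 1 else m ^ (CARD('n) - 1))"
proof -
  have ZR: "Z - Reg = (if M (Min UNIV) = m - 1 then {(\<lambda>_. 0)(Min UNIV := 1)} else {})"
    using exceptional_iff exceptional_box by (auto simp: Z_def Reg_def)
  have "card Reg = card Z - card (Z - Reg)"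
    using card_Diff_subset[OF finite_Reg Reg_Z] card_mono[OF finite_Z Reg_Z] by simp
  then show ?thesis unfolding card_Z ZR by simp
qed

lemma card_NR: "card NR = (if M (Min UNIV) = m - 1 then m ^ CARD('n) - m ^ (CARD('n) - 1) + 1
    else m ^ CARD('n) - m ^ (CARD('n) - 1))"
proof -
  have "NR = box - Reg" by (auto simp: NR_def Reg_def)
  moreover have "Reg \<subseteq> box" by (auto simp: Reg_def)
  ultimately have "card NR = m ^ CARD('n) - card Reg"
    using card_Diff_subset[OF finite_Reg, of box] by (simp add: card_box)
  moreover have "m ^ (CARD('n) - 1) \<ge> 1" "m ^ (CARD('n) - 1) \<le> m ^ CARD('n)"
    using m_pos by (auto intro: power_increasing)
  ultimately show ?thesis unfolding card_Reg by (simp add: Suc_diff_le)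
qed

section \<open>Classes of equations and the characters they determine\<close>

lemma equiv_same_class: "equiv (index_box m) (same_class m M)"
proof (rule equivI)
  show "same_class m M \<subseteq> index_box m \<times> index_box m" by (auto simp: same_class_def)
  show "refl_on (index_box m) (same_class m M)"
    by (auto simp: refl_on_def same_class_def intro!: exI[of _ 0])
  show "sym (same_class m M)"
  proof (rule symI)
    fix I J assume "(I, J) \<in> same_class m M"
    then obtain t where t: "I \<in> index_box m" "J \<in> index_box m" "\<And>i. [I $ i - J $ i = t * int (M i)] (mod int m)"
      unfolding same_class_def by auto
    have "[J $ i - I $ i = (- t) * int (M i)] (mod int m)" for i
      using t(3)[of i] cong_minus_minus_iff[of "I $ i - J $ i" "t * int (M i)" "int m"] by simp
    then show "(J, I) \<in> same_class m M" using t(1,2) unfolding same_class_def by blast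
  qed
  show "trans (same_class m M)"
  proof (rule transI)
    fix I J K assume "(I, J) \<in> same_class m M" "(J, K) \<in> same_class m M"
    then obtain t s where t: "I \<in> index_box m" "K \<in> index_box m"
      "\<And>i. [I $ i - J $ i = t * int (M i)] (mod int m)" "\<And>i. [J $ i - K $ i = s * int (M i)] (mod int m)"
      unfolding same_class_def by auto
    have "[I $ i - K $ i = (t + s) * int (M i)] (mod int m)" for i
      using cong_add[OF t(3)[of i] t(4)[of i]] by (simp add: distrib_right)
    then show "(I, K) \<in> same_class m M" using t(1,2) unfolding same_class_def by blast
  qed
qed

lemma G_quotient: "G k \<in> index_box m // same_class m M"
  using classes by (auto simp: bij_betw_def)

lemma sum_classes: "(\<Sum>J\<in>index_box m. f J) = (\<Sum>k\<in>UNIV. \<Sum>J\<in>G k. f J)"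
proof -
  have U: "(\<Union>k. G k) = index_box m"
    using classes Union_quotient[OF equiv_same_class] by (simp add: bij_betw_def)
  have fin: "finite (G k)" for k using finite_index_box U by (metis UN_upper finite_subset UNIV_I)
  have disj: "G k \<inter> G l = {}" if "k \<noteq> l" for k l
  proof -
    have "G k \<noteq> G l" using classes that by (auto simp: bij_betw_def inj_on_def)
    then show ?thesis using quotient_disj[OF equiv_same_class G_quotient G_quotient] by blast
  qed
  show ?thesis unfolding U[symmetric] by (rule sum.UNION_disjoint) (use fin disj in auto)
qed

text \<open>J and I differ by t (m_1, ..., m_n) modulo m, so the exponents differ by t times a
  multiple of m, again modulo m. The condition on d holds for differences of elements of
  \<open>Z\<close>.\<close>

lemma chr_class:
  assumes J: "J \<in> G k" "I \<in> G k" and d: "int m dvd (\<Sum>i\<in>UNIV. int (M i) * d i)"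
  shows "chr J d = chr I d"
proof -
  have "(J, I) \<in> same_class m M"
    using quotient_eq_iff[OF equiv_same_class G_quotient G_quotient J(1) J(2)] by simp
  then obtain t where t: "\<And>i. [J $ i - I $ i = t * int (M i)] (mod int m)" unfolding same_class_def by auto
  have "int m dvd (J $ i - I $ i) - t * int (M i)" for i using t[of i] by (simp add: cong_iff_dvd_diff)
  then have "int m dvd (\<Sum>i\<in>UNIV. ((J $ i - I $ i) - t * int (M i)) * d i)" by (intro dvd_sum dvd_mult2) simp
  moreover have "(\<Sum>i\<in>UNIV. ((J $ i - I $ i) - t * int (M i)) * d i) =
     ((\<Sum>i\<in>UNIV. J $ i * d i) - (\<Sum>i\<in>UNIV. I $ i * d i)) - t * (\<Sum>i\<in>UNIV. int (M i) * d i)"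
    by (simp add: left_diff_distrib sum_subtractf sum_distrib_left mult.assoc)
  ultimately have 1: "int m dvd ((\<Sum>i\<in>UNIV. J $ i * d i) - (\<Sum>i\<in>UNIV. I $ i * d i)) - t * (\<Sum>i\<in>UNIV. int (M i) * d i)"
    by (simp only:)
  have "int m dvd t * (\<Sum>i\<in>UNIV. int (M i) * d i)" using d by (rule dvd_mult)
  from dvd_add[OF 1 this] have "int m dvd (\<Sum>i\<in>UNIV. J $ i * d i) - (\<Sum>i\<in>UNIV. I $ i * d i)"
    by (simp only: diff_add_cancel)
  then have "om powi ((\<Sum>i\<in>UNIV. J $ i * d i) - (\<Sum>i\<in>UNIV. I $ i * d i)) = 1" unfolding om_powi_eq_1 .
  then show ?thesis unfolding chr_def by (simp add: power_int_diff om_nonzero)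
qed

end

locale mellin_roots = mellin_classes m M G
  for m :: nat and M :: "'n::{finite,linorder} \<Rightarrow> nat" and G :: "'k::finite \<Rightarrow> (int, 'n) vec set" +
  fixes Isel :: "'k \<Rightarrow> (int, 'n) vec" and y :: "'k \<Rightarrow> nat \<Rightarrow> (complex, 'n) vec \<Rightarrow> complex"
  assumes Isel: "\<And>k. Isel k \<in> G k"
    and roots: "\<And>k. bij_betw (\<lambda>j. germ (y k j)) {1..m} (root_germs m M (Isel k))"
begin

text \<open>The Fourier transform of c; by \<open>coef_tw\<close> the vector c enters the
  coefficients of root sums and of their logarithmic analogues only through it.\<close>

definition hat :: "complex^'k \<Rightarrow> ('n \<Rightarrow> nat) \<Rightarrow> complex" where
  "hat c \<alpha> = (\<Sum>k\<in>UNIV. c $ k * chr (Isel k) (int \<circ> \<alpha>))"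

text \<open>The dual family: on \<open>Z\<close> the transform of \<open>vv \<beta>\<close> is
  concentrated at \<beta>. The weight \<open>card (G k)\<close> lets the selected equation stand for
  its whole class.\<close>

definition vv :: "('n \<Rightarrow> nat) \<Rightarrow> complex^'k" where
  "vv \<beta> = (\<chi> k. of_nat (card (G k)) * chr (Isel k) (\<lambda>i. - int (\<beta> i)))"

lemma hat_amod: "hat c \<alpha> = hat c (amod \<alpha>)"
  unfolding hat_def by (subst chr_amod) rule

lemma hat_add: "hat (c + d) \<alpha> = hat c \<alpha> + hat d \<alpha>" and hat_scale: "hat (a *s c) \<alpha> = a * hat c \<alpha>"
  and hat_0: "hat 0 \<alpha> = 0"
  by (simp_all add: hat_def distrib_right sum.distrib sum_distrib_left mult.assoc)

lemma hat_sum: "hat (\<Sum>i\<in>A. f i) \<alpha> = (\<Sum>i\<in>A. hat (f i) \<alpha>)"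
  by (induction A rule: infinite_finite_induct) (simp_all add: hat_0 hat_add)

text \<open>Differences of elements of \<open>Z\<close> are admissible in \<open>chr_class\<close>,
  so each class contributes the sum over all its members, and the total is a full character sum over
  the index box.\<close>

lemma hat_vv:
  assumes "\<beta> \<in> Z" "\<gamma> \<in> Z"
  shows "hat (vv \<beta>) \<gamma> = (if \<gamma> = \<beta> then of_nat m ^ CARD('n) else 0)"
proof -
  let ?d = "\<lambda>i. int (\<gamma> i) - int (\<beta> i)"
  have dv: "int m dvd int (1 + dotM \<delta>)" if "\<delta> \<in> Z" for \<delta>
    using that unfolding int_dvd_int_iff Z_def by simp
  have "int m dvd int (1 + dotM \<gamma>) - int (1 + dotM \<beta>)"
    by (rule dvd_diff[OF dv[OF assms(2)] dv[OF assms(1)]])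
  then have d: "int m dvd (\<Sum>i\<in>UNIV. int (M i) * ?d i)"
    by (simp add: dotM_def right_diff_distrib sum_subtractf)
  have "hat (vv \<beta>) \<gamma> = (\<Sum>k\<in>UNIV. of_nat (card (G k)) * chr (Isel k) ?d)"
    unfolding hat_def vv_def
  proof (rule sum.cong)
    fix k
    show "(\<chi> k. of_nat (card (G k)) * chr (Isel k) (\<lambda>i. - int (\<beta> i))) $ k * chr (Isel k) (int \<circ> \<gamma>) =
      of_nat (card (G k)) * chr (Isel k) ?d"
      using chr_add[of "Isel k" "\<lambda>i. - int (\<beta> i)" "int \<circ> \<gamma>"] by simp
  qed simp
  also have "\<dots> = (\<Sum>k\<in>UNIV. \<Sum>J\<in>G k. chr J ?d)"
  proof (rule sum.cong)
    fix k
    have "(\<Sum>J\<in>G k. chr J ?d) = (\<Sum>J\<in>G k. chr (Isel k) ?d)"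
      by (rule sum.cong) (use chr_class[OF _ Isel d] in auto)
    then show "of_nat (card (G k)) * chr (Isel k) ?d = (\<Sum>J\<in>G k. chr J ?d)" by simp
  qed simp
  also have "\<dots> = (\<Sum>J\<in>index_box m. chr J ?d)" by (rule sum_classes[symmetric])
  also have "\<dots> = (if \<gamma> = \<beta> then of_nat m ^ CARD('n) else 0)"
    unfolding sum_chr using dvd_amod[of \<beta> \<gamma>] amod_id[of \<gamma>] assms by (simp add: Z_def)
  finally show ?thesis .
qed

lemma vv_independent: "inj_on vv Z" "vec.independent (vv ` Z)"
proof -
  have mn: "(of_nat m :: complex) ^ CARD('n) \<noteq> 0" using m_nz by simp
  show inj: "inj_on vv Z"
  proof (rule inj_onI, rule ccontr)
    fix a b assume "a \<in> Z" "b \<in> Z" "vv a = vv b" "a \<noteq> b"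
    then show False using hat_vv[of a a] hat_vv[of b a] mn by simp
  qed
  show "vec.independent (vv ` Z)"
  proof
    assume "vec.dependent (vv ` Z)"
    then obtain u b where u: "b \<in> Z" "u (vv b) \<noteq> 0" "(\<Sum>v\<in>vv ` Z. u v *s v) = 0"
      using finite_Z by (auto simp: vec.dependent_finite)
    have "0 = hat (\<Sum>c\<in>Z. u (vv c) *s vv c) b" using u(3) by (simp add: sum.reindex[OF inj] hat_0)
    also have "\<dots> = (\<Sum>c\<in>Z. if b = c then u (vv b) * of_nat m ^ CARD('n) else 0)"
      unfolding hat_sum hat_scale by (rule sum.cong) (auto simp: hat_vv u(1))
    also have "\<dots> = u (vv b) * of_nat m ^ CARD('n)" using finite_Z u(1) by simp
    finally show False using u(2) mn by simp
  qed
qed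

text \<open>By \<open>card_Z\<close> and \<open>card_classes\<close> the independent family has as
  many members as the coefficient space has dimensions.\<close>

lemma vv_span: "vec.span (vv ` Z) = UNIV"
proof -
  have "vec.dim (UNIV :: (complex^'k) set) \<le> card (vv ` Z)"
    unfolding vec_dim_card card_image[OF vv_independent(1)] card_Z card_classes ..
  then show ?thesis using vec.card_ge_dim_independent[OF subset_UNIV vv_independent(2)] by blast
qed

lemma vv_expand: "c = (\<Sum>\<beta>\<in>Z. (hat c \<beta> / of_nat m ^ CARD('n)) *s vv \<beta>)"
proof -
  have mn: "(of_nat m :: complex) ^ CARD('n) \<noteq> 0" using m_nz by simp
  have "c \<in> vec.span (vv ` Z)" by (simp add: vv_span)
  then obtain u where u: "c = (\<Sum>v\<in>vv ` Z. u v *s v)"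
    using vec.span_finite[of "vv ` Z"] finite_Z by auto
  then have c: "c = (\<Sum>\<beta>\<in>Z. u (vv \<beta>) *s vv \<beta>)" by (simp add: sum.reindex[OF vv_independent(1)])
  have "hat c \<beta> = u (vv \<beta>) * of_nat m ^ CARD('n)" if "\<beta> \<in> Z" for \<beta>
  proof -
    have "hat c \<beta> = (\<Sum>\<gamma>\<in>Z. if \<beta> = \<gamma> then u (vv \<beta>) * of_nat m ^ CARD('n) else 0)"
      by (subst c) (auto simp: hat_sum hat_scale hat_vv \<open>\<beta> \<in> Z\<close> intro!: sum.cong)
    then show ?thesis using finite_Z \<open>\<beta> \<in> Z\<close> by simp
  qed
  then have "(\<Sum>\<beta>\<in>Z. (hat c \<beta> / of_nat m ^ CARD('n)) *s vv \<beta>) = (\<Sum>\<beta>\<in>Z. u (vv \<beta>) *s vv \<beta>)"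
    using mn by (intro sum.cong) auto
  then show ?thesis using c by simp
qed

section \<open>Sums over the roots of one equation\<close>

lemma chr_shiftM: "om ^ s * chr (shiftM I s) (int \<circ> \<alpha>) = chr I (int \<circ> \<alpha>) * om powi (int s * int (1 + dotM \<alpha>))"
proof -
  have "(\<Sum>i\<in>UNIV. shiftM I s $ i * (int \<circ> \<alpha>) i) = (\<Sum>i\<in>UNIV. I $ i * (int \<circ> \<alpha>) i) + int s * int (dotM \<alpha>)"
    by (simp add: shiftM_def dotM_def distrib_right sum.distrib sum_distrib_left mult.assoc)
  moreover have "int s * int (1 + dotM \<alpha>) = int s + int s * int (dotM \<alpha>)" by (simp add: distrib_left)
  ultimately show ?thesis unfolding chr_def by (simp add: power_int_add om_nonzero mult_ac)
qed

text \<open>Running through the m roots of one equation is a geometric sum in \<epsilon>^(1 + dotM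
  \<alpha>).\<close>

lemma sum_chr_shiftM:
  "(\<Sum>s<m. om ^ s * chr (shiftM I s) (int \<circ> \<alpha>)) = chr I (int \<circ> \<alpha>) * (if m dvd 1 + dotM \<alpha> then of_nat m else 0)"
  unfolding chr_shiftM sum_distrib_left[symmetric] om_geometric int_dvd_int_iff ..

text \<open>For \<open>phi\<close> this is the combination of root sums that defines the relations;
  for \<open>psi\<close> it is \<chi>_c up to an element of the root space.\<close>

definition tw :: "'n germ \<Rightarrow> complex^'k \<Rightarrow> 'n germ" where
  "tw g c = (\<Sum>k\<in>UNIV. scale_germ (c $ k) (\<Sum>s<m. scale_germ (om ^ s) (udil (shiftM (Isel k) s) g)))"

lemma ganalytic_tw: "ganalytic g \<Longrightarrow> ganalytic (tw g c)"
  unfolding tw_def by (intro ganalytic_intros ganalytic_udil)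

lemma coef_tw:
  assumes "ganalytic g"
  shows "coef (tw g c) \<alpha> = hat c \<alpha> * ((if m dvd 1 + dotM \<alpha> then of_nat m else 0) * coef g \<alpha>)"
proof -
  have "coef (tw g c) \<alpha> = (\<Sum>k\<in>UNIV. c $ k * ((\<Sum>s<m. om ^ s * chr (shiftM (Isel k) s) (int \<circ> \<alpha>)) * coef g \<alpha>))"
    unfolding tw_def using assms
    by (simp add: coef_sum coef_scale coef_udil ganalytic_udil ganalytic_scale ganalytic_sum sum_distrib_right mult.assoc)
  also have "\<dots> = hat c \<alpha> * ((if m dvd 1 + dotM \<alpha> then of_nat m else 0) * coef g \<alpha>)"
    unfolding sum_chr_shiftM hat_def sum_distrib_right by (rule sum.cong) (simp_all only: mult.assoc)
  finally show ?thesis .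
qed

lemma germ_lincomb: "germ (\<lambda>x. \<Sum>k\<in>UNIV. c k * (\<Sum>j\<in>A. F k j x)) = (\<Sum>k\<in>UNIV. scale_germ (c k) (\<Sum>j\<in>A. germ (F k j)))"
  unfolding germ_sum by (simp add: scale_germ.abs_eq[symmetric] germ_sum)

lemma sum_roots: "(\<Sum>j=1..m. H (germ (y k j))) = (\<Sum>s<m. H (rt (Isel k) s))"
proof -
  have "(\<Sum>j=1..m. H (germ (y k j))) = (\<Sum>g\<in>root_germs m M (Isel k). H g)"
    by (rule sum.reindex_bij_betw[OF roots])
  also have "\<dots> = (\<Sum>s<m. H (rt (Isel k) s))"
    unfolding root_germs_eq by (simp add: sum.reindex[OF inj_rt])
  finally show ?thesis .
qed

text \<open>The coefficients of the combination are m times \<open>hat c\<close> times those of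
  \<open>phi\<close> where m divides 1 + dotM \<alpha>, and 0 elsewhere. Those of \<open>phi\<close>
  vanish at regular indices, so a condition is left only at the exceptional index, if there is
  one.\<close>

lemma root_relations_iff: "c \<in> root_relations m y \<longleftrightarrow> (\<forall>\<beta>\<in>Z - Reg. hat c \<beta> = 0)"
proof -
  have "c \<in> root_relations m y \<longleftrightarrow> germ (\<lambda>x. \<Sum>k\<in>UNIV. c $ k * (\<Sum>j=1..m. y k j x)) = 0"
    unfolding root_relations_def zero_germ_def germ.abs_eq_iff germ_eq_def by simp
  also have "germ (\<lambda>x. \<Sum>k\<in>UNIV. c $ k * (\<Sum>j=1..m. y k j x)) = tw phi c"
    unfolding germ_lincomb sum_roots[of "\<lambda>g. g"] tw_def rt_def ..
  also have "tw phi c = 0 \<longleftrightarrow> (\<forall>\<alpha>. coef (tw phi c) \<alpha> = 0)"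
    using coef_eq_0_imp_eq_0[OF ganalytic_tw[OF phi(1)]] by (auto simp: coef_0)
  also have "\<dots> \<longleftrightarrow> (\<forall>\<beta>\<in>Z - Reg. hat c \<beta> = 0)"
  proof -
    have "coef (tw phi c) \<alpha> = 0 \<longleftrightarrow> (m dvd 1 + dotM \<alpha> \<and> \<not> regular \<alpha> \<longrightarrow> hat c \<alpha> = 0)" for \<alpha>
      unfolding coef_tw[OF phi(1)] using m_nz coef_phi_eq_0_iff[of \<alpha>] by auto
    moreover have "m dvd 1 + dotM \<alpha> \<and> \<not> regular \<alpha> \<longleftrightarrow> \<alpha> \<in> Z - Reg" for \<alpha>
      using exceptional_box[of \<alpha>] by (auto simp: Z_def Reg_def)
    ultimately show ?thesis by auto
  qed
  finally show ?thesis .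
qed

lemma root_relations_eq: "root_relations m y = vec.span (vv ` Reg)"
proof
  show "root_relations m y \<subseteq> vec.span (vv ` Reg)"
  proof
    fix c assume c: "c \<in> root_relations m y"
    have "(\<Sum>\<beta>\<in>Z. (hat c \<beta> / of_nat m ^ CARD('n)) *s vv \<beta>) = (\<Sum>\<beta>\<in>Reg. (hat c \<beta> / of_nat m ^ CARD('n)) *s vv \<beta>)"
      using c Reg_Z finite_Z by (intro sum.mono_neutral_right) (auto simp: root_relations_iff)
    then have "c = (\<Sum>\<beta>\<in>Reg. (hat c \<beta> / of_nat m ^ CARD('n)) *s vv \<beta>)" using vv_expand[of c] by metis
    then show "c \<in> vec.span (vv ` Reg)"
      by (metis (no_types, lifting) vec.span_sum vec.span_scale vec.span_base imageI)
  qed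
  show "vec.span (vv ` Reg) \<subseteq> root_relations m y"
  proof (rule vec.span_minimal)
    show "vv ` Reg \<subseteq> root_relations m y"
      using Reg_Z by (auto simp: root_relations_iff hat_vv subset_iff)
    show "vec.subspace (root_relations m y)"
      by (auto simp: vec.subspace_def root_relations_iff hat_0 hat_add hat_scale)
  qed
qed

lemma dim_root_relations: "vec.dim (root_relations m y) = card Reg"
proof -
  have "vec.independent (vv ` Reg)" using vv_independent(2) Reg_Z vec.independent_mono by blast
  then have "vec.dim (root_relations m y) = card (vv ` Reg)"
    unfolding root_relations_eq vec.dim_span by (rule vec.dim_eq_card_independent)
  also have "\<dots> = card Reg" using vv_independent(1) Reg_Z by (intro card_image) (rule inj_on_subset)
  finally show ?thesis .
qed

text \<open>On a class with regular representative the coefficients are a constant times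
  \<open>gc\<close>, since \<open>hat c\<close> depends only on the class. On the remaining classes
  they all vanish.\<close>

lemma tw_psi_sols:
  assumes "c \<in> root_relations m y"
  shows "tw psi c \<in> sols"
  unfolding sols_iff
proof (intro conjI allI)
  show "ganalytic (tw psi c)" by (rule ganalytic_tw[OF ganalytic_psi])
  fix j :: 'n and \<alpha> :: "'n \<Rightarrow> nat"
  let ?\<alpha>' = "\<alpha>(j := \<alpha> j + m)"
  have h': "hat c ?\<alpha>' = hat c \<alpha>" using hat_amod[of c ?\<alpha>'] hat_amod[of c \<alpha>] by (simp only: amod_add)
  show "mellin_rec_at m M (coef (tw psi c)) j \<alpha>"
  proof (cases "regular (amod \<alpha>)")
    case True
    define \<kappa> where "\<kappa> = - hat c \<alpha> / of_nat m"
    have r: "regular \<alpha>" "regular ?\<alpha>'" using regular_class[OF True] regular_add by blast+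
    have e: "coef (tw psi c) \<gamma> = \<kappa> * gc \<gamma>" if "regular \<gamma>" "hat c \<gamma> = hat c \<alpha>" for \<gamma>
      unfolding coef_tw[OF ganalytic_psi] coef_psi_regular[OF that(1)] that(2)
      using that(1) m_nz by (simp add: \<kappa>_def regular_def power2_eq_square)
    have "mellin_rec_at m M (\<lambda>\<alpha>. \<kappa> * gc \<alpha>) j \<alpha>" by (rule rec_scale[OF gc_rec[OF r(1)]])
    then show ?thesis unfolding mellin_rec_at_eq e[OF r(1) refl] e[OF r(2) h'] .
  next
    case False
    have z: "coef (tw psi c) \<gamma> = 0" if "amod \<gamma> = amod \<alpha>" for \<gamma>
    proof (cases "m dvd 1 + dotM \<gamma>")
      case True
      have d1: "int m dvd int (1 + dotM \<gamma>) - int (1 + dotM (amod \<gamma>))"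
      proof -
        have "int (1 + dotM \<gamma>) - int (1 + dotM (amod \<gamma>)) = (\<Sum>i\<in>UNIV. int (M i) * (int (\<gamma> i) - int (\<gamma> i mod m)))"
          by (simp add: dotM_def amod_def right_diff_distrib sum_subtractf)
        also have "int m dvd \<dots>" by (intro dvd_sum dvd_mult) (simp add: zmod_int minus_mod_eq_mult_div)
        finally show ?thesis .
      qed
      have d2: "int m dvd int (1 + dotM \<gamma>)" using True by (simp only: int_dvd_int_iff)
      have "x - (x - z) = z" for x z :: int by simp
      then have "int m dvd int (1 + dotM (amod \<gamma>))" using dvd_diff[OF d2 d1] by (simp only:)
      then have "m dvd 1 + dotM (amod \<gamma>)" by (simp only: int_dvd_int_iff)
      \<comment> \<open>The index \<gamma> itself may be regular although its representative is
        exceptional, so \<open>psi\<close> can have a coefficient there; the relation on c removes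
        it.\<close>
      then have "amod \<gamma> \<in> Z - Reg" using False amod_box that by (simp add: Z_def Reg_def)
      then have "hat c \<gamma> = 0" using assms hat_amod[of c \<gamma>] by (simp add: root_relations_iff)
      then show ?thesis unfolding coef_tw[OF ganalytic_psi] by simp
    qed (simp add: coef_tw[OF ganalytic_psi])
    show ?thesis unfolding mellin_rec_at_eq z[OF refl] z[OF amod_add] by simp
  qed
qed

text \<open>Along the root, the branch \<open>L\<close> and the principal logarithm of the dilated
  \<open>phi\<close> differ by a continuous function whose exponential is the constant \<epsilon>^s;
  such a function is constant near the origin, which gives \<kappa>.\<close>

lemma log_root_germ:
  assumes L: "log_branch_on Vs L" and f: "germ f = rt I s" and fV: "\<forall>\<^sub>F x in nhds 0. f x \<in> Vs"
  shows "\<exists>\<kappa>. germ (\<lambda>x. f x * L (f x)) = scale_germ (om ^ s) (udil (shiftM I s) psi) + scale_germ \<kappa> (rt I s)"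
proof -
  obtain F where F: "phi = germ F" by (rule germ_cases)
  define u where "u = (\<lambda>i. om powi (shiftM I s $ i))"
  define E where "E x = F (\<chi> i. u i * x $ i)" for x
  have LamF: "Lam = germ (\<lambda>x. Ln (F x))" by (rule Lam(4)[OF F])
  have uphi: "udil (shiftM I s) phi = germ E" by (simp add: udil_def F dil.abs_eq u_def E_def[abs_def])
  have uLam: "udil (shiftM I s) Lam = germ (\<lambda>x. Ln (E x))" by (simp add: udil_def LamF dil.abs_eq u_def E_def[abs_def])
  have rtE: "rt I s = germ (\<lambda>x. om ^ s * E x)" by (simp add: rt_def uphi scale_germ.abs_eq)
  have ev: "\<forall>\<^sub>F x in nhds 0. f x = om ^ s * E x"
    using f unfolding rtE germ.abs_eq_iff germ_eq_def .
  have cont: "isCont h 0" if "ganalytic (germ h)" for h :: "(complex, 'n) vec \<Rightarrow> complex"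
  proof -
    obtain A where "0 \<in> A" "mholo_on h A" using \<open>ganalytic (germ h)\<close> by (auto simp: ganalytic.abs_eq analytic_near_0_iff)
    then show ?thesis using mholo_on_continuous[of h A] by (simp add: mholo_on_def continuous_on_eq_continuous_at)
  qed
  have cf: "isCont f 0" by (rule cont) (simp add: f ganalytic_rt)
  have cE: "isCont E 0" by (rule cont) (simp add: uphi[symmetric] ganalytic_udil phi)
  have cLE: "isCont (\<lambda>x. Ln (E x)) 0" by (rule cont) (simp add: uLam[symmetric] ganalytic_udil Lam)
  have E0: "E 0 = 1"
  proof -
    have "ev0 (germ E) = 1" unfolding uphi[symmetric] udil_def by (simp add: ev0_dil phi)
    then show ?thesis by (simp add: ev0.abs_eq)
  qed
  have f0V: "f 0 \<in> Vs" using fV by (rule eventually_nhds_x_imp_x)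
  have Lprop: "open Vs" "L holomorphic_on Vs" "\<And>z. z \<in> Vs \<Longrightarrow> exp (L z) = z"
    using L by (auto simp: log_branch_on_def)
  have cLf: "isCont (\<lambda>x. L (f x)) 0"
  proof (rule isCont_o2[OF cf])
    show "isCont L (f 0)"
      using holomorphic_on_imp_continuous_on[OF Lprop(2)] Lprop(1) f0V by (simp add: continuous_on_eq_continuous_at)
  qed
  define d where "d x = L (f x) - Ln (E x)" for x
  have cd: "isCont d 0" unfolding d_def using cLf cLE by (rule continuous_diff)
  have evE: "\<forall>\<^sub>F x in nhds 0. E x \<noteq> 0"
  proof (rule tendsto_imp_eventually_ne)
    show "(E \<longlongrightarrow> E 0) (nhds 0)" using cE unfolding isCont_def tendsto_at_iff_tendsto_nhds .
    show "E 0 \<noteq> 0" using E0 by simp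
  qed
  have expd: "\<forall>\<^sub>F x in nhds 0. exp (d x) = om ^ s"
    using ev evE fV
  proof eventually_elim
    case (elim x)
    then show ?case using Lprop(3)[of "f x"] by (simp add: d_def exp_diff)
  qed
  have "\<forall>\<^sub>F x in nhds 0. dist (d x) (d 0) < 1"
    using cd unfolding isCont_def tendsto_at_iff_tendsto_nhds by (rule tendstoD) simp
  then have const: "\<forall>\<^sub>F x in nhds 0. d x = d 0"
    using expd
  proof eventually_elim
    case (elim x)
    \<comment> \<open>The imaginary parts differ by less than 1, hence by less than 2 \<pi>, so
      equal exponentials force equal values.\<close>
    have "\<bar>Im (d x) - Im (d 0)\<bar> \<le> dist (d x) (d 0)" unfolding dist_norm minus_complex.simps[symmetric] by (rule abs_Im_le_cmod)
    then have "\<bar>Im (d x) - Im (d 0)\<bar> < 2 * pi" using elim(1) pi_gt3 by linarith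
    moreover have "exp (d x) = exp (d 0)" using elim(2) eventually_nhds_x_imp_x[OF expd] by simp
    ultimately show ?case by (rule exp_complex_eqI)
  qed
  have "\<forall>\<^sub>F x in nhds 0. f x * L (f x) = om ^ s * (E x * Ln (E x)) + d 0 * (om ^ s * E x)"
    using ev const
  proof eventually_elim
    case (elim x)
    have "L (f x) = Ln (E x) + d 0" using elim(2) by (simp add: d_def algebra_simps)
    then have "f x * L (f x) = om ^ s * E x * (Ln (E x) + d 0)" using elim(1) by simp
    then show ?case by (simp add: algebra_simps)
  qed
  then have "germ (\<lambda>x. f x * L (f x)) = germ (\<lambda>x. om ^ s * (E x * Ln (E x)) + d 0 * (om ^ s * E x))"
    unfolding germ.abs_eq_iff germ_eq_def .
  also have "\<dots> = scale_germ (om ^ s) (germ E * germ (\<lambda>x. Ln (E x))) + scale_germ (d 0) (rt I s)"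
    unfolding rtE by (simp add: plus_germ.abs_eq scale_germ.abs_eq times_germ.abs_eq)
  also have "germ E * germ (\<lambda>x. Ln (E x)) = udil (shiftM I s) psi"
    unfolding uphi[symmetric] uLam[symmetric] psi_def udil_def by (rule dil_mult[symmetric])
  finally show ?thesis by blast
qed

context
  fixes Vs :: "complex set" and L :: "complex \<Rightarrow> complex"
  assumes L: "log_branch_on Vs L" and yV: "\<And>k j. j \<in> {1..m} \<Longrightarrow> \<forall>\<^sub>F x in nhds 0. y k j x \<in> Vs"
begin

section \<open>The space of the functions \<chi>_c\<close>

lemma rt_root_space: "rt (Isel k) s \<in> root_space m M"
  unfolding root_space_eq span_phiB_iff by (auto simp: rt_sols coef_rt coef_phi_eq_0_iff)

lemma subspace_root_space: "germ.subspace (root_space m M)"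
  unfolding root_space_def by (rule germ.subspace_span)

lemma chi_germ_decomp: "\<exists>r\<in>root_space m M. chi_germ m y L c = tw psi c + r"
proof -
  define psis where "psis k s = scale_germ (om ^ s) (udil (shiftM (Isel k) s) psi)" for k s
  \<comment> \<open>The numbering of the roots \<open>y k j\<close> by j is arbitrary;
    \<open>ind\<close> translates a root germ into its exponent s.\<close>
  define ind where "ind k = inv_into {..<m} (rt (Isel k))" for k
  have ind: "germ (y k j) = rt (Isel k) (ind k (germ (y k j)))" if "j \<in> {1..m}" for k j
  proof -
    have "germ (y k j) \<in> root_germs m M (Isel k)" using roots[of k] that by (auto simp: bij_betw_def)
    then show ?thesis unfolding ind_def root_germs_eq by (simp only: f_inv_into_f)
  qed
  have ex: "\<exists>\<kappa>. germ (\<lambda>x. y k j x * L (y k j x)) = psis k (ind k (germ (y k j))) + scale_germ \<kappa> (rt (Isel k) (ind k (germ (y k j))))"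
    if "j \<in> {1..m}" for k j
    unfolding psis_def by (rule log_root_germ[OF L ind[OF that] yV[OF that]])
  define \<kappa> where "\<kappa> k j = (SOME \<kappa>. germ (\<lambda>x. y k j x * L (y k j x)) =
     psis k (ind k (germ (y k j))) + scale_germ \<kappa> (rt (Isel k) (ind k (germ (y k j)))))" for k j
  have \<kappa>: "germ (\<lambda>x. y k j x * L (y k j x)) =
     psis k (ind k (germ (y k j))) + scale_germ (\<kappa> k j) (rt (Isel k) (ind k (germ (y k j))))" if "j \<in> {1..m}" for k j
    unfolding \<kappa>_def by (rule someI_ex[OF ex[OF that]])
  define r where "r = (\<Sum>k\<in>UNIV. scale_germ (c $ k) (\<Sum>j=1..m. scale_germ (\<kappa> k j) (rt (Isel k) (ind k (germ (y k j))))))"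
  have "r \<in> root_space m M"
    unfolding r_def by (intro germ.subspace_sum[OF subspace_root_space] germ.subspace_scale[OF subspace_root_space] rt_root_space)
  moreover have "chi_germ m y L c = tw psi c + r"
  proof -
    have "chi_germ m y L c = (\<Sum>k\<in>UNIV. scale_germ (c $ k) (\<Sum>j=1..m. germ (\<lambda>x. y k j x * L (y k j x))))"
      unfolding chi_germ_def by (rule germ_lincomb)
    also have "\<dots> = (\<Sum>k\<in>UNIV. scale_germ (c $ k) ((\<Sum>j=1..m. psis k (ind k (germ (y k j)))) +
        (\<Sum>j=1..m. scale_germ (\<kappa> k j) (rt (Isel k) (ind k (germ (y k j)))))))"
      unfolding sum.distrib[symmetric] by (intro sum.cong refl arg_cong2[of _ _ _ _ scale_germ] \<kappa>)
    also have "\<dots> = (\<Sum>k\<in>UNIV. scale_germ (c $ k) (\<Sum>j=1..m. psis k (ind k (germ (y k j))))) + r"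
      by (simp add: r_def germ.scale_right_distrib sum.distrib)
    also have "(\<Sum>k\<in>UNIV. scale_germ (c $ k) (\<Sum>j=1..m. psis k (ind k (germ (y k j))))) = tw psi c"
    proof -
      have "(\<Sum>j=1..m. psis k (ind k (germ (y k j)))) = (\<Sum>s<m. psis k s)" for k
        unfolding sum_roots[of "\<lambda>g. psis k (ind k g)"] unfolding ind_def
        by (rule sum.cong) (simp_all add: inv_into_f_f[OF inj_rt])
      then show ?thesis by (simp add: tw_def psis_def)
    qed
    finally show ?thesis .
  qed
  ultimately show ?thesis by blast
qed

lemma chi_germ_add: "chi_germ m y L (c + d) = chi_germ m y L c + chi_germ m y L d"
  and chi_germ_scale: "chi_germ m y L (a *s c) = scale_germ a (chi_germ m y L c)"
  by (simp_all add: chi_germ_def plus_germ.abs_eq scale_germ.abs_eq distrib_right sum.distrib sum_distrib_left mult.assoc)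

text \<open>The correction from the root space has no coefficients at regular \<beta> in the box, so
  \<open>tw psi c\<close> alone counts there.\<close>

lemma ganalytic_chi: "ganalytic (chi_germ m y L c)"
  and coef_chi: "\<beta> \<in> Reg \<Longrightarrow> coef (chi_germ m y L c) \<beta> = hat c \<beta> * (of_nat m * coef psi \<beta>)"
proof -
  obtain r where r: "r \<in> root_space m M" "chi_germ m y L c = tw psi c + r" using chi_germ_decomp by blast
  have r': "r \<in> sols" "\<forall>\<beta>\<in>box. regular \<beta> \<longrightarrow> coef r \<beta> = 0" using r(1) unfolding root_space_eq span_phiB_iff by auto
  have an: "ganalytic (tw psi c)" "ganalytic r" using ganalytic_tw[OF ganalytic_psi] ganalytic_sols[OF r'(1)] by auto
  show "ganalytic (chi_germ m y L c)" unfolding r(2) by (rule ganalytic_add[OF an])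
  show "coef (chi_germ m y L c) \<beta> = hat c \<beta> * (of_nat m * coef psi \<beta>)" if "\<beta> \<in> Reg"
    using that r'(2) unfolding r(2) coef_add[OF an] coef_tw[OF ganalytic_psi] by (simp add: Reg_def regular_def)
qed

lemma coef_psi_nonzero: "\<beta> \<in> Reg \<Longrightarrow> coef psi \<beta> \<noteq> 0"
  using gc_nonzero m_nz by (simp add: Reg_def coef_psi_regular)

lemma chi_sols: "c \<in> root_relations m y \<Longrightarrow> chi_germ m y L c \<in> sols"
proof -
  assume c: "c \<in> root_relations m y"
  obtain r where r: "r \<in> root_space m M" "chi_germ m y L c = tw psi c + r" using chi_germ_decomp by blast
  then have "r \<in> sols" unfolding root_space_eq span_phiB_iff by auto
  then show ?thesis unfolding r(2) using tw_psi_sols[OF c] by (intro sols_add)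
qed

text \<open>Membership in the root space would annihilate \<open>hat c\<close> on
  \<open>Reg\<close>, the relation annihilates it on the rest of \<open>Z\<close>, and
  \<open>vv_expand\<close> recovers c from these values.\<close>

lemma chi_not_root_space: "c \<in> root_relations m y \<Longrightarrow> c \<noteq> 0 \<Longrightarrow> chi_germ m y L c \<notin> root_space m M"
proof
  assume c: "c \<in> root_relations m y" "c \<noteq> 0" and r: "chi_germ m y L c \<in> root_space m M"
  have "hat c \<beta> = 0" if b: "\<beta> \<in> Z" for \<beta>
  proof (cases "\<beta> \<in> Reg")
    case True
    then have "coef (chi_germ m y L c) \<beta> = 0" using r unfolding root_space_eq span_phiB_iff by (auto simp: Reg_def)
    then show ?thesis using coef_chi[OF True] coef_psi_nonzero[OF True] m_nz by simp
  next
    case False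
    then show ?thesis using c(1) b by (simp add: root_relations_iff)
  qed
  then have "c = 0" by (subst vv_expand) simp
  then show False using c(2) by simp
qed

lemma chi_image: "chi_germ m y L ` root_relations m y = germ.span (chi_germ m y L ` vv ` Reg)"
proof -
  have "Vector_Spaces.linear (*s) scale_germ (chi_germ m y L)"
    unfolding Vector_Spaces.linear_iff
    using vec.vector_space_axioms germ.vector_space_axioms chi_germ_add chi_germ_scale by blast
  from module_hom.span_image[OF this[unfolded linear_iff_module_hom], of "vv ` Reg"] show ?thesis unfolding root_relations_eq by simp
qed

text \<open>The germs belonging to \<open>vv \<beta>\<close> have a diagonal matrix of coefficients
  at the indices in \<open>Reg\<close>.\<close>

lemma dim_chi: "germ.dim (chi_germ m y L ` root_relations m y) = card Reg"
proof -
  have nz: "hat (vv b) b \<noteq> 0" if "b \<in> Reg" for b using that Reg_Z m_nz by (auto simp: hat_vv)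
  have z: "hat (vv b) b' = 0" if "b \<in> Reg" "b' \<in> Reg" "b \<noteq> b'" for b b' using that Reg_Z by (subst hat_vv) auto
  note ind = germ_independent_diag[of Reg "\<lambda>\<beta>. chi_germ m y L (vv \<beta>)", OF finite_Reg ganalytic_chi]
  have "inj_on (\<lambda>\<beta>. chi_germ m y L (vv \<beta>)) Reg" "germ.independent ((\<lambda>\<beta>. chi_germ m y L (vv \<beta>)) ` Reg)"
    using ind nz z coef_chi coef_psi_nonzero m_nz by simp_all
  then show ?thesis unfolding chi_image image_image germ.dim_span
    by (simp add: germ.dim_eq_card_independent card_image)
qed

lemma chi_inter: "chi_germ m y L ` root_relations m y \<inter> root_space m M = {0}"
proof -
  have 0: "chi_germ m y L 0 = 0" using chi_germ_scale[of 0 0] by simp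
  have R0: "0 \<in> root_relations m y" unfolding root_relations_eq by (rule vec.span_zero)
  have "0 \<in> root_space m M" unfolding root_space_def by (rule germ.span_zero)
  moreover have "0 \<in> chi_germ m y L ` root_relations m y" using 0 R0 by (metis imageI)
  ultimately show ?thesis using chi_not_root_space 0 by auto
qed

lemma chi_sum: "{s + r | s r. s \<in> chi_germ m y L ` root_relations m y \<and> r \<in> root_space m M} = sols"
proof
  show "{s + r | s r. s \<in> chi_germ m y L ` root_relations m y \<and> r \<in> root_space m M} \<subseteq> sols"
    using chi_sols by (auto simp: root_space_iff intro!: sols_add)
  show "sols \<subseteq> {s + r | s r. s \<in> chi_germ m y L ` root_relations m y \<and> r \<in> root_space m M}"
  proof
    fix h assume h: "h \<in> sols"
    have mn: "(of_nat m :: complex) ^ CARD('n) \<noteq> 0" using m_nz by simp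
    \<comment> \<open>Solves \<open>coef_chi\<close> for \<open>hat c\<close>: the transform of c at
      \<beta> is \<open>a \<beta>\<close> times m^n, so \<chi>_c acquires the coefficients of h on
      \<open>Reg\<close>, and the difference lies in the root space.\<close>
    define a where "a \<beta> = coef h \<beta> / (of_nat m ^ CARD('n) * (of_nat m * coef psi \<beta>))" for \<beta>
    define c where "c = (\<Sum>\<beta>\<in>Reg. a \<beta> *s vv \<beta>)"
    have cR: "c \<in> root_relations m y"
      unfolding c_def root_relations_eq by (intro vec.span_sum vec.span_scale vec.span_base imageI)
    have hc: "hat c \<beta> = a \<beta> * of_nat m ^ CARD('n)" if "\<beta> \<in> Reg" for \<beta>
    proof -
      have "hat c \<beta> = (\<Sum>\<gamma>\<in>Reg. if \<beta> = \<gamma> then a \<beta> * of_nat m ^ CARD('n) else 0)"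
        unfolding c_def hat_sum hat_scale using \<open>\<beta> \<in> Reg\<close> Reg_Z by (intro sum.cong) (auto simp: hat_vv subset_iff)
      then show ?thesis using finite_Reg \<open>\<beta> \<in> Reg\<close> by simp
    qed
    define r where "r = h - chi_germ m y L c"
    have "r \<in> sols" unfolding r_def by (rule germ.subspace_diff[OF subspace_sols h chi_sols[OF cR]])
    moreover have "coef r \<beta> = 0" if "\<beta> \<in> box" "regular \<beta>" for \<beta>
    proof -
      have b: "\<beta> \<in> Reg" using that by (simp add: Reg_def)
      have "coef r \<beta> = coef h \<beta> - coef (chi_germ m y L c) \<beta>"
        unfolding r_def by (rule coef_diff[OF ganalytic_sols[OF h] ganalytic_chi])
      then show ?thesis unfolding coef_chi[OF b] hc[OF b] a_def using mn m_nz coef_psi_nonzero[OF b] by simp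
    qed
    ultimately have "r \<in> root_space m M" unfolding root_space_eq span_phiB_iff by blast
    moreover have "h = chi_germ m y L c + r" by (simp add: r_def)
    ultimately show "h \<in> {s + r | s r. s \<in> chi_germ m y L ` root_relations m y \<and> r \<in> root_space m M}"
      using cR by blast
  qed
qed

end

end

theorem theorem4p3:
  fixes m :: nat
    and M :: "'n::{finite,linorder} \<Rightarrow> nat"
    and G :: "'k::finite \<Rightarrow> (int, 'n) vec set"
  assumes M_range: "\<forall>i. 0 < M i \<and> M i < m"
    and M_decreasing: "\<forall>i j. i < j \<longrightarrow> M j < M i"
    and coprime: "Gcd (insert m (range M)) = 1"
    and card_classes: "CARD('k) = m ^ (CARD('n) - 1)"
    and classes: "bij_betw G UNIV (index_box m // same_class m M)"
  shows
    "(root_space m M = mellin_solutions m M \<inter> algebraic_germs \<and>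
      germ.dim (root_space m M) =
        (if M (Min UNIV) = m - 1 then m ^ CARD('n) - m ^ (CARD('n) - 1) + 1
         else m ^ CARD('n) - m ^ (CARD('n) - 1)))
     \<and>
     (\<forall>(Isel :: 'k \<Rightarrow> (int, 'n) vec) (y :: 'k \<Rightarrow> nat \<Rightarrow> (complex, 'n) vec \<Rightarrow> complex).
        (\<forall>k. Isel k \<in> G k) \<and>
        (\<forall>k. bij_betw (\<lambda>j. germ (y k j)) {1..m} (root_germs m M (Isel k)))
        \<longrightarrow>
        vec.dim (root_relations m y) =
          (if M (Min UNIV) = m - 1 then m ^ (CARD('n) - 1) - 1 else m ^ (CARD('n) - 1))
        \<and>
        (\<forall>V L. log_branch_on V L \<and> (\<forall>k. \<forall>j\<in>{1..m}. \<forall>\<^sub>F x in nhds 0. y k j x \<in> V)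
           \<longrightarrow>
           (\<forall>c\<in>root_relations m y. c \<noteq> 0 \<longrightarrow>
              chi_germ m y L c \<in> mellin_solutions m M \<and>
              chi_germ m y L c \<notin> algebraic_germs) \<and>
           germ.dim (chi_germ m y L ` root_relations m y) = vec.dim (root_relations m y) \<and>
           chi_germ m y L ` root_relations m y \<inter> root_space m M = {0} \<and>
           {s + r | s r. s \<in> chi_germ m y L ` root_relations m y \<and> r \<in> root_space m M}
             = mellin_solutions m M))"
proof -
  interpret mellin_classes m M G
    by unfold_locales (use M_range M_decreasing coprime card_classes classes in auto)
  show ?thesis
  proof (intro conjI allI impI)
    show "root_space m M = mellin_solutions m M \<inter> algebraic_germs" by (rule root_space_iff)
    show "germ.dim (root_space m M) = (if M (Min UNIV) = m - 1 then m ^ CARD('n) - m ^ (CARD('n) - 1) + 1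
         else m ^ CARD('n) - m ^ (CARD('n) - 1))"
      unfolding dim_root_space by (rule card_NR)
    fix Isel :: "'k \<Rightarrow> (int, 'n) vec" and y :: "'k \<Rightarrow> nat \<Rightarrow> (complex, 'n) vec \<Rightarrow> complex"
    assume "(\<forall>k. Isel k \<in> G k) \<and> (\<forall>k. bij_betw (\<lambda>j. germ (y k j)) {1..m} (root_germs m M (Isel k)))"
    then interpret mellin_roots m M G Isel y by unfold_locales auto
    show "vec.dim (root_relations m y) =
          (if M (Min UNIV) = m - 1 then m ^ (CARD('n) - 1) - 1 else m ^ (CARD('n) - 1))"
      unfolding dim_root_relations by (rule card_Reg)
    fix V L
    assume "log_branch_on V L \<and> (\<forall>k. \<forall>j\<in>{1..m}. \<forall>\<^sub>F x in nhds 0. y k j x \<in> V)"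
    then have L: "log_branch_on V L" "\<And>k j. j \<in> {1..m} \<Longrightarrow> \<forall>\<^sub>F x in nhds 0. y k j x \<in> V" by auto
    show "\<forall>c\<in>root_relations m y. c \<noteq> 0 \<longrightarrow>
              chi_germ m y L c \<in> mellin_solutions m M \<and> chi_germ m y L c \<notin> algebraic_germs"
      \<comment> \<open>An algebraic \<chi>_c would lie in the root space, which consists of the
        algebraic solutions.\<close>
      using chi_sols[OF L] chi_not_root_space[OF L] root_space_iff by blast
    show "germ.dim (chi_germ m y L ` root_relations m y) = vec.dim (root_relations m y)"
      using dim_chi[OF L] dim_root_relations by simp
    show "chi_germ m y L ` root_relations m y \<inter> root_space m M = {0}" by (rule chi_inter[OF L])
    show "{s + r | s r. s \<in> chi_germ m y L ` root_relations m y \<and> r \<in> root_space m M} = mellin_solutions m M"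
      by (rule chi_sum[OF L])
  qed
qed

end
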